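(* Let $U\in\mathcal{B}(\mathcal{X})$ and $V\in\mathcal{B}(\mathcal{Y})$ with $\mathcal{X}$ and $\mathcal{Y}$ essentially incomparable Banach spaces. Then: (1) $U$ and $V$ are never equivalent after one-sided extension (EAOE); (2) $U$ and $V$ are Schur coupled (SC) if and only if $U$ and $V$ are Fredholm with index $0$ and $\dim\operatorname{Ker}U=\dim\operatorname{Ker}V$ (and thus $\dim\operatorname{Coker}U=\dim\operatorname{Coker}V$); (3) $U$ and $V$ are equivalent after extension (EAE) if and only if $U$ and $V$ are Fredholm with $\dim\operatorname{Ker}U=\dim\operatorname{Ker}V$ and $\dim\operatorname{Coker}U=\dim\operatorname{Coker}V$. In particular, SC and EAE do not coincide: there exist Banach spaces $\mathcal{X},\mathcal{Y}$ and operators $U\in\mathcal{B}(\mathcal{X})$, $V\in\mathcal{B}(\mathcal{Y})$ that are EAE but not SC.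
   Context: All Banach spaces are complex. $\mathcal{B}(\mathcal{V},\mathcal{W})$ is the space of bounded linear operators from $\mathcal{V}$ to $\mathcal{W}$, and $\mathcal{B}(\mathcal{V})=\mathcal{B}(\mathcal{V},\mathcal{V})$. "Operator" means bounded linear operator; "invertible" means with bounded inverse. Equivalent after extension (EAE): $U\in\mathcal{B}(\mathcal{X})$ and $V\in\mathcal{B}(\mathcal{Y})$ are EAE if there exist Banach spaces $\mathcal{X}_0,\mathcal{Y}_0$ and invertible operators $E\in\mathcal{B}(\mathcal{Y}\oplus\mathcal{Y}_0,\mathcal{X}\oplus\mathcal{X}_0)$ and $F\in\mathcal{B}(\mathcal{X}\oplus\mathcal{X}_0,\mathcal{Y}\oplus\mathcal{Y}_0)$ with $U\oplus I_{\mathcal{X}_0}=E\,(V\oplus I_{\mathcal{Y}_0})\,F$. Equivalent after one-sided extension (EAOE): EAE can be established with $\mathcal{X}_0=\{0\}$ or with $\mathcal{Y}_0=\{0\}$. Schur coupled (SC): there exists a block operator $\begin{bmatrix}A&B\\C&D\end{bmatrix}\in\mathcal{B}(\mathcal{X}\oplus\mathcal{Y})$ with $A\in\mathcal{B}(\mathcal{X})$ and $D\in\mathcal{B}(\mathcal{Y})$ invertible such that $U=A-BD^{-1}C$ and $V=D-CA^{-1}B$. An operator is Fredholm if it has closed complementable range, complementable kernel, and its kernel and cokernel (a complement of the range) are finite dimensional; it has index $0$ if kernel and cokernel have equal dimension. An operator $S\in\mathcal{B}(\mathcal{X},\mathcal{Y})$ is inessential if $I_{\mathcal{X}}-TS$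 is Fredholm for every $T\in\mathcal{B}(\mathcal{Y},\mathcal{X})$. The Banach spaces $\mathcal{X}$ and $\mathcal{Y}$ are essentially incomparable if every operator in $\mathcal{B}(\mathcal{X},\mathcal{Y})$ is inessential.
   Formalization: Part (1) is stated only for X and Y both infinite dimensional: if either space is finite dimensional it fails, e.g. X = Y = C with U = V = I are EAOE with zero extension spaces; parts (2) and (3) hold for all Banach spaces. *)

theory Defs
  imports "HOL-Analysis.Analysis" "HOL-Algebra.AbelCoset" "HOL-Algebra.Module"
begin

section \<open>Complex Banach spaces with explicit carriers\<close>

text \<open>
  Equivalence after extension quantifies existentially over Banach spaces, which rules out
  representing a Banach space by a type. A space is a HOL-Algebra module record over the complex
  numbers together with a norm; the record fields for multiplication and one, inherited
  from rings, carry no meaning. Operators are HOL functions, and only their values on the carrier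
  matter.
\<close>

definition complex_scalars :: "complex ring"
  where "complex_scalars = \<lparr>carrier = UNIV, mult = (*), one = 1, zero = 0, add = (+)\<rparr>"

record 'a nspace = "(complex, 'a) module" +
  vnorm :: "'a \<Rightarrow> real"

text \<open>
  Outside the carrier the distance is set to 0, since the locale \<^locale>\<open>Metric_space\<close> requires
  nonnegativity and symmetry of the distance on the whole type.
\<close>

definition vdist :: "'a nspace \<Rightarrow> 'a \<Rightarrow> 'a \<Rightarrow> real"
  where "vdist X x y =
    (if x \<in> carrier X \<and> y \<in> carrier X then vnorm X (x \<ominus>\<^bsub>X\<^esub> y) else 0)"

locale banach_space = Module.module complex_scalars X for X :: "'a nspace" (structure) +
  assumes vnorm_nonneg: "x \<in> carrier X \<Longrightarrow> 0 \<le> vnorm X x"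
    and vnorm_eq_0_iff: "x \<in> carrier X \<Longrightarrow> vnorm X x = 0 \<longleftrightarrow> x = \<zero>\<^bsub>X\<^esub>"
    and vnorm_smult: "x \<in> carrier X \<Longrightarrow> vnorm X (c \<odot>\<^bsub>X\<^esub> x) = cmod c * vnorm X x"
    and vnorm_triangle: "x \<in> carrier X \<Longrightarrow> y \<in> carrier X \<Longrightarrow>
      vnorm X (x \<oplus>\<^bsub>X\<^esub> y) \<le> vnorm X x + vnorm X y"
    and complete: "Metric_space.mcomplete (carrier X) (vdist X)"

text \<open>
  The sum norm is one of the equivalent standard norms on a direct sum of two Banach spaces;
  everything below depends on norms only up to equivalence.
\<close>

definition dsum :: "'a nspace \<Rightarrow> 'b nspace \<Rightarrow> ('a \<times> 'b) nspace"  (infixr \<open>\<oplus>\<^sub>B\<close> 65)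
  where "X \<oplus>\<^sub>B Y =
    \<lparr>carrier = carrier X \<times> carrier Y, mult = undefined, one = undefined,
     zero = (\<zero>\<^bsub>X\<^esub>, \<zero>\<^bsub>Y\<^esub>),
     add = (\<lambda>(x, y) (x', y'). (x \<oplus>\<^bsub>X\<^esub> x', y \<oplus>\<^bsub>Y\<^esub> y')),
     smult = (\<lambda>c (x, y). (c \<odot>\<^bsub>X\<^esub> x, c \<odot>\<^bsub>Y\<^esub> y)),
     vnorm = (\<lambda>(x, y). vnorm X x + vnorm Y y)\<rparr>"


section \<open>Bounded operators\<close>

definition bounded_ops :: "'a nspace \<Rightarrow> 'b nspace \<Rightarrow> ('a \<Rightarrow> 'b) set"  (\<open>\<B>\<close>)
  where "\<B> X Y = {T. T \<in> carrier X \<rightarrow> carrier Y \<and>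
    (\<forall>x\<in>carrier X. \<forall>y\<in>carrier X. T (x \<oplus>\<^bsub>X\<^esub> y) = T x \<oplus>\<^bsub>Y\<^esub> T y) \<and>
    (\<forall>c. \<forall>x\<in>carrier X. T (c \<odot>\<^bsub>X\<^esub> x) = c \<odot>\<^bsub>Y\<^esub> T x) \<and>
    (\<exists>K. \<forall>x\<in>carrier X. vnorm Y (T x) \<le> K * vnorm X x)}"

definition inverse_ops :: "'a nspace \<Rightarrow> 'b nspace \<Rightarrow> ('a \<Rightarrow> 'b) \<Rightarrow> ('b \<Rightarrow> 'a) \<Rightarrow> bool"
  where "inverse_ops X Y T S \<longleftrightarrow> T \<in> \<B> X Y \<and> S \<in> \<B> Y X \<and>
    (\<forall>x\<in>carrier X. S (T x) = x) \<and> (\<forall>y\<in>carrier Y. T (S y) = y)"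

definition invertible_op :: "'a nspace \<Rightarrow> 'b nspace \<Rightarrow> ('a \<Rightarrow> 'b) \<Rightarrow> bool"
  where "invertible_op X Y T \<longleftrightarrow> (\<exists>S. inverse_ops X Y T S)"


section \<open>Dimension and complemented subspaces\<close>

text \<open>A finite basis of \<open>M\<close>: every vector of \<open>M\<close> is a unique linear combination.\<close>

definition finite_basis :: "'a nspace \<Rightarrow> 'a set \<Rightarrow> 'a set \<Rightarrow> bool"
  where "finite_basis X M B \<longleftrightarrow> finite B \<and> B \<subseteq> M \<and>
    (\<forall>x\<in>M. \<exists>!a. a \<in> extensional B \<and> x = (\<Oplus>\<^bsub>X\<^esub>b\<in>B. a b \<odot>\<^bsub>X\<^esub> b))"

definition finite_dim :: "'a nspace \<Rightarrow> 'a set \<Rightarrow> bool"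
  where "finite_dim X M \<longleftrightarrow> (\<exists>B. finite_basis X M B)"

text \<open>Meaningful only for finite-dimensional \<open>M\<close>.\<close>

definition vdim :: "'a nspace \<Rightarrow> 'a set \<Rightarrow> nat"
  where "vdim X M = card (SOME B. finite_basis X M B)"

definition closed_subspace :: "'a nspace \<Rightarrow> 'a set \<Rightarrow> bool"
  where "closed_subspace X M \<longleftrightarrow> submodule M complex_scalars X \<and>
    closedin (Metric_space.mtopology (carrier X) (vdist X)) M"

definition complements :: "'a nspace \<Rightarrow> 'a set \<Rightarrow> 'a set \<Rightarrow> bool"
  where "complements X M N \<longleftrightarrow> closed_subspace X M \<and> closed_subspace X N \<and>
    M \<inter> N = {\<zero>\<^bsub>X\<^esub>} \<and> M <+>\<^bsub>X\<^esub> N = carrier X"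

definition complemented :: "'a nspace \<Rightarrow> 'a set \<Rightarrow> bool"
  where "complemented X M \<longleftrightarrow> (\<exists>N. complements X M N)"


section \<open>Fredholm operators\<close>

definition Ran :: "'a nspace \<Rightarrow> ('a \<Rightarrow> 'b) \<Rightarrow> 'b set"
  where "Ran X T = T ` carrier X"

abbreviation Ker :: "'a nspace \<Rightarrow> 'b nspace \<Rightarrow> ('a \<Rightarrow> 'b) \<Rightarrow> 'a set"
  where "Ker X Y T \<equiv> a_kernel X Y T"

text \<open>
  A chosen complement of the range; any two complements of the range are isomorphic to the
  quotient by the range. Meaningful only if the range is complemented.
\<close>

definition Coker :: "'a nspace \<Rightarrow> 'b nspace \<Rightarrow> ('a \<Rightarrow> 'b) \<Rightarrow> 'b set"
  where "Coker X Y T = (SOME N. complements Y (Ran X T) N)"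

definition fredholm :: "'a nspace \<Rightarrow> 'b nspace \<Rightarrow> ('a \<Rightarrow> 'b) \<Rightarrow> bool"
  where "fredholm X Y T \<longleftrightarrow> T \<in> \<B> X Y \<and>
    complemented Y (Ran X T) \<and> complemented X (Ker X Y T) \<and>
    finite_dim X (Ker X Y T) \<and> finite_dim Y (Coker X Y T)"

definition fredholm_index_0 :: "'a nspace \<Rightarrow> 'b nspace \<Rightarrow> ('a \<Rightarrow> 'b) \<Rightarrow> bool"
  where "fredholm_index_0 X Y T \<longleftrightarrow> fredholm X Y T \<and>
    vdim X (Ker X Y T) = vdim Y (Coker X Y T)"


section \<open>Essentially incomparable Banach spaces\<close>

definition inessential :: "'a nspace \<Rightarrow> 'b nspace \<Rightarrow> ('a \<Rightarrow> 'b) \<Rightarrow> bool"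
  where "inessential X Y S \<longleftrightarrow> S \<in> \<B> X Y \<and>
    (\<forall>T\<in>\<B> Y X. fredholm X X (\<lambda>x. x \<ominus>\<^bsub>X\<^esub> T (S x)))"

definition essentially_incomparable :: "'a nspace \<Rightarrow> 'b nspace \<Rightarrow> bool"
  where "essentially_incomparable X Y \<longleftrightarrow> (\<forall>S\<in>\<B> X Y. inessential X Y S)"


section \<open>Equivalence after extension and Schur coupling\<close>

text \<open>
  The operator \<open>U \<oplus> I\<close> is \<open>map_prod U id\<close>.
\<close>

definition EAE_via :: "'a nspace \<Rightarrow> 'b nspace \<Rightarrow> ('a \<Rightarrow> 'a) \<Rightarrow> ('b \<Rightarrow> 'b) \<Rightarrow>
    'c nspace \<Rightarrow> 'd nspace \<Rightarrow> bool"
  where "EAE_via X Y U V X\<^sub>0 Y\<^sub>0 \<longleftrightarrow> banach_space X\<^sub>0 \<and> banach_space Y\<^sub>0 \<and>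
    (\<exists>E F. invertible_op (Y \<oplus>\<^sub>B Y\<^sub>0) (X \<oplus>\<^sub>B X\<^sub>0) E \<and> invertible_op (X \<oplus>\<^sub>B X\<^sub>0) (Y \<oplus>\<^sub>B Y\<^sub>0) F \<and>
      (\<forall>z\<in>carrier (X \<oplus>\<^sub>B X\<^sub>0). map_prod U id z = E (map_prod V id (F z))))"

text \<open>
  In the next two definitions the type \<open>'u\<close> is the universe of Banach spaces: the given spaces
  and the extension spaces all have carriers in \<open>'u\<close>. Results polymorphic in \<open>'u\<close> cover arbitrary
  carriers, since finitely many spaces can be moved into a common type by injections.
\<close>

definition EAE :: "'u nspace \<Rightarrow> 'u nspace \<Rightarrow> ('u \<Rightarrow> 'u) \<Rightarrow> ('u \<Rightarrow> 'u) \<Rightarrow> bool"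
  where "EAE X Y U V \<longleftrightarrow> (\<exists>(X\<^sub>0 :: 'u nspace) (Y\<^sub>0 :: 'u nspace). EAE_via X Y U V X\<^sub>0 Y\<^sub>0)"

definition EAOE :: "'u nspace \<Rightarrow> 'u nspace \<Rightarrow> ('u \<Rightarrow> 'u) \<Rightarrow> ('u \<Rightarrow> 'u) \<Rightarrow> bool"
  where "EAOE X Y U V \<longleftrightarrow> (\<exists>(X\<^sub>0 :: 'u nspace) (Y\<^sub>0 :: 'u nspace). EAE_via X Y U V X\<^sub>0 Y\<^sub>0 \<and>
    (carrier X\<^sub>0 = {\<zero>\<^bsub>X\<^sub>0\<^esub>} \<or> carrier Y\<^sub>0 = {\<zero>\<^bsub>Y\<^sub>0\<^esub>}))"

definition block_op :: "'a nspace \<Rightarrow> 'b nspace \<Rightarrow>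
    ('a \<Rightarrow> 'a) \<Rightarrow> ('b \<Rightarrow> 'a) \<Rightarrow> ('a \<Rightarrow> 'b) \<Rightarrow> ('b \<Rightarrow> 'b) \<Rightarrow> 'a \<times> 'b \<Rightarrow> 'a \<times> 'b"
  where "block_op X Y A B C D = (\<lambda>(x, y). (A x \<oplus>\<^bsub>X\<^esub> B y, C x \<oplus>\<^bsub>Y\<^esub> D y))"

definition SC :: "'a nspace \<Rightarrow> 'b nspace \<Rightarrow> ('a \<Rightarrow> 'a) \<Rightarrow> ('b \<Rightarrow> 'b) \<Rightarrow> bool"
  where "SC X Y U V \<longleftrightarrow> (\<exists>A\<in>\<B> X X. \<exists>B\<in>\<B> Y X. \<exists>C\<in>\<B> X Y. \<exists>D\<in>\<B> Y Y.
    block_op X Y A B C D \<in> \<B> (X \<oplus>\<^sub>B Y) (X \<oplus>\<^sub>B Y) \<and>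
    (\<exists>A' D'. inverse_ops X X A A' \<and> inverse_ops Y Y D D' \<and>
      (\<forall>x\<in>carrier X. U x = A x \<ominus>\<^bsub>X\<^esub> B (D' (C x))) \<and>
      (\<forall>y\<in>carrier Y. V y = D y \<ominus>\<^bsub>Y\<^esub> C (A' (B y)))))"

end

theory Submission
  imports Defs
begin

text \<open>
  A Fredholm operator \<open>T\<close> with kernel of dimension \<open>n\<close> and cokernel of dimension \<open>m\<close> is encoded by
  an invertible operator matrix bordering \<open>T\<close> with the coordinate spaces of dimension \<open>n\<close> and \<open>m\<close>; the
  boundedness of its entries comes from the open mapping theorem. Given such matrices for \<open>U\<close> and \<open>V\<close>, explicit
  formulas produce the operators needed for an equivalence after extension, with extension spaces \<open>Y\<close>
  and \<open>X\<close>, and, if the index is 0, for a Schur coupling.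

  Conversely, an equivalence after extension yields \<open>W\<close> such that \<open>I - U W\<close> and \<open>I - W U\<close> factor
  through \<open>Y\<close>. If \<open>X\<close> and \<open>Y\<close> are essentially incomparable, \<open>U W\<close> and \<open>W U\<close> are Fredholm, hence so
  is \<open>U\<close>. For a Schur coupling, \<open>A\<^sup>-\<^sup>1 U = I - K\<close> where \<open>I - t K\<close> is Fredholm for all real \<open>t\<close>, so the
  index is 0 because it is locally constant in \<open>t\<close>. An equivalence after one-sided extension would
  embed \<open>X\<close> or \<open>Y\<close> as a complemented subspace of the other space.

  The right shifts on \<open>c\<^sub>0\<close> and on the space of square-summable sequences are equivalent after
  extension. They are not Schur coupled, since operators from \<open>c\<^sub>0\<close> to a Hilbert space are small on
  tails.
\<close>

section \<open>Linear algebra over explicit carriers\<close>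

text \<open>Essential incomparability of \<open>X\<close> and \<open>Y\<close>, as defined, yields
  Fredholm operators on \<open>X\<close> only, and its symmetry is not established here. Hence every
  fact about \<open>V\<close> is carried over from \<open>U\<close> along the equivalence
  (\<open>fdata_transfer\<close>); for this purpose a Schur coupling is first turned into an
  equivalence after extension.

  Dimensions and cokernels are defined by arbitrary choices. Bordering an operator by coordinate
  spaces replaces "Fredholm with defects \<open>n\<close> and \<open>m\<close>" by finitely many
  equations between bounded operators, so the constructions reduce to identities of vectors. Such an
  identity is checked by applying an arbitrary linear functional to both sides, which leaves complex
  arithmetic.

  Index 0 is detected by \<open>index0\<close>, bijectivity up to finite rank: near an operator with
  defects \<open>n\<close> and \<open>m\<close> this holds exactly if \<open>n = m\<close>.

  The final example does not rely on incomparability of \<open>c0\<close> and \<open>l2\<close>;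
  smallness on tails replaces it.\<close>

lemma complex_scalars_simps [simp]:
  "carrier complex_scalars = UNIV" "a \<oplus>\<^bsub>complex_scalars\<^esub> b = a + b"
  "a \<otimes>\<^bsub>complex_scalars\<^esub> b = a * b" "\<one>\<^bsub>complex_scalars\<^esub> = 1" "\<zero>\<^bsub>complex_scalars\<^esub> = 0"
  by (simp_all add: complex_scalars_def)

lemma cring_complex_scalars: "cring complex_scalars"
proof (rule cringI)
  show "abelian_group complex_scalars"
  proof (rule abelian_groupI)
    fix x :: complex
    show "\<exists>y\<in>carrier complex_scalars. y \<oplus>\<^bsub>complex_scalars\<^esub> x = \<zero>\<^bsub>complex_scalars\<^esub>"
      by (rule bexI[of _ "- x"]) auto
  qed (auto simp: algebra_simps)
  show "comm_monoid complex_scalars"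
    by (rule comm_monoidI) (auto simp: algebra_simps)
qed (auto simp: algebra_simps)

lemma minus_complex_scalars [simp]: "\<ominus>\<^bsub>complex_scalars\<^esub> a = - a"
proof -
  interpret cring complex_scalars by (rule cring_complex_scalars)
  show ?thesis by (rule minus_equality) auto
qed

text \<open>Closure under negation is contained in scaling by -1; \<open>subsp_iff_submodule\<close>
  connects this with the submodules used in \<open>closed_subspace\<close>.\<close>

definition subsp :: "'a nspace \<Rightarrow> 'a set \<Rightarrow> bool"
  where "subsp X M \<longleftrightarrow> M \<subseteq> carrier X \<and> \<zero>\<^bsub>X\<^esub> \<in> M \<and>
    (\<forall>x\<in>M. \<forall>y\<in>M. x \<oplus>\<^bsub>X\<^esub> y \<in> M) \<and> (\<forall>c. \<forall>x\<in>M. c \<odot>\<^bsub>X\<^esub> x \<in> M)"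

text \<open>No continuity is asked for: these functionals only test equality of vectors, so Zorn's
  lemma supplies enough of them without a Hahn-Banach argument.\<close>

definition lfun :: "'a nspace \<Rightarrow> ('a \<Rightarrow> complex) set"
  where "lfun X = {f. (\<forall>x\<in>carrier X. \<forall>y\<in>carrier X. f (x \<oplus>\<^bsub>X\<^esub> y) = f x + f y) \<and>
    (\<forall>c. \<forall>x\<in>carrier X. f (c \<odot>\<^bsub>X\<^esub> x) = c * f x)}"

text \<open>\<open>ev\<close> keeps the rewrite rules for linear functionals first-order.\<close>

definition ev :: "('a \<Rightarrow> complex) \<Rightarrow> 'a \<Rightarrow> complex"
  where "ev f x = f x"

section \<open>Vector identities and separating functionals\<close>

locale vspace = Module.module complex_scalars X for X :: "'a nspace" (structure)
begin

lemma zero_in [simp]: "\<zero> \<in> carrier X" by (rule M.zero_closed)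
lemma add_in [simp]: "x \<in> carrier X \<Longrightarrow> y \<in> carrier X \<Longrightarrow> x \<oplus> y \<in> carrier X" by (rule M.a_closed)
lemma neg_in [simp]: "x \<in> carrier X \<Longrightarrow> \<ominus> x \<in> carrier X" by (rule M.a_inv_closed)
lemma minus_in [simp]: "x \<in> carrier X \<Longrightarrow> y \<in> carrier X \<Longrightarrow> x \<ominus> y \<in> carrier X" by (rule M.minus_closed)
lemma smult_in [simp]: "x \<in> carrier X \<Longrightarrow> c \<odot> x \<in> carrier X" by simp

lemma neg_smult: "x \<in> carrier X \<Longrightarrow> \<ominus> x = (-1) \<odot> x"
  using smult_l_minus[of 1 x] smult_one[of x] by simp

lemma smult_add: "x \<in> carrier X \<Longrightarrow> (a + b) \<odot> x = a \<odot> x \<oplus> b \<odot> x"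
  using smult_l_distr[of a b x] by simp

lemma smult_smult: "x \<in> carrier X \<Longrightarrow> a \<odot> (b \<odot> x) = (a * b) \<odot> x"
  using smult_assoc1[of a b x] by simp

lemma smult_1 [simp]: "x \<in> carrier X \<Longrightarrow> 1 \<odot> x = x"
  using smult_one[of x] by simp

lemma smult_0 [simp]: "x \<in> carrier X \<Longrightarrow> 0 \<odot> x = \<zero>"
  using smult_l_null[of x] by simp

lemma smult_zero [simp]: "c \<odot> \<zero> = \<zero>"
  using smult_r_null[of c] by simp

lemma smult_distr: "x \<in> carrier X \<Longrightarrow> y \<in> carrier X \<Longrightarrow> c \<odot> (x \<oplus> y) = c \<odot> x \<oplus> c \<odot> y"
  using smult_r_distr[of c x y] by simp

lemma minus_self: "x \<in> carrier X \<Longrightarrow> x \<ominus> x = \<zero>" 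
  by (simp add: a_minus_def M.r_neg)

lemma subsp_minus: "subsp X M \<Longrightarrow> x \<in> M \<Longrightarrow> y \<in> M \<Longrightarrow> x \<ominus> y \<in> M"
  by (metis (no_types, lifting) a_minus_def neg_smult subsetD subsp_def)

lemma subsp_iff_submodule: "subsp X M \<longleftrightarrow> submodule M complex_scalars X"
proof
  assume M: "subsp X M"
  show "submodule M complex_scalars X"
    by (rule submoduleI) (use M in \<open>auto simp: subsp_def neg_smult subset_eq\<close>)
next
  assume M: "submodule M complex_scalars X"
  note E = submoduleE[OF M]
  obtain x where "x \<in> M" using E(2) by auto
  then have "\<zero> \<in> M" using E(4)[of 0 x] E(1) by (auto simp: subset_eq)
  then show "subsp X M" using E by (auto simp: subsp_def)
qed

lemma lfun_rules:
  assumes "f \<in> lfun X"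
  shows "x \<in> carrier X \<Longrightarrow> y \<in> carrier X \<Longrightarrow> f (x \<oplus> y) = f x + f y"
    "x \<in> carrier X \<Longrightarrow> f (c \<odot> x) = c * f x"
    "f \<zero> = 0"
    "x \<in> carrier X \<Longrightarrow> f (\<ominus> x) = - f x"
    "x \<in> carrier X \<Longrightarrow> y \<in> carrier X \<Longrightarrow> f (x \<ominus> y) = f x - f y"
proof -
  show 1: "x \<in> carrier X \<Longrightarrow> y \<in> carrier X \<Longrightarrow> f (x \<oplus> y) = f x + f y" for x y
    using assms by (auto simp: lfun_def)
  show 2: "x \<in> carrier X \<Longrightarrow> f (c \<odot> x) = c * f x" for x c
    using assms by (auto simp: lfun_def)
  show "f \<zero> = 0" using 2[of \<zero> 0] by simp
  show 3: "x \<in> carrier X \<Longrightarrow> f (\<ominus> x) = - f x" for x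
    using 2[of x "-1"] by (simp add: neg_smult)
  show "x \<in> carrier X \<Longrightarrow> y \<in> carrier X \<Longrightarrow> f (x \<ominus> y) = f x - f y"
    using 1[of x "\<ominus> y"] 3[of y] by (simp add: a_minus_def)
qed

text \<open>A maximal subspace avoiding \<open>x\<close> is a hyperplane.\<close>

lemma separating_functional:
  assumes x: "x \<in> carrier X" "x \<noteq> \<zero>"
  shows "\<exists>f\<in>lfun X. f x \<noteq> 0"
proof -
  define \<A> where "\<A> = {M. subsp X M \<and> x \<notin> M}"
  have "{\<zero>} \<in> \<A>" using x by (auto simp: \<A>_def subsp_def)
  then have ne: "\<A> \<noteq> {}" by blast
  have chain: "\<Union>\<C> \<in> \<A>" if c: "\<C> \<noteq> {}" "subset.chain \<A> \<C>" for \<C>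
  proof -
    have sub: "\<And>M. M \<in> \<C> \<Longrightarrow> M \<in> \<A>" and tot: "\<And>M N. M \<in> \<C> \<Longrightarrow> N \<in> \<C> \<Longrightarrow> M \<subseteq> N \<or> N \<subseteq> M"
      using c(2) by (auto simp: subset_chain_def)
    have "a \<oplus> b \<in> \<Union>\<C>" if ab: "a \<in> \<Union>\<C>" "b \<in> \<Union>\<C>" for a b
    proof -
      obtain M N where MN: "M \<in> \<C>" "a \<in> M" "N \<in> \<C>" "b \<in> N" using ab by blast
      from tot[OF MN(1,3)] show ?thesis
      proof
        assume "M \<subseteq> N"
        then show ?thesis using MN sub[OF MN(3)] by (intro UnionI[OF MN(3)]) (auto simp: \<A>_def subsp_def)
      next
        assume "N \<subseteq> M"
        then show ?thesis using MN sub[OF MN(1)] by (intro UnionI[OF MN(1)]) (auto simp: \<A>_def subsp_def)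
      qed
    qed
    then show ?thesis using sub c(1) unfolding \<A>_def subsp_def by blast
  qed
  obtain M where M: "M \<in> \<A>" and max: "\<And>N. N \<in> \<A> \<Longrightarrow> M \<subseteq> N \<Longrightarrow> N = M"
    using subset_Zorn_nonempty[OF ne chain] by blast
  have sM: "subsp X M" and xM: "x \<notin> M" using M by (auto simp: \<A>_def)
  have Min: "\<And>m. m \<in> M \<Longrightarrow> m \<in> carrier X" and M0: "\<zero> \<in> M"
    and Madd: "\<And>a b. a \<in> M \<Longrightarrow> b \<in> M \<Longrightarrow> a \<oplus> b \<in> M" and Msm: "\<And>c a. a \<in> M \<Longrightarrow> c \<odot> a \<in> M"
    using sM by (auto simp: subsp_def)
  \<comment> \<open>Every \<open>y\<close> agrees modulo \<open>M\<close> with a multiple of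
    \<open>x\<close>. If \<open>y\<close> lies outside \<open>M\<close>, maximality puts
    \<open>x\<close> into the span of \<open>M\<close> and \<open>y\<close>; the coefficient of
    \<open>y\<close> is nonzero because \<open>x\<close> is not in \<open>M\<close>, so the relation
    can be solved for \<open>y\<close>.\<close>
  have ex: "\<exists>c. y \<oplus> c \<odot> x \<in> M" if y: "y \<in> carrier X" for y
  proof (cases "y \<in> M")
    case True
    then show ?thesis by (intro exI[of _ 0]) (use x y in simp)
  next
    case False
    define N where "N = {m \<oplus> a \<odot> y | m a. m \<in> M}"
    have MN: "M \<subseteq> N"
    proof
      fix m assume "m \<in> M"
      then show "m \<in> N" unfolding N_def using Min[of m] y by (intro CollectI exI[of _ m] exI[of _ 0]) simp
    qed
    have yN: "y \<in> N" unfolding N_def using M0 y by (intro CollectI exI[of _ \<zero>] exI[of _ 1]) simp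
    have "subsp X N" unfolding subsp_def
    proof (intro conjI ballI allI)
      show "N \<subseteq> carrier X" using Min y by (auto simp: N_def)
      show "\<zero> \<in> N" using MN M0 by auto
      fix u v assume "u \<in> N" "v \<in> N"
      then obtain m a n b where *: "m \<in> M" "n \<in> M" "u = m \<oplus> a \<odot> y" "v = n \<oplus> b \<odot> y"
        by (auto simp: N_def)
      have "u \<oplus> v = (m \<oplus> n) \<oplus> (a + b) \<odot> y"
        using * Min y by (simp add: smult_add M.a_ac)
      then show "u \<oplus> v \<in> N" unfolding N_def using * Madd by blast
    next
      fix c u assume "u \<in> N"
      then obtain m a where *: "m \<in> M" "u = m \<oplus> a \<odot> y" by (auto simp: N_def)
      have "c \<odot> u = c \<odot> m \<oplus> (c * a) \<odot> y"
        using * Min y by (simp add: smult_distr smult_smult)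
      then show "c \<odot> u \<in> N" unfolding N_def using * Msm by blast
    qed
    then have "x \<in> N" using max[of N] MN yN False by (auto simp: \<A>_def)
    then obtain m a where ma: "m \<in> M" "x = m \<oplus> a \<odot> y" by (auto simp: N_def)
    have a0: "a \<noteq> 0" using ma xM Min y by auto
    have "y \<oplus> (- 1 / a) \<odot> x = (-1/a) \<odot> m"
    proof -
      have "(- 1 / a) \<odot> x = (-1/a) \<odot> m \<oplus> (-1) \<odot> y"
        using ma Min[of m] y a0 by (simp add: smult_distr smult_smult)
      then have "y \<oplus> (- 1 / a) \<odot> x = (-1/a) \<odot> m \<oplus> (y \<oplus> \<ominus> y)"
        using ma Min[of m] y by (simp add: neg_smult[symmetric] M.a_ac)
      then show ?thesis using Min[OF ma(1)] y by (simp add: M.r_neg)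
    qed
    then show ?thesis using Msm[OF ma(1)] by metis
  qed
  have uniq: "c = d" if y: "y \<in> carrier X" and c: "y \<oplus> c \<odot> x \<in> M" and d: "y \<oplus> d \<odot> x \<in> M" for y c d
  proof (rule ccontr)
    assume ne: "c \<noteq> d"
    have "(y \<oplus> c \<odot> x) \<oplus> (-1) \<odot> (y \<oplus> d \<odot> x) \<in> M" using Madd Msm c d by blast
    also have "(y \<oplus> c \<odot> x) \<oplus> (-1) \<odot> (y \<oplus> d \<odot> x) = (y \<oplus> \<ominus> y) \<oplus> (c \<odot> x \<oplus> (-d) \<odot> x)"
      using y x by (simp add: smult_distr smult_smult neg_smult M.a_ac)
    also have "\<dots> = (c - d) \<odot> x" using y x smult_add[of x c "-d"] by (simp add: M.r_neg)
    finally have "(1 / (c - d)) \<odot> ((c - d) \<odot> x) \<in> M" by (rule Msm)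
    then show False using ne x xM by (simp add: smult_smult)
  qed
  \<comment> \<open>Minus the coefficient of \<open>x\<close> in the decomposition of
    \<open>y\<close> along \<open>M\<close>; the sign explains the value -1 at
    \<open>x\<close>.\<close>
  define g where "g y = (THE c. y \<oplus> c \<odot> x \<in> M)" for y
  have g: "y \<oplus> g y \<odot> x \<in> M" if "y \<in> carrier X" for y
    unfolding g_def by (rule theI') (use ex uniq that in blast)
  have gI: "g y = c" if "y \<in> carrier X" "y \<oplus> c \<odot> x \<in> M" for y c
    using g uniq that by blast
  have "g \<in> lfun X" unfolding lfun_def
  proof (intro CollectI conjI ballI allI)
    fix y z assume yz: "y \<in> carrier X" "z \<in> carrier X"
    have "(y \<oplus> z) \<oplus> (g y + g z) \<odot> x = (y \<oplus> g y \<odot> x) \<oplus> (z \<oplus> g z \<odot> x)"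
      using yz x by (simp add: smult_add M.a_ac)
    then show "g (y \<oplus> z) = g y + g z" using g yz Madd by (intro gI) auto
  next
    fix c y assume y: "y \<in> carrier X"
    have "c \<odot> y \<oplus> (c * g y) \<odot> x = c \<odot> (y \<oplus> g y \<odot> x)"
      using y x by (simp add: smult_distr smult_smult)
    then show "g (c \<odot> y) = c * g y" using g y Msm by (intro gI) auto
  qed
  moreover have "g x = -1"
    by (rule gI) (use x M0 in \<open>simp_all add: neg_smult[symmetric] M.r_neg\<close>)
  ultimately show ?thesis by (intro bexI[of _ g]) auto
qed

text \<open>The standard way to prove vector identities below: \<open>ev_rules\<close> turns both
  sides into complex expressions, which simplification can compare.\<close>

lemma vec_eqI:
  assumes "a \<in> carrier X" "b \<in> carrier X" "\<And>f. f \<in> lfun X \<Longrightarrow> ev f a = ev f b"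
  shows "a = b"
proof -
  have "f (a \<ominus> b) = 0" if "f \<in> lfun X" for f
    using lfun_rules(5)[OF that, of a b] assms that by (simp add: ev_def)
  then have "a \<ominus> b = \<zero>" using separating_functional[of "a \<ominus> b"] assms by auto
  then show ?thesis using assms using M.minus_equality[of a "\<ominus> b"] by (simp add: a_minus_def)
qed


lemma ev_rules:
  assumes "f \<in> lfun X"
  shows "x \<in> carrier X \<Longrightarrow> y \<in> carrier X \<Longrightarrow> ev f (x \<oplus> y) = ev f x + ev f y"
    "x \<in> carrier X \<Longrightarrow> ev f (c \<odot> x) = c * ev f x"
    "ev f \<zero> = 0"
    "x \<in> carrier X \<Longrightarrow> ev f (\<ominus> x) = - ev f x"
    "x \<in> carrier X \<Longrightarrow> y \<in> carrier X \<Longrightarrow> ev f (x \<ominus> y) = ev f x - ev f y"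
  unfolding ev_def by (fact lfun_rules[OF assms])+

lemma minus_eq_zero_iff: "x \<in> carrier X \<Longrightarrow> y \<in> carrier X \<Longrightarrow> x \<ominus> y = \<zero> \<longleftrightarrow> x = y"
  using M.minus_equality[of x "\<ominus> y"] minus_self by (auto simp: a_minus_def)

end

lemmas vec_simps [simp] = vspace.zero_in vspace.add_in vspace.neg_in vspace.minus_in vspace.smult_in
  vspace.smult_1 vspace.smult_0 vspace.smult_zero

lemmas vec_ev = vspace.ev_rules

section \<open>Linear maps and direct sums\<close>

definition Lin :: "'a nspace \<Rightarrow> 'b nspace \<Rightarrow> ('a \<Rightarrow> 'b) set"
  where "Lin X Y = {T. T \<in> carrier X \<rightarrow> carrier Y \<and>
    (\<forall>x\<in>carrier X. \<forall>y\<in>carrier X. T (x \<oplus>\<^bsub>X\<^esub> y) = T x \<oplus>\<^bsub>Y\<^esub> T y) \<and>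
    (\<forall>c. \<forall>x\<in>carrier X. T (c \<odot>\<^bsub>X\<^esub> x) = c \<odot>\<^bsub>Y\<^esub> T x)}"

lemma Lin_rules:
  assumes X: "vspace X" and Y: "vspace Y" and T: "T \<in> Lin X Y"
  shows "x \<in> carrier X \<Longrightarrow> T x \<in> carrier Y"
    "x \<in> carrier X \<Longrightarrow> y \<in> carrier X \<Longrightarrow> T (x \<oplus>\<^bsub>X\<^esub> y) = T x \<oplus>\<^bsub>Y\<^esub> T y"
    "x \<in> carrier X \<Longrightarrow> T (c \<odot>\<^bsub>X\<^esub> x) = c \<odot>\<^bsub>Y\<^esub> T x"
    "T \<zero>\<^bsub>X\<^esub> = \<zero>\<^bsub>Y\<^esub>"
    "x \<in> carrier X \<Longrightarrow> T (\<ominus>\<^bsub>X\<^esub> x) = \<ominus>\<^bsub>Y\<^esub> T x"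
    "x \<in> carrier X \<Longrightarrow> y \<in> carrier X \<Longrightarrow> T (x \<ominus>\<^bsub>X\<^esub> y) = T x \<ominus>\<^bsub>Y\<^esub> T y"
proof -
  interpret X: vspace X by (rule X)
  interpret Y: vspace Y by (rule Y)
  show 1: "x \<in> carrier X \<Longrightarrow> T x \<in> carrier Y" for x
    using T by (auto simp: Lin_def)
  show 2: "x \<in> carrier X \<Longrightarrow> y \<in> carrier X \<Longrightarrow> T (x \<oplus>\<^bsub>X\<^esub> y) = T x \<oplus>\<^bsub>Y\<^esub> T y" for x y
    using T by (auto simp: Lin_def)
  show 3: "x \<in> carrier X \<Longrightarrow> T (c \<odot>\<^bsub>X\<^esub> x) = c \<odot>\<^bsub>Y\<^esub> T x" for x c
    using T by (auto simp: Lin_def)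
  show "T \<zero>\<^bsub>X\<^esub> = \<zero>\<^bsub>Y\<^esub>" using 3[of "\<zero>\<^bsub>X\<^esub>" 0] 1[of "\<zero>\<^bsub>X\<^esub>"] by (metis X.smult_0 X.zero_in Y.smult_0)
  show 4: "x \<in> carrier X \<Longrightarrow> T (\<ominus>\<^bsub>X\<^esub> x) = \<ominus>\<^bsub>Y\<^esub> T x" for x
    using 3[of x "-1"] 1 by (simp add: X.neg_smult Y.neg_smult)
  show "x \<in> carrier X \<Longrightarrow> y \<in> carrier X \<Longrightarrow> T (x \<ominus>\<^bsub>X\<^esub> y) = T x \<ominus>\<^bsub>Y\<^esub> T y"
    using 2[of x "\<ominus>\<^bsub>X\<^esub> y"] 4[of y] by (simp add: a_minus_def)
qed

lemma Lin_I:
  assumes "\<And>x. x \<in> carrier X \<Longrightarrow> T x \<in> carrier Y"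
    "\<And>x y. x \<in> carrier X \<Longrightarrow> y \<in> carrier X \<Longrightarrow> T (x \<oplus>\<^bsub>X\<^esub> y) = T x \<oplus>\<^bsub>Y\<^esub> T y"
    "\<And>c x. x \<in> carrier X \<Longrightarrow> T (c \<odot>\<^bsub>X\<^esub> x) = c \<odot>\<^bsub>Y\<^esub> T x"
  shows "T \<in> Lin X Y"
  using assms by (auto simp: Lin_def)

lemma Lin_comp: "T \<in> Lin Y Z \<Longrightarrow> S \<in> Lin X Y \<Longrightarrow> (\<lambda>x. T (S x)) \<in> Lin X Z"
  by (auto simp: Lin_def Pi_iff)

lemma Lin_id: "(\<lambda>x. x) \<in> Lin X X"
  by (auto simp: Lin_def)

lemma Lin_add:
  assumes Y: "vspace Y" and S: "S \<in> Lin X Y" and T: "T \<in> Lin X Y"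
  shows "(\<lambda>x. S x \<oplus>\<^bsub>Y\<^esub> T x) \<in> Lin X Y"
proof (rule Lin_I)
  fix x y assume "x \<in> carrier X" "y \<in> carrier X"
  then show "S (x \<oplus>\<^bsub>X\<^esub> y) \<oplus>\<^bsub>Y\<^esub> T (x \<oplus>\<^bsub>X\<^esub> y) = S x \<oplus>\<^bsub>Y\<^esub> T x \<oplus>\<^bsub>Y\<^esub> (S y \<oplus>\<^bsub>Y\<^esub> T y)"
    using S T Y by (intro vspace.vec_eqI[OF Y]) (auto simp: Lin_def Pi_iff vec_ev)
next
  fix c x assume "x \<in> carrier X"
  then show "S (c \<odot>\<^bsub>X\<^esub> x) \<oplus>\<^bsub>Y\<^esub> T (c \<odot>\<^bsub>X\<^esub> x) = c \<odot>\<^bsub>Y\<^esub> (S x \<oplus>\<^bsub>Y\<^esub> T x)"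
    using S T Y by (intro vspace.vec_eqI[OF Y]) (auto simp: Lin_def Pi_iff vec_ev algebra_simps)
qed (use S T Y in \<open>auto simp: Lin_def Pi_iff\<close>)

lemma Lin_smult:
  assumes Y: "vspace Y" and T: "T \<in> Lin X Y"
  shows "(\<lambda>x. a \<odot>\<^bsub>Y\<^esub> T x) \<in> Lin X Y"
proof (rule Lin_I)
  fix x y assume "x \<in> carrier X" "y \<in> carrier X"
  then show "a \<odot>\<^bsub>Y\<^esub> T (x \<oplus>\<^bsub>X\<^esub> y) = a \<odot>\<^bsub>Y\<^esub> T x \<oplus>\<^bsub>Y\<^esub> a \<odot>\<^bsub>Y\<^esub> T y"
    using T Y by (intro vspace.vec_eqI[OF Y]) (auto simp: Lin_def Pi_iff vec_ev algebra_simps)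
next
  fix c x assume "x \<in> carrier X"
  then show "a \<odot>\<^bsub>Y\<^esub> T (c \<odot>\<^bsub>X\<^esub> x) = c \<odot>\<^bsub>Y\<^esub> (a \<odot>\<^bsub>Y\<^esub> T x)"
    using T Y by (intro vspace.vec_eqI[OF Y]) (auto simp: Lin_def Pi_iff vec_ev algebra_simps)
qed (use T Y in \<open>auto simp: Lin_def Pi_iff\<close>)

lemma Lin_minus:
  assumes Y: "vspace Y" and S: "S \<in> Lin X Y" and T: "T \<in> Lin X Y"
  shows "(\<lambda>x. S x \<ominus>\<^bsub>Y\<^esub> T x) \<in> Lin X Y"
proof (rule Lin_I)
  fix x y assume "x \<in> carrier X" "y \<in> carrier X"
  then show "S (x \<oplus>\<^bsub>X\<^esub> y) \<ominus>\<^bsub>Y\<^esub> T (x \<oplus>\<^bsub>X\<^esub> y) = S x \<ominus>\<^bsub>Y\<^esub> T x \<oplus>\<^bsub>Y\<^esub> (S y \<ominus>\<^bsub>Y\<^esub> T y)"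
    using S T Y by (intro vspace.vec_eqI[OF Y]) (auto simp: Lin_def Pi_iff vec_ev)
next
  fix c x assume "x \<in> carrier X"
  then show "S (c \<odot>\<^bsub>X\<^esub> x) \<ominus>\<^bsub>Y\<^esub> T (c \<odot>\<^bsub>X\<^esub> x) = c \<odot>\<^bsub>Y\<^esub> (S x \<ominus>\<^bsub>Y\<^esub> T x)"
    using S T Y by (intro vspace.vec_eqI[OF Y]) (auto simp: Lin_def Pi_iff vec_ev algebra_simps)
qed (use S T Y in \<open>auto simp: Lin_def Pi_iff\<close>)

lemma Lin_zero: "vspace Y \<Longrightarrow> (\<lambda>x. \<zero>\<^bsub>Y\<^esub>) \<in> Lin X Y"
  by (rule Lin_I) (auto intro!: vspace.vec_eqI[of Y] simp: vec_ev)

subsection \<open>Direct sums\<close>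

lemma dsum_simps [simp]:
  "carrier (X \<oplus>\<^sub>B Y) = carrier X \<times> carrier Y"
  "\<zero>\<^bsub>X \<oplus>\<^sub>B Y\<^esub> = (\<zero>\<^bsub>X\<^esub>, \<zero>\<^bsub>Y\<^esub>)"
  "(x, y) \<oplus>\<^bsub>X \<oplus>\<^sub>B Y\<^esub> (x', y') = (x \<oplus>\<^bsub>X\<^esub> x', y \<oplus>\<^bsub>Y\<^esub> y')"
  "c \<odot>\<^bsub>X \<oplus>\<^sub>B Y\<^esub> (x, y) = (c \<odot>\<^bsub>X\<^esub> x, c \<odot>\<^bsub>Y\<^esub> y)"
  "vnorm (X \<oplus>\<^sub>B Y) (x, y) = vnorm X x + vnorm Y y"
  by (simp_all add: dsum_def)

lemma vspaceI:
  assumes "\<zero>\<^bsub>X\<^esub> \<in> carrier X"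
    "\<And>x y. x \<in> carrier X \<Longrightarrow> y \<in> carrier X \<Longrightarrow> x \<oplus>\<^bsub>X\<^esub> y \<in> carrier X"
    "\<And>c x. x \<in> carrier X \<Longrightarrow> c \<odot>\<^bsub>X\<^esub> x \<in> carrier X"
    "\<And>x y z. x \<in> carrier X \<Longrightarrow> y \<in> carrier X \<Longrightarrow> z \<in> carrier X \<Longrightarrow>
      (x \<oplus>\<^bsub>X\<^esub> y) \<oplus>\<^bsub>X\<^esub> z = x \<oplus>\<^bsub>X\<^esub> (y \<oplus>\<^bsub>X\<^esub> z)"
    "\<And>x y. x \<in> carrier X \<Longrightarrow> y \<in> carrier X \<Longrightarrow> x \<oplus>\<^bsub>X\<^esub> y = y \<oplus>\<^bsub>X\<^esub> x"
    "\<And>x. x \<in> carrier X \<Longrightarrow> \<zero>\<^bsub>X\<^esub> \<oplus>\<^bsub>X\<^esub> x = x"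
    "\<And>x. x \<in> carrier X \<Longrightarrow> (-1) \<odot>\<^bsub>X\<^esub> x \<oplus>\<^bsub>X\<^esub> x = \<zero>\<^bsub>X\<^esub>"
    "\<And>a b x. x \<in> carrier X \<Longrightarrow> (a + b) \<odot>\<^bsub>X\<^esub> x = a \<odot>\<^bsub>X\<^esub> x \<oplus>\<^bsub>X\<^esub> b \<odot>\<^bsub>X\<^esub> x"
    "\<And>a x y. x \<in> carrier X \<Longrightarrow> y \<in> carrier X \<Longrightarrow> a \<odot>\<^bsub>X\<^esub> (x \<oplus>\<^bsub>X\<^esub> y) = a \<odot>\<^bsub>X\<^esub> x \<oplus>\<^bsub>X\<^esub> a \<odot>\<^bsub>X\<^esub> y"
    "\<And>a b x. x \<in> carrier X \<Longrightarrow> (a * b) \<odot>\<^bsub>X\<^esub> x = a \<odot>\<^bsub>X\<^esub> (b \<odot>\<^bsub>X\<^esub> x)"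
    "\<And>x. x \<in> carrier X \<Longrightarrow> 1 \<odot>\<^bsub>X\<^esub> x = x"
  shows "vspace X"
proof -
  have "abelian_group X"
    by (rule abelian_groupI) (use assms in blast)+
  then show ?thesis unfolding vspace_def
    by (rule moduleI[OF cring_complex_scalars]) (use assms in auto)
qed

lemma vspace_dsum [simp]:
  assumes "vspace X" "vspace Y"
  shows "vspace (X \<oplus>\<^sub>B Y)"
  by (rule vspaceI)
    (use assms in \<open>auto intro!: vspace.vec_eqI[of X] vspace.vec_eqI[of Y] simp: vec_ev algebra_simps\<close>)

lemma dsum_minus [simp]:
  assumes "vspace X" "vspace Y" "x \<in> carrier X" "x' \<in> carrier X" "y \<in> carrier Y" "y' \<in> carrier Y"
  shows "(x, y) \<ominus>\<^bsub>X \<oplus>\<^sub>B Y\<^esub> (x', y') = (x \<ominus>\<^bsub>X\<^esub> x', y \<ominus>\<^bsub>Y\<^esub> y')"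
  using assms vspace_dsum[OF assms(1,2)]
  by (simp add: a_minus_def vspace.neg_smult)

lemma Lin_fst: "fst \<in> Lin (X \<oplus>\<^sub>B Y) X"
  by (rule Lin_I) auto

lemma Lin_snd: "snd \<in> Lin (X \<oplus>\<^sub>B Y) Y"
  by (rule Lin_I) auto

lemma Lin_pair: "S \<in> Lin Z X \<Longrightarrow> T \<in> Lin Z Y \<Longrightarrow> (\<lambda>z. (S z, T z)) \<in> Lin Z (X \<oplus>\<^sub>B Y)"
  by (auto simp: Lin_def Pi_iff)

section \<open>Subspaces, kernels and ranges\<close>

lemma subsp_imp_vspace:
  assumes X: "vspace X" and M: "subsp X M"
  shows "vspace (X\<lparr>carrier := M\<rparr>)"
  by (rule vspaceI)
    (use assms in \<open>auto intro!: vspace.vec_eqI[OF X] simp: vec_ev algebra_simps subsp_def subset_eq\<close>)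

text \<open>Negation in a group record is defined through the carrier, so shrinking the carrier
  changes the term for subtraction. Both versions reduce to scaling by -1, which does not mention
  the carrier.\<close>

lemma subsp_minus_eq:
  assumes X: "vspace X" and M: "subsp X M" and "x \<in> M" "y \<in> M"
  shows "x \<ominus>\<^bsub>X\<lparr>carrier := M\<rparr>\<^esub> y = x \<ominus>\<^bsub>X\<^esub> y"
  using assms vspace.neg_smult[OF X, of y] vspace.neg_smult[OF subsp_imp_vspace[OF X M], of y]
  by (auto simp: a_minus_def subsp_def)

lemma subsp_kernel:
  assumes X: "vspace X" and Y: "vspace Y" and T: "T \<in> Lin X Y"
  shows "subsp X {x \<in> carrier X. T x = \<zero>\<^bsub>Y\<^esub>}"
  using X Y Lin_rules[OF assms] by (auto simp: subsp_def intro!: vspace.vec_eqI[OF Y] simp: vec_ev)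

lemma subsp_range:
  assumes X: "vspace X" and Y: "vspace Y" and T: "T \<in> Lin X Y"
  shows "subsp Y (T ` carrier X)"
  unfolding subsp_def
proof (intro conjI ballI allI)
  note [simp] = Lin_rules[OF assms] X Y
  show "T ` carrier X \<subseteq> carrier Y" by auto
  show "\<zero>\<^bsub>Y\<^esub> \<in> T ` carrier X" by (rule image_eqI[of _ _ "\<zero>\<^bsub>X\<^esub>"]) auto
  fix u v assume "u \<in> T ` carrier X" "v \<in> T ` carrier X"
  then obtain x y where "x \<in> carrier X" "y \<in> carrier X" "u = T x" "v = T y" by auto
  then show "u \<oplus>\<^bsub>Y\<^esub> v \<in> T ` carrier X" by (intro image_eqI[of _ _ "x \<oplus>\<^bsub>X\<^esub> y"]) auto
next
  note [simp] = Lin_rules[OF assms] X Y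
  fix c u assume "u \<in> T ` carrier X"
  then obtain x where "x \<in> carrier X" "u = T x" by auto
  then show "c \<odot>\<^bsub>Y\<^esub> u \<in> T ` carrier X" by (intro image_eqI[of _ _ "c \<odot>\<^bsub>X\<^esub> x"]) auto
qed

section \<open>Norms, completeness and the open mapping theorem\<close>

text \<open>The norm axioms of \<open>banach_space\<close> with completeness split off: the algebra
  of bounded operators and the approximation half of the open mapping theorem work with it, and
  \<open>banach_iff\<close> adds completeness.\<close>

locale normed = vspace +
  assumes nm_nonneg: "x \<in> carrier X \<Longrightarrow> 0 \<le> vnorm X x"
    and nm_eq_0_iff: "x \<in> carrier X \<Longrightarrow> vnorm X x = 0 \<longleftrightarrow> x = \<zero>"
    and nm_smult: "x \<in> carrier X \<Longrightarrow> vnorm X (c \<odot> x) = cmod c * vnorm X x"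
    and nm_triangle: "x \<in> carrier X \<Longrightarrow> y \<in> carrier X \<Longrightarrow> vnorm X (x \<oplus> y) \<le> vnorm X x + vnorm X y"
begin

lemma nm_zero [simp]: "vnorm X \<zero> = 0"
  using nm_eq_0_iff by auto

lemma nm_neg: "x \<in> carrier X \<Longrightarrow> vnorm X (\<ominus> x) = vnorm X x"
  by (simp add: neg_smult nm_smult)

lemma nm_minus: "x \<in> carrier X \<Longrightarrow> y \<in> carrier X \<Longrightarrow> vnorm X (x \<ominus> y) \<le> vnorm X x + vnorm X y"
  using nm_triangle[of x "\<ominus> y"] by (simp add: a_minus_def nm_neg)

lemma nm_minus_commute:
  assumes "x \<in> carrier X" "y \<in> carrier X" shows "vnorm X (x \<ominus> y) = vnorm X (y \<ominus> x)"
proof -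
  have "x \<ominus> y = \<ominus> (y \<ominus> x)"
    using assms by (intro vec_eqI) (auto simp: ev_rules)
  then show ?thesis using assms by (simp add: nm_neg)
qed

lemma nm_minus_triangle:
  assumes "x \<in> carrier X" "y \<in> carrier X" "z \<in> carrier X"
  shows "vnorm X (x \<ominus> z) \<le> vnorm X (x \<ominus> y) + vnorm X (y \<ominus> z)"
proof -
  have "x \<ominus> z = (x \<ominus> y) \<oplus> (y \<ominus> z)"
    using assms by (intro vec_eqI) (auto simp: ev_rules)
  then show ?thesis using assms nm_triangle[of "x \<ominus> y" "y \<ominus> z"] by simp
qed

lemma nm_diff_le:
  assumes "x \<in> carrier X" "y \<in> carrier X" 
  shows "vnorm X x \<le> vnorm X y + vnorm X (x \<ominus> y)"
proof -
  have "x = y \<oplus> (x \<ominus> y)"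
    using assms by (intro vec_eqI) (auto simp: ev_rules)
  then show ?thesis using assms nm_triangle[of y "x \<ominus> y"] by simp
qed

sublocale Met: Metric_space "carrier X" "vdist X"
proof
  show "0 \<le> vdist X x y" for x y by (auto simp: vdist_def nm_nonneg)
  show "vdist X x y = vdist X y x" for x y by (auto simp: vdist_def nm_minus_commute)
  show "x \<in> carrier X \<Longrightarrow> y \<in> carrier X \<Longrightarrow> vdist X x y = 0 \<longleftrightarrow> x = y" for x y
    by (auto simp: vdist_def nm_eq_0_iff minus_eq_zero_iff)
  show "x \<in> carrier X \<Longrightarrow> y \<in> carrier X \<Longrightarrow> z \<in> carrier X \<Longrightarrow> vdist X x z \<le> vdist X x y + vdist X y z" for x y z
    by (auto simp: vdist_def nm_minus_triangle)
qed

section \<open>Topology and completeness in terms of sequences and norms\<close>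

lemma limitin_iff:
  assumes "\<And>n. s n \<in> carrier X"
  shows "limitin Met.mtopology s x sequentially \<longleftrightarrow> x \<in> carrier X \<and> (\<lambda>n. vnorm X (s n \<ominus> x)) \<longlonglongrightarrow> 0"
  using assms by (auto simp: Met.limitin_metric_dist_null vdist_def)

lemma MCauchy_iff:
  "Met.MCauchy s \<longleftrightarrow> (\<forall>n. s n \<in> carrier X) \<and> (\<forall>e>0. \<exists>N. \<forall>m\<ge>N. \<forall>n\<ge>N. vnorm X (s m \<ominus> s n) < e)"
proof -
  have "vdist X (s m) (s n) = vnorm X (s m \<ominus> s n)" if "\<forall>n. s n \<in> carrier X" for m n
    using that by (simp add: vdist_def)
  moreover have "range s \<subseteq> carrier X \<longleftrightarrow> (\<forall>n. s n \<in> carrier X)" by blast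
  ultimately show ?thesis unfolding Met.MCauchy_def by (metis (no_types, lifting))
qed

lemma closedin_iff:
  "closedin Met.mtopology M \<longleftrightarrow> M \<subseteq> carrier X \<and>
    (\<forall>s x. (\<forall>n. s n \<in> M) \<and> x \<in> carrier X \<and> (\<lambda>n. vnorm X (s n \<ominus> x)) \<longlonglongrightarrow> 0 \<longrightarrow> x \<in> M)"
proof -
  have "(range s \<subseteq> M \<and> limitin Met.mtopology s x sequentially \<longrightarrow> x \<in> M) \<longleftrightarrow>
    ((\<forall>n. s n \<in> M) \<and> x \<in> carrier X \<and> (\<lambda>n. vnorm X (s n \<ominus> x)) \<longlonglongrightarrow> 0 \<longrightarrow> x \<in> M)"
    if "M \<subseteq> carrier X" for s x
    using that limitin_iff[of s x] by (auto simp: image_subset_iff subset_eq)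
  then show ?thesis
    unfolding Met.metric_closedin_iff_sequentially_closed by blast
qed

lemma limit_unique:
  assumes s: "\<And>n. s n \<in> carrier X" and x: "x \<in> carrier X" "y \<in> carrier X"
    and "(\<lambda>n. vnorm X (s n \<ominus> x)) \<longlonglongrightarrow> 0" "(\<lambda>n. vnorm X (s n \<ominus> y)) \<longlonglongrightarrow> 0"
  shows "x = y"
  using assms Met.limitin_metric_unique[of s x sequentially y] limitin_iff[OF s] by auto

end

lemma banach_iff:
  "banach_space X \<longleftrightarrow> normed X \<and> (\<forall>s. (\<forall>n. s n \<in> carrier X) \<and>
    (\<forall>e>0. \<exists>N. \<forall>m\<ge>N. \<forall>n\<ge>N. vnorm X (s m \<ominus>\<^bsub>X\<^esub> s n) < e) \<longrightarrow>
    (\<exists>x\<in>carrier X. (\<lambda>n. vnorm X (s n \<ominus>\<^bsub>X\<^esub> x)) \<longlonglongrightarrow> 0))"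
proof -
  have "banach_space X \<longleftrightarrow> normed X \<and> Metric_space.mcomplete (carrier X) (vdist X)"
    unfolding banach_space_def banach_space_axioms_def normed_def normed_axioms_def vspace_def by blast
  moreover have "Metric_space.mcomplete (carrier X) (vdist X) \<longleftrightarrow> (\<forall>s. (\<forall>n. s n \<in> carrier X) \<and>
    (\<forall>e>0. \<exists>N. \<forall>m\<ge>N. \<forall>n\<ge>N. vnorm X (s m \<ominus>\<^bsub>X\<^esub> s n) < e) \<longrightarrow>
    (\<exists>x\<in>carrier X. (\<lambda>n. vnorm X (s n \<ominus>\<^bsub>X\<^esub> x)) \<longlonglongrightarrow> 0))" if "normed X"
  proof -
    interpret normed X by (rule that)
    have "(\<exists>x. limitin Met.mtopology s x sequentially) \<longleftrightarrow>
        (\<exists>x\<in>carrier X. (\<lambda>n. vnorm X (s n \<ominus>\<^bsub>X\<^esub> x)) \<longlonglongrightarrow> 0)"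
      if "\<forall>n. s n \<in> carrier X" for s
      using limitin_iff[of s] that by auto
    then show ?thesis unfolding Met.mcomplete_def MCauchy_iff
      by (intro iff_allI imp_cong refl) blast
  qed
  ultimately show ?thesis by blast
qed

lemma banach_normed: "banach_space X \<Longrightarrow> normed X"
  by (simp add: banach_iff)

lemma normed_vspace [simp]: "normed X \<Longrightarrow> vspace X"
  by (simp add: normed_def)

lemma banach_vspace [simp]: "banach_space X \<Longrightarrow> vspace X"
  by (simp add: banach_normed)

lemma banach_convergent:
  "banach_space X \<Longrightarrow> (\<And>n. s n \<in> carrier X) \<Longrightarrow>
    (\<And>e. e > 0 \<Longrightarrow> \<exists>N. \<forall>m\<ge>N. \<forall>n\<ge>N. vnorm X (s m \<ominus>\<^bsub>X\<^esub> s n) < e) \<Longrightarrow>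
    \<exists>x\<in>carrier X. (\<lambda>n. vnorm X (s n \<ominus>\<^bsub>X\<^esub> x)) \<longlonglongrightarrow> 0"
  unfolding banach_iff by blast

lemma banach_spaceI:
  assumes "normed X"
    and "\<And>s. (\<And>n. s n \<in> carrier X) \<Longrightarrow>
      (\<And>e. e > 0 \<Longrightarrow> \<exists>N. \<forall>m\<ge>N. \<forall>n\<ge>N. vnorm X (s m \<ominus>\<^bsub>X\<^esub> s n) < e) \<Longrightarrow>
      \<exists>x\<in>carrier X. (\<lambda>n. vnorm X (s n \<ominus>\<^bsub>X\<^esub> x)) \<longlonglongrightarrow> 0"
  shows "banach_space X"
  unfolding banach_iff using assms by blast

section \<open>Algebra of bounded operators\<close>

lemma bounded_ops_iff:
  "T \<in> \<B> X Y \<longleftrightarrow> T \<in> Lin X Y \<and> (\<exists>K. \<forall>x\<in>carrier X. vnorm Y (T x) \<le> K * vnorm X x)"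
  by (auto simp: bounded_ops_def Lin_def)

lemma B_Lin: "T \<in> \<B> X Y \<Longrightarrow> T \<in> Lin X Y"
  by (simp add: bounded_ops_iff)

lemma B_bound:
  assumes X: "normed X" and T: "T \<in> \<B> X Y"
  obtains K where "K > 0" "\<And>x. x \<in> carrier X \<Longrightarrow> vnorm Y (T x) \<le> K * vnorm X x"
proof -
  obtain K where K: "\<forall>x\<in>carrier X. vnorm Y (T x) \<le> K * vnorm X x"
    using T by (auto simp: bounded_ops_iff)
  have "vnorm Y (T x) \<le> (\<bar>K\<bar> + 1) * vnorm X x" if "x \<in> carrier X" for x
  proof -
    have "vnorm Y (T x) \<le> K * vnorm X x" using K that by blast
    also have "\<dots> \<le> (\<bar>K\<bar> + 1) * vnorm X x"
      using normed.nm_nonneg[OF X that] by (intro mult_right_mono) auto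
    finally show ?thesis .
  qed
  then show ?thesis by (intro that[of "\<bar>K\<bar> + 1"]) auto
qed

lemma B_I: "T \<in> Lin X Y \<Longrightarrow> (\<And>x. x \<in> carrier X \<Longrightarrow> vnorm Y (T x) \<le> K * vnorm X x) \<Longrightarrow> T \<in> \<B> X Y"
  by (auto simp: bounded_ops_iff)

lemma B_comp:
  assumes X: "normed X" and Y: "normed Y" and T: "T \<in> \<B> Y Z" and S: "S \<in> \<B> X Y"
  shows "(\<lambda>x. T (S x)) \<in> \<B> X Z"
proof -
  obtain K where K: "K > 0" "\<And>x. x \<in> carrier Y \<Longrightarrow> vnorm Z (T x) \<le> K * vnorm Y x"
    using B_bound[OF Y T] by blast
  obtain L where L: "L > 0" "\<And>x. x \<in> carrier X \<Longrightarrow> vnorm Y (S x) \<le> L * vnorm X x"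
    using B_bound[OF X S] by blast
  show ?thesis
  proof (rule B_I[OF Lin_comp[OF B_Lin[OF T] B_Lin[OF S]]])
    fix x assume x: "x \<in> carrier X"
    then have "S x \<in> carrier Y" using B_Lin[OF S] by (auto simp: Lin_def)
    then have "vnorm Z (T (S x)) \<le> K * vnorm Y (S x)" by (rule K)
    also have "\<dots> \<le> K * (L * vnorm X x)" using K(1) L(2)[OF x] by simp
    finally show "vnorm Z (T (S x)) \<le> (K * L) * vnorm X x" by (simp add: mult.assoc)
  qed
qed

lemma B_id: "(\<lambda>x. x) \<in> \<B> X X"
  by (rule B_I[OF Lin_id, where K = 1]) auto

lemma B_zero: "normed X \<Longrightarrow> normed Y \<Longrightarrow> (\<lambda>x. \<zero>\<^bsub>Y\<^esub>) \<in> \<B> X Y"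
  by (rule B_I[OF Lin_zero, where K = 0]) (auto simp: normed.nm_zero)

lemma B_add:
  assumes X: "normed X" and Y: "normed Y" and S: "S \<in> \<B> X Y" and T: "T \<in> \<B> X Y"
  shows "(\<lambda>x. S x \<oplus>\<^bsub>Y\<^esub> T x) \<in> \<B> X Y"
proof -
  obtain K where K: "\<And>x. x \<in> carrier X \<Longrightarrow> vnorm Y (T x) \<le> K * vnorm X x"
    using B_bound[OF X T] by blast
  obtain L where L: "\<And>x. x \<in> carrier X \<Longrightarrow> vnorm Y (S x) \<le> L * vnorm X x"
    using B_bound[OF X S] by blast
  show ?thesis
  proof (rule B_I[OF Lin_add[OF normed_vspace[OF Y] B_Lin[OF S] B_Lin[OF T]], where K = "L + K"])
    fix x assume x: "x \<in> carrier X"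
    then have "S x \<in> carrier Y" "T x \<in> carrier Y" using B_Lin[OF S] B_Lin[OF T] by (auto simp: Lin_def)
    then show "vnorm Y (S x \<oplus>\<^bsub>Y\<^esub> T x) \<le> (L + K) * vnorm X x"
      using K[OF x] L[OF x] normed.nm_triangle[OF Y, of "S x" "T x"] by (simp add: algebra_simps)
  qed
qed

lemma B_smult:
  assumes X: "normed X" and Y: "normed Y" and T: "T \<in> \<B> X Y"
  shows "(\<lambda>x. c \<odot>\<^bsub>Y\<^esub> T x) \<in> \<B> X Y"
proof -
  obtain K where K: "\<And>x. x \<in> carrier X \<Longrightarrow> vnorm Y (T x) \<le> K * vnorm X x"
    using B_bound[OF X T] by blast
  show ?thesis
  proof (rule B_I[OF Lin_smult[OF normed_vspace[OF Y] B_Lin[OF T]], where K = "cmod c * K"])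
    fix x assume x: "x \<in> carrier X"
    then have "T x \<in> carrier Y" using B_Lin[OF T] by (auto simp: Lin_def)
    then show "vnorm Y (c \<odot>\<^bsub>Y\<^esub> T x) \<le> cmod c * K * vnorm X x"
      using K[OF x] normed.nm_smult[OF Y] by (simp add: mult.assoc mult_left_mono)
  qed
qed

lemma B_cong:
  assumes "vspace X" and T: "T \<in> \<B> X Y" and eq: "\<And>x. x \<in> carrier X \<Longrightarrow> S x = T x"
  shows "S \<in> \<B> X Y"
  using T assms(1) by (auto simp: bounded_ops_def eq Pi_iff)

lemma B_minus:
  assumes X: "normed X" and Y: "normed Y" and S: "S \<in> \<B> X Y" and T: "T \<in> \<B> X Y"
  shows "(\<lambda>x. S x \<ominus>\<^bsub>Y\<^esub> T x) \<in> \<B> X Y"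
proof (rule B_cong[OF normed_vspace[OF X] B_add[OF X Y S B_smult[OF X Y T, of "-1"]]])
  fix x assume x: "x \<in> carrier X"
  then have "T x \<in> carrier Y" using B_Lin[OF T] by (auto simp: Lin_def)
  then show "S x \<ominus>\<^bsub>Y\<^esub> T x = S x \<oplus>\<^bsub>Y\<^esub> (-1) \<odot>\<^bsub>Y\<^esub> T x"
    using vspace.neg_smult[OF normed_vspace[OF Y]] by (simp add: a_minus_def)
qed

lemma B_continuous:
  assumes X: "normed X" and Y: "normed Y" and T: "T \<in> \<B> X Y"
    and s: "\<And>n. s n \<in> carrier X" "x \<in> carrier X" "(\<lambda>n. vnorm X (s n \<ominus>\<^bsub>X\<^esub> x)) \<longlonglongrightarrow> 0"
  shows "(\<lambda>n. vnorm Y (T (s n) \<ominus>\<^bsub>Y\<^esub> T x)) \<longlonglongrightarrow> 0"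
proof -
  obtain K where K: "\<And>x. x \<in> carrier X \<Longrightarrow> vnorm Y (T x) \<le> K * vnorm X x"
    using B_bound[OF X T] by blast
  note [simp] = Lin_rules[OF normed_vspace[OF X] normed_vspace[OF Y] B_Lin[OF T]] X Y
  have "(\<lambda>n. K * vnorm X (s n \<ominus>\<^bsub>X\<^esub> x)) \<longlonglongrightarrow> K * 0"
    by (intro tendsto_mult tendsto_const s)
  then have lim: "(\<lambda>n. K * vnorm X (s n \<ominus>\<^bsub>X\<^esub> x)) \<longlonglongrightarrow> 0" by simp
  show ?thesis
  proof (rule tendsto_sandwich[OF _ _ tendsto_const lim])
    show "\<forall>\<^sub>F n in sequentially. 0 \<le> vnorm Y (T (s n) \<ominus>\<^bsub>Y\<^esub> T x)"
      using s by (intro always_eventually allI normed.nm_nonneg[OF Y]) simp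
    show "\<forall>\<^sub>F n in sequentially. vnorm Y (T (s n) \<ominus>\<^bsub>Y\<^esub> T x) \<le> K * vnorm X (s n \<ominus>\<^bsub>X\<^esub> x)"
      using s K[of "s n \<ominus>\<^bsub>X\<^esub> x" for n] by (intro always_eventually allI) simp
  qed
qed

section \<open>Closed subspaces and direct sums of Banach spaces\<close>

lemma closed_subspace_iff:
  assumes "normed X"
  shows "closed_subspace X M \<longleftrightarrow> subsp X M \<and>
    (\<forall>s x. (\<forall>n. s n \<in> M) \<and> x \<in> carrier X \<and> (\<lambda>n. vnorm X (s n \<ominus>\<^bsub>X\<^esub> x)) \<longlonglongrightarrow> 0 \<longrightarrow> x \<in> M)"
  using assms vspace.subsp_iff_submodule[of X M] unfolding closed_subspace_def
  by (auto simp: normed.closedin_iff subsp_def)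

lemma closed_subspaceI:
  assumes "normed X" "subsp X M"
    and "\<And>s x. (\<And>n. s n \<in> M) \<Longrightarrow> x \<in> carrier X \<Longrightarrow>
      (\<lambda>n. vnorm X (s n \<ominus>\<^bsub>X\<^esub> x)) \<longlonglongrightarrow> 0 \<Longrightarrow> x \<in> M"
  shows "closed_subspace X M"
  using assms(2,3) closed_subspace_iff[OF assms(1), of M] by blast

lemma closed_subspace_kernel:
  assumes X: "normed X" and Y: "normed Y" and T: "T \<in> \<B> X Y"
  shows "closed_subspace X {x \<in> carrier X. T x = \<zero>\<^bsub>Y\<^esub>}"
proof (rule closed_subspaceI[OF X])
  show "subsp X {x \<in> carrier X. T x = \<zero>\<^bsub>Y\<^esub>}"
    using subsp_kernel[OF _ _ B_Lin[OF T]] X Y by simp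
  fix s :: "nat \<Rightarrow> _" and x assume s: "\<And>n. s n \<in> {x \<in> carrier X. T x = \<zero>\<^bsub>Y\<^esub>}" and x: "x \<in> carrier X"
    and lim: "(\<lambda>n. vnorm X (s n \<ominus>\<^bsub>X\<^esub> x)) \<longlonglongrightarrow> 0"
  note [simp] = Lin_rules[OF normed_vspace[OF X] normed_vspace[OF Y] B_Lin[OF T]] X Y
  have "(\<lambda>n. vnorm Y (T (s n) \<ominus>\<^bsub>Y\<^esub> T x)) \<longlonglongrightarrow> 0"
    by (rule B_continuous[OF X Y T _ x lim]) (use s in auto)
  then have "(\<lambda>n. vnorm Y (\<zero>\<^bsub>Y\<^esub> \<ominus>\<^bsub>Y\<^esub> T x)) \<longlonglongrightarrow> 0" using s by simp
  moreover have "(\<lambda>n. vnorm Y (\<zero>\<^bsub>Y\<^esub> \<ominus>\<^bsub>Y\<^esub> \<zero>\<^bsub>Y\<^esub>)) \<longlonglongrightarrow> 0"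
    by (simp add: vspace.minus_self normed.nm_zero)
  ultimately have "T x = \<zero>\<^bsub>Y\<^esub>"
    using x by (intro normed.limit_unique[OF Y, of "\<lambda>_. \<zero>\<^bsub>Y\<^esub>"]) auto
  then show "x \<in> {x \<in> carrier X. T x = \<zero>\<^bsub>Y\<^esub>}" using x by simp
qed

lemma normed_subsp:
  assumes X: "normed X" and M: "subsp X M"
  shows "normed (X\<lparr>carrier := M\<rparr>)"
proof -
  have "vspace (X\<lparr>carrier := M\<rparr>)" using subsp_imp_vspace[OF _ M] X by simp
  then show ?thesis unfolding normed_def normed_axioms_def
    using X M by (auto simp: normed.nm_nonneg normed.nm_eq_0_iff normed.nm_smult normed.nm_triangle subsp_def subset_eq)
qed

lemma banach_closed_subspace:
  assumes X: "banach_space X" and M: "closed_subspace X M"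
  shows "banach_space (X\<lparr>carrier := M\<rparr>)"
proof (rule banach_spaceI)
  note X' = banach_normed[OF X]
  have sM: "subsp X M" using M closed_subspace_iff[OF X'] by blast
  show "normed (X\<lparr>carrier := M\<rparr>)" by (rule normed_subsp[OF X' sM])
  fix s :: "nat \<Rightarrow> _" assume s: "\<And>n. s n \<in> carrier (X\<lparr>carrier := M\<rparr>)"
    and c: "\<And>e. e > 0 \<Longrightarrow> \<exists>N. \<forall>m\<ge>N. \<forall>n\<ge>N. vnorm (X\<lparr>carrier := M\<rparr>) (s m \<ominus>\<^bsub>X\<lparr>carrier := M\<rparr>\<^esub> s n) < e"
  have sn: "s n \<in> M" "s n \<in> carrier X" for n using s sM by (auto simp: subsp_def)
  have meq: "a \<ominus>\<^bsub>X\<lparr>carrier := M\<rparr>\<^esub> b = a \<ominus>\<^bsub>X\<^esub> b" if "a \<in> M" "b \<in> M" for a b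
    using that subsp_minus_eq[OF _ sM] X by simp
  have "\<exists>x\<in>carrier X. (\<lambda>n. vnorm X (s n \<ominus>\<^bsub>X\<^esub> x)) \<longlonglongrightarrow> 0"
    by (rule banach_convergent[OF X]) (use sn c in \<open>auto simp: meq\<close>)
  then obtain x where x: "x \<in> carrier X" "(\<lambda>n. vnorm X (s n \<ominus>\<^bsub>X\<^esub> x)) \<longlonglongrightarrow> 0" by blast
  then have "x \<in> M" using M sn closed_subspace_iff[OF X'] by blast
  then show "\<exists>x\<in>carrier (X\<lparr>carrier := M\<rparr>). (\<lambda>n. vnorm (X\<lparr>carrier := M\<rparr>) (s n \<ominus>\<^bsub>X\<lparr>carrier := M\<rparr>\<^esub> x)) \<longlonglongrightarrow> 0"
    using x sn by (intro bexI[of _ x]) (auto simp: meq)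
qed

lemma normed_dsum:
  assumes X: "normed X" and Y: "normed Y"
  shows "normed (X \<oplus>\<^sub>B Y)"
  unfolding normed_def normed_axioms_def
proof (intro conjI allI impI)
  show "vspace (X \<oplus>\<^sub>B Y)" using X Y by simp
  fix z assume z: "z \<in> carrier (X \<oplus>\<^sub>B Y)"
  then show "0 \<le> vnorm (X \<oplus>\<^sub>B Y) z" "(vnorm (X \<oplus>\<^sub>B Y) z = 0) = (z = \<zero>\<^bsub>X \<oplus>\<^sub>B Y\<^esub>)"
    using normed.nm_nonneg[OF X] normed.nm_nonneg[OF Y] normed.nm_eq_0_iff[OF X] normed.nm_eq_0_iff[OF Y]
    by (auto simp: add_nonneg_eq_0_iff)
  show "vnorm (X \<oplus>\<^sub>B Y) (c \<odot>\<^bsub>X \<oplus>\<^sub>B Y\<^esub> z) = cmod c * vnorm (X \<oplus>\<^sub>B Y) z" for c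
    using z normed.nm_smult[OF X] normed.nm_smult[OF Y] by (auto simp: algebra_simps)
  fix w assume w: "w \<in> carrier (X \<oplus>\<^sub>B Y)"
  obtain x y x' y' where "z = (x, y)" "w = (x', y')" by fastforce
  then show "vnorm (X \<oplus>\<^sub>B Y) (z \<oplus>\<^bsub>X \<oplus>\<^sub>B Y\<^esub> w) \<le> vnorm (X \<oplus>\<^sub>B Y) z + vnorm (X \<oplus>\<^sub>B Y) w"
    using z w normed.nm_triangle[OF X, of x x'] normed.nm_triangle[OF Y, of y y'] by auto
qed

lemma banach_dsum:
  assumes X: "banach_space X" and Y: "banach_space Y"
  shows "banach_space (X \<oplus>\<^sub>B Y)"
proof (rule banach_spaceI)
  note X' = banach_normed[OF X] note Y' = banach_normed[OF Y]
  show "normed (X \<oplus>\<^sub>B Y)" by (rule normed_dsum[OF X' Y'])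
  fix s :: "nat \<Rightarrow> _" assume s: "\<And>n. s n \<in> carrier (X \<oplus>\<^sub>B Y)"
    and c: "\<And>e. e > 0 \<Longrightarrow> \<exists>N. \<forall>m\<ge>N. \<forall>n\<ge>N. vnorm (X \<oplus>\<^sub>B Y) (s m \<ominus>\<^bsub>X \<oplus>\<^sub>B Y\<^esub> s n) < e"
  have sn: "fst (s n) \<in> carrier X" "snd (s n) \<in> carrier Y" for n
    using s[of n] by (auto simp: mem_Times_iff)
  have eq: "vnorm (X \<oplus>\<^sub>B Y) (s m \<ominus>\<^bsub>X \<oplus>\<^sub>B Y\<^esub> (x, y)) =
    vnorm X (fst (s m) \<ominus>\<^bsub>X\<^esub> x) + vnorm Y (snd (s m) \<ominus>\<^bsub>Y\<^esub> y)" if "x \<in> carrier X" "y \<in> carrier Y" for m x y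
    using dsum_minus[of X Y "fst (s m)" x "snd (s m)" y] sn that X Y by simp
  have c': "\<exists>N. \<forall>m\<ge>N. \<forall>n\<ge>N. vnorm X (fst (s m) \<ominus>\<^bsub>X\<^esub> fst (s n)) + vnorm Y (snd (s m) \<ominus>\<^bsub>Y\<^esub> snd (s n)) < e"
    if "e > 0" for e
  proof -
    have "vnorm (X \<oplus>\<^sub>B Y) (s m \<ominus>\<^bsub>X \<oplus>\<^sub>B Y\<^esub> s n) =
      vnorm X (fst (s m) \<ominus>\<^bsub>X\<^esub> fst (s n)) + vnorm Y (snd (s m) \<ominus>\<^bsub>Y\<^esub> snd (s n))" for m n
      using eq[OF sn(1)[of n] sn(2)[of n], of m] by simp
    then show ?thesis using c[OF that] by simp
  qed
  have "\<exists>x\<in>carrier X. (\<lambda>n. vnorm X (fst (s n) \<ominus>\<^bsub>X\<^esub> x)) \<longlonglongrightarrow> 0"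
  proof (rule banach_convergent[OF X])
    fix e :: real assume "e > 0"
    from c'[OF this] obtain N where N: "\<And>m n. m \<ge> N \<Longrightarrow> n \<ge> N \<Longrightarrow> vnorm X (fst (s m) \<ominus>\<^bsub>X\<^esub> fst (s n)) + vnorm Y (snd (s m) \<ominus>\<^bsub>Y\<^esub> snd (s n)) < e"
      by blast
    have "vnorm X (fst (s m) \<ominus>\<^bsub>X\<^esub> fst (s n)) < e" if "m \<ge> N" "n \<ge> N" for m n
      using N[OF that] normed.nm_nonneg[OF Y', of "snd (s m) \<ominus>\<^bsub>Y\<^esub> snd (s n)"] sn Y by simp
    then show "\<exists>N. \<forall>m\<ge>N. \<forall>n\<ge>N. vnorm X (fst (s m) \<ominus>\<^bsub>X\<^esub> fst (s n)) < e" by blast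
  qed (use sn in auto)
  then obtain x where x: "x \<in> carrier X" "(\<lambda>n. vnorm X (fst (s n) \<ominus>\<^bsub>X\<^esub> x)) \<longlonglongrightarrow> 0" by blast
  have "\<exists>y\<in>carrier Y. (\<lambda>n. vnorm Y (snd (s n) \<ominus>\<^bsub>Y\<^esub> y)) \<longlonglongrightarrow> 0"
  proof (rule banach_convergent[OF Y])
    fix e :: real assume "e > 0"
    from c'[OF this] obtain N where N: "\<And>m n. m \<ge> N \<Longrightarrow> n \<ge> N \<Longrightarrow> vnorm X (fst (s m) \<ominus>\<^bsub>X\<^esub> fst (s n)) + vnorm Y (snd (s m) \<ominus>\<^bsub>Y\<^esub> snd (s n)) < e"
      by blast
    have "vnorm Y (snd (s m) \<ominus>\<^bsub>Y\<^esub> snd (s n)) < e" if "m \<ge> N" "n \<ge> N" for m n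
      using N[OF that] normed.nm_nonneg[OF X', of "fst (s m) \<ominus>\<^bsub>X\<^esub> fst (s n)"] sn X by simp
    then show "\<exists>N. \<forall>m\<ge>N. \<forall>n\<ge>N. vnorm Y (snd (s m) \<ominus>\<^bsub>Y\<^esub> snd (s n)) < e" by blast
  qed (use sn in auto)
  then obtain y where y: "y \<in> carrier Y" "(\<lambda>n. vnorm Y (snd (s n) \<ominus>\<^bsub>Y\<^esub> y)) \<longlonglongrightarrow> 0" by blast
  show "\<exists>x\<in>carrier (X \<oplus>\<^sub>B Y). (\<lambda>n. vnorm (X \<oplus>\<^sub>B Y) (s n \<ominus>\<^bsub>X \<oplus>\<^sub>B Y\<^esub> x)) \<longlonglongrightarrow> 0"
    using x y tendsto_add[OF x(2) y(2)] by (intro bexI[of _ "(x, y)"]) (simp_all add: eq)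
qed

lemma B_fst: "normed X \<Longrightarrow> normed Y \<Longrightarrow> fst \<in> \<B> (X \<oplus>\<^sub>B Y) X"
  by (rule B_I[OF Lin_fst, where K = 1]) (auto simp: normed.nm_nonneg)

lemma B_snd: "normed X \<Longrightarrow> normed Y \<Longrightarrow> snd \<in> \<B> (X \<oplus>\<^sub>B Y) Y"
  by (rule B_I[OF Lin_snd, where K = 1]) (auto simp: normed.nm_nonneg)

lemma B_pair:
  assumes Z: "normed Z" and S: "S \<in> \<B> Z X" and T: "T \<in> \<B> Z Y"
  shows "(\<lambda>z. (S z, T z)) \<in> \<B> Z (X \<oplus>\<^sub>B Y)"
proof -
  obtain K where K: "\<And>x. x \<in> carrier Z \<Longrightarrow> vnorm X (S x) \<le> K * vnorm Z x"
    using B_bound[OF Z S] by blast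
  obtain L where L: "\<And>x. x \<in> carrier Z \<Longrightarrow> vnorm Y (T x) \<le> L * vnorm Z x"
    using B_bound[OF Z T] by blast
  show ?thesis
    by (rule B_I[OF Lin_pair[OF B_Lin[OF S] B_Lin[OF T]], where K = "K + L"])
      (use K L in \<open>auto simp: algebra_simps intro!: add_mono\<close>)
qed

section \<open>Open mapping theorem and Neumann's argument\<close>

lemma geometric_convergent:
  assumes X: "banach_space X" and s: "\<And>n. s n \<in> carrier X"
    and step: "\<And>n. vnorm X (s (Suc n) \<ominus>\<^bsub>X\<^esub> s n) \<le> a * (1/2) ^ n"
  shows "\<exists>x\<in>carrier X. (\<lambda>n. vnorm X (s n \<ominus>\<^bsub>X\<^esub> x)) \<longlonglongrightarrow> 0"
proof (rule banach_convergent[OF X s])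
  interpret normed X by (rule banach_normed[OF X])
  have a: "0 \<le> a" using step[of 0] nm_nonneg[of "s (Suc 0) \<ominus>\<^bsub>X\<^esub> s 0"] s by simp
  \<comment> \<open>The right-hand side is the exact sum of the step bounds
    \<open>a * (1/2) ^ l\<close> for \<open>l\<close> from \<open>n\<close> to
    \<open>n + j - 1\<close>.\<close>
  have tele: "vnorm X (s (n + j) \<ominus>\<^bsub>X\<^esub> s n) \<le> 2 * a * ((1/2) ^ n - (1/2) ^ (n + j))" for n j
  proof (induction j)
    case 0
    then show ?case using s by (simp add: minus_self)
  next
    case (Suc j)
    have "vnorm X (s (n + Suc j) \<ominus>\<^bsub>X\<^esub> s n) \<le> vnorm X (s (Suc (n + j)) \<ominus>\<^bsub>X\<^esub> s (n + j)) + vnorm X (s (n + j) \<ominus>\<^bsub>X\<^esub> s n)"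
      using nm_minus_triangle[of "s (Suc (n + j))" "s (n + j)" "s n"] s by simp
    also have "\<dots> \<le> a * (1/2) ^ (n + j) + 2 * a * ((1/2) ^ n - (1/2) ^ (n + j))"
      using Suc step[of "n + j"] by simp
    also have "\<dots> = 2 * a * ((1/2) ^ n - (1/2) ^ (n + Suc j))" by (simp add: algebra_simps)
    finally show ?case .
  qed
  have le: "vnorm X (s m \<ominus>\<^bsub>X\<^esub> s n) \<le> 2 * a * (1/2) ^ n" if "m \<ge> n" for m n
  proof -
    have "vnorm X (s m \<ominus>\<^bsub>X\<^esub> s n) \<le> 2 * a * ((1/2) ^ n - (1/2) ^ m)"
      using tele[of n "m - n"] that by simp
    also have "\<dots> \<le> 2 * a * (1/2) ^ n" using a by (intro mult_left_mono) auto
    finally show ?thesis .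
  qed
  fix e :: real assume e: "e > 0"
  have "(\<lambda>n. 2 * a * (1/2) ^ n) \<longlonglongrightarrow> 2 * a * 0"
    by (intro tendsto_mult tendsto_const LIMSEQ_power_zero) auto
  then have "\<forall>\<^sub>F n in sequentially. 2 * a * (1/2) ^ n < e"
    using e by (intro order_tendstoD(2)) auto
  then obtain N where N: "\<And>n. n \<ge> N \<Longrightarrow> 2 * a * (1/2) ^ n < e"
    unfolding eventually_sequentially by blast
  show "\<exists>N. \<forall>m\<ge>N. \<forall>n\<ge>N. vnorm X (s m \<ominus>\<^bsub>X\<^esub> s n) < e"
  proof (intro exI[of _ N] allI impI)
    fix m n assume mn: "m \<ge> N" "n \<ge> N"
    show "vnorm X (s m \<ominus>\<^bsub>X\<^esub> s n) < e"
    proof (cases "m \<ge> n")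
      case True
      then show ?thesis using le[of n m] N[OF mn(2)] by linarith
    next
      case False
      then show ?thesis using le[of m n] N[OF mn(1)] nm_minus_commute[OF s s, of m n] by simp
    qed
  qed
qed

text \<open>Baire's theorem in the complete space \<open>Y\<close>: the closures of the images of
  the balls of radius \<open>k\<close> cover \<open>Y\<close>, so one of these closures contains a
  ball around some \<open>y\<^sub>0\<close>.\<close>

lemma open_mapping_dense:
  assumes X: "normed X" and Y: "banach_space Y" and T: "T \<in> Lin X Y"
    and surj: "T ` carrier X = carrier Y"
  obtains k :: nat and r y\<^sub>0 where "r > 0" "y\<^sub>0 \<in> carrier Y"
    "\<And>y e. y \<in> carrier Y \<Longrightarrow> vnorm Y (y \<ominus>\<^bsub>Y\<^esub> y\<^sub>0) < r \<Longrightarrow> e > 0 \<Longrightarrow>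
      \<exists>x\<in>carrier X. vnorm X x \<le> real k \<and> vnorm Y (y \<ominus>\<^bsub>Y\<^esub> T x) < e"
proof -
  interpret X: normed X by (rule X)
  interpret Y: normed Y by (rule banach_normed[OF Y])
  note [simp] = Lin_rules[OF normed_vspace[OF X] banach_vspace[OF Y] T]
  define A where "A k = T ` {x \<in> carrier X. vnorm X x \<le> real k}" for k :: nat
  define F where "F k = Y.Met.mtopology closure_of A k" for k
  have AY: "A k \<subseteq> carrier Y" for k by (auto simp: A_def)
  have "(\<Union>k. F k) = carrier Y"
  proof
    show "(\<Union>k. F k) \<subseteq> carrier Y"
      unfolding F_def using closure_of_subset_topspace[of Y.Met.mtopology] by auto
    show "carrier Y \<subseteq> (\<Union>k. F k)"
    proof
      fix y assume "y \<in> carrier Y"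
      then obtain x where x: "x \<in> carrier X" "y = T x" using surj by blast
      obtain k :: nat where "vnorm X x \<le> real k" using real_arch_simple by blast
      then have "y \<in> A k" using x by (auto simp: A_def)
      then have "y \<in> F k"
        using closure_of_subset[of "A k" Y.Met.mtopology] AY[of k] by (auto simp: F_def)
      then show "y \<in> (\<Union>k. F k)" by blast
    qed
  qed
  then have "Y.Met.mtopology interior_of (\<Union>k. F k) = carrier Y"
    using interior_of_topspace[of Y.Met.mtopology] by simp
  moreover have "carrier Y \<noteq> {}" using Y.zero_in by blast
  ultimately have ne: "Y.Met.mtopology interior_of (\<Union>k. F k) \<noteq> {}" by simp
  have "\<exists>k. Y.Met.mtopology interior_of F k \<noteq> {}"
  proof (rule ccontr)
    assume "\<not> ?thesis"
    then have "Y.Met.mtopology interior_of \<Union>(range F) = {}"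
      using Y by (intro Y.Met.metric_Baire_category_alt) (auto simp: F_def banach_space.complete)
    then show False using ne by simp
  qed
  then obtain k y0 where y0: "y0 \<in> Y.Met.mtopology interior_of F k" by blast
  have "openin Y.Met.mtopology (Y.Met.mtopology interior_of F k)" by simp
  then obtain r where r: "r > 0" "Y.Met.mball y0 r \<subseteq> Y.Met.mtopology interior_of F k"
    using y0 unfolding Y.Met.openin_mtopology by blast
  have y0Y: "y0 \<in> carrier Y" using y0 interior_of_subset_topspace[of Y.Met.mtopology "F k"] by auto
  show thesis
  proof (rule that[OF r(1) y0Y])
    fix y and e :: real assume y: "y \<in> carrier Y" "vnorm Y (y \<ominus>\<^bsub>Y\<^esub> y0) < r" and e: "e > 0"
    have "y \<in> Y.Met.mball y0 r"
      using y y0Y Y.nm_minus_commute[of y y0] by (simp add: vdist_def)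
    then have "y \<in> F k" using r(2) interior_of_subset[of Y.Met.mtopology "F k"] by blast
    then obtain z where "z \<in> A k" "z \<in> Y.Met.mball y e"
      using e unfolding F_def Y.Met.metric_closure_of by blast
    then show "\<exists>x\<in>carrier X. vnorm X x \<le> real k \<and> vnorm Y (y \<ominus>\<^bsub>Y\<^esub> T x) < e"
      using y by (auto simp: A_def vdist_def)
  qed
qed

text \<open>The ball from the density statement is centred at \<open>y0\<close>, not at 0.
  Approximating both \<open>y0 + t y\<close> and \<open>y0\<close> and subtracting removes the
  centre; rescaling by \<open>1 / t\<close> leaves half of the norm as error.\<close>

lemma open_mapping_half:
  assumes X: "normed X" and Y: "banach_space Y" and T: "T \<in> Lin X Y"
    and surj: "T ` carrier X = carrier Y"
  obtains C where "C \<ge> 0" "\<And>y. y \<in> carrier Y \<Longrightarrow>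
      \<exists>x\<in>carrier X. vnorm X x \<le> C * vnorm Y y \<and> vnorm Y (y \<ominus>\<^bsub>Y\<^esub> T x) \<le> vnorm Y y / 2"
proof (rule open_mapping_dense[OF assms])
  interpret X: normed X by (rule X)
  interpret Y: normed Y by (rule banach_normed[OF Y])
  note [simp] = Lin_rules[OF normed_vspace[OF X] banach_vspace[OF Y] T]
  fix k :: nat and r y0
  assume r: "r > 0" and y0: "y0 \<in> carrier Y"
    and d: "\<And>y e. y \<in> carrier Y \<Longrightarrow> vnorm Y (y \<ominus>\<^bsub>Y\<^esub> y0) < r \<Longrightarrow> e > 0 \<Longrightarrow>
      \<exists>x\<in>carrier X. vnorm X x \<le> real k \<and> vnorm Y (y \<ominus>\<^bsub>Y\<^esub> T x) < e"
  show thesis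
  proof (rule that[of "4 * real k / r"])
    fix y assume y: "y \<in> carrier Y"
    show "\<exists>x\<in>carrier X. vnorm X x \<le> 4 * real k / r * vnorm Y y \<and> vnorm Y (y \<ominus>\<^bsub>Y\<^esub> T x) \<le> vnorm Y y / 2"
    proof (cases "vnorm Y y = 0")
      case True
      then show ?thesis using y by (intro bexI[of _ "\<zero>\<^bsub>X\<^esub>"]) (auto simp: Y.nm_eq_0_iff Y.minus_self)
    next
      case False
      define n where "n = vnorm Y y"
      have n: "n > 0" using False Y.nm_nonneg[OF y] by (simp add: n_def)
      \<comment> \<open>With this factor \<open>t y\<close> has norm \<open>r / 2\<close>, so
        \<open>y0 + t y\<close> is inside the ball. Two errors of \<open>r / 8\<close>, multiplied
        by \<open>1 / t\<close>, give at most \<open>n / 2\<close>; two vectors of norm at most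
        \<open>k\<close> give the constant \<open>4 k / r\<close>.\<close>
      define t :: complex where "t = complex_of_real (r / (2 * n))"
      have t: "t \<noteq> 0" "cmod t = r / (2 * n)" "cmod (1 / t) = 2 * n / r"
        using n r by (simp_all add: t_def norm_divide norm_mult)
      have "vnorm Y ((y0 \<oplus>\<^bsub>Y\<^esub> t \<odot>\<^bsub>Y\<^esub> y) \<ominus>\<^bsub>Y\<^esub> y0) = r / 2"
      proof -
        have "(y0 \<oplus>\<^bsub>Y\<^esub> t \<odot>\<^bsub>Y\<^esub> y) \<ominus>\<^bsub>Y\<^esub> y0 = t \<odot>\<^bsub>Y\<^esub> y"
          using y0 y by (intro Y.vec_eqI) (auto simp: Y.ev_rules)
        then show ?thesis using y n by (simp add: Y.nm_smult t n_def[symmetric])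
      qed
      then obtain x1 where x1: "x1 \<in> carrier X" "vnorm X x1 \<le> real k"
        "vnorm Y ((y0 \<oplus>\<^bsub>Y\<^esub> t \<odot>\<^bsub>Y\<^esub> y) \<ominus>\<^bsub>Y\<^esub> T x1) < r / 8"
        using d[of "y0 \<oplus>\<^bsub>Y\<^esub> t \<odot>\<^bsub>Y\<^esub> y" "r / 8"] y y0 r by auto
      obtain x2 where x2: "x2 \<in> carrier X" "vnorm X x2 \<le> real k" "vnorm Y (y0 \<ominus>\<^bsub>Y\<^esub> T x2) < r / 8"
        using d[of y0 "r / 8"] y0 r by (auto simp: Y.minus_self)
      define w where "w = (1 / t) \<odot>\<^bsub>X\<^esub> (x1 \<ominus>\<^bsub>X\<^esub> x2)"
      have w: "w \<in> carrier X" using x1 x2 by (simp add: w_def)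
      have "vnorm X w \<le> cmod (1 / t) * (vnorm X x1 + vnorm X x2)"
        unfolding w_def using x1 x2 X.nm_minus[of x1 x2] by (simp add: X.nm_smult mult_left_mono)
      also have "\<dots> \<le> cmod (1 / t) * (2 * real k)"
        using x1 x2 by (intro mult_left_mono) auto
      also have "\<dots> = 4 * real k / r * n" unfolding t by simp
      finally have wn: "vnorm X w \<le> 4 * real k / r * n" .
      have eq: "y \<ominus>\<^bsub>Y\<^esub> T w =
        (1 / t) \<odot>\<^bsub>Y\<^esub> (((y0 \<oplus>\<^bsub>Y\<^esub> t \<odot>\<^bsub>Y\<^esub> y) \<ominus>\<^bsub>Y\<^esub> T x1) \<ominus>\<^bsub>Y\<^esub> (y0 \<ominus>\<^bsub>Y\<^esub> T x2))"
        using x1 x2 y y0 t(1) unfolding w_def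
        by (intro Y.vec_eqI) (auto simp: Y.ev_rules field_simps)
      have "vnorm Y (y \<ominus>\<^bsub>Y\<^esub> T w) \<le> cmod (1 / t) * (vnorm Y ((y0 \<oplus>\<^bsub>Y\<^esub> t \<odot>\<^bsub>Y\<^esub> y) \<ominus>\<^bsub>Y\<^esub> T x1) + vnorm Y (y0 \<ominus>\<^bsub>Y\<^esub> T x2))"
        unfolding eq using x1 x2 y y0 Y.nm_minus[of "(y0 \<oplus>\<^bsub>Y\<^esub> t \<odot>\<^bsub>Y\<^esub> y) \<ominus>\<^bsub>Y\<^esub> T x1" "y0 \<ominus>\<^bsub>Y\<^esub> T x2"]
        by (simp add: Y.nm_smult mult_left_mono)
      also have "\<dots> \<le> cmod (1 / t) * (r / 8 + r / 8)"
        using x1 x2 by (intro mult_left_mono) auto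
      also have "\<dots> = n / 2" unfolding t using r by (simp add: field_simps)
      finally show ?thesis using w wn unfolding n_def by blast
    qed
  qed (use r in auto)
qed

text \<open>Iterating the approximate solution halves the residual
  \<open>ys n = y - T (xs n)\<close> at every step. The corrections are dominated by a geometric
  series with sum \<open>2 C\<close> times the norm of \<open>y\<close>, so the partial sums
  \<open>xs n\<close> converge by completeness of \<open>X\<close>.\<close>

theorem open_mapping:
  assumes X: "banach_space X" and Y: "banach_space Y" and T: "T \<in> \<B> X Y"
    and surj: "T ` carrier X = carrier Y"
  obtains K where "\<And>y. y \<in> carrier Y \<Longrightarrow> \<exists>x\<in>carrier X. T x = y \<and> vnorm X x \<le> K * vnorm Y y"
proof -
  note X' = banach_normed[OF X] note Y' = banach_normed[OF Y]
  interpret X: normed X by (rule X')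
  interpret Y: normed Y by (rule Y')
  note TR [simp] = Lin_rules[OF banach_vspace[OF X] banach_vspace[OF Y] B_Lin[OF T]]
  obtain C where C: "C \<ge> 0" and half: "\<And>y. y \<in> carrier Y \<Longrightarrow>
      \<exists>x\<in>carrier X. vnorm X x \<le> C * vnorm Y y \<and> vnorm Y (y \<ominus>\<^bsub>Y\<^esub> T x) \<le> vnorm Y y / 2"
    using open_mapping_half[OF X' Y B_Lin[OF T] surj] by blast
  obtain g where g: "\<And>y. y \<in> carrier Y \<Longrightarrow> g y \<in> carrier X"
    "\<And>y. y \<in> carrier Y \<Longrightarrow> vnorm X (g y) \<le> C * vnorm Y y"
    "\<And>y. y \<in> carrier Y \<Longrightarrow> vnorm Y (y \<ominus>\<^bsub>Y\<^esub> T (g y)) \<le> vnorm Y y / 2"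
    using half by metis
  show thesis
  proof (rule that[of "2 * C"])
    fix y assume y: "y \<in> carrier Y"
    define ys where "ys n = ((\<lambda>z. z \<ominus>\<^bsub>Y\<^esub> T (g z)) ^^ n) y" for n
    have ys0: "ys 0 = y" and ysS: "ys (Suc n) = ys n \<ominus>\<^bsub>Y\<^esub> T (g (ys n))" for n
      by (simp_all add: ys_def)
    have ysc [simp]: "ys n \<in> carrier Y" for n
      by (induction n) (auto simp: ys0 ysS y g)
    have ysn: "vnorm Y (ys n) \<le> vnorm Y y * (1/2) ^ n" for n
    proof (induction n)
      case (Suc n)
      have "vnorm Y (ys (Suc n)) \<le> vnorm Y (ys n) / 2" unfolding ysS by (rule g) simp
      then show ?case using Suc by simp
    qed (simp add: ys0)
    define xs where "xs = rec_nat \<zero>\<^bsub>X\<^esub> (\<lambda>n x. x \<oplus>\<^bsub>X\<^esub> g (ys n))"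
    have xs0: "xs 0 = \<zero>\<^bsub>X\<^esub>" and xsS: "xs (Suc n) = xs n \<oplus>\<^bsub>X\<^esub> g (ys n)" for n
      by (simp_all add: xs_def)
    have xsc [simp]: "xs n \<in> carrier X" for n
      by (induction n) (auto simp: xs0 xsS g)
    have Txs: "T (xs n) = y \<ominus>\<^bsub>Y\<^esub> ys n" for n
    proof (induction n)
      case 0
      then show ?case using y by (simp add: xs0 ys0 Y.minus_self)
    next
      case (Suc n)
      then show ?case using y g(1)[OF ysc[of n]] unfolding xsS ysS
        by (intro Y.vec_eqI) (auto simp: Y.ev_rules)
    qed
    have gn: "vnorm X (g (ys n)) \<le> C * vnorm Y y * (1/2) ^ n" for n
      using g(2)[OF ysc[of n]] mult_left_mono[OF ysn[of n] C] by simp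
    have xsn: "vnorm X (xs n) \<le> 2 * (C * vnorm Y y) * (1 - (1/2) ^ n)" for n
    proof (induction n)
      case (Suc n)
      have "vnorm X (xs (Suc n)) \<le> vnorm X (xs n) + vnorm X (g (ys n))"
        unfolding xsS by (rule X.nm_triangle) (auto simp: g)
      also have "\<dots> \<le> 2 * (C * vnorm Y y) * (1 - (1/2) ^ n) + C * vnorm Y y * (1/2) ^ n"
        using Suc gn[of n] by linarith
      finally show ?case by (simp add: algebra_simps)
    qed (simp add: xs0)
    have "\<exists>x\<in>carrier X. (\<lambda>n. vnorm X (xs n \<ominus>\<^bsub>X\<^esub> x)) \<longlonglongrightarrow> 0"
    proof (rule geometric_convergent[OF X xsc])
      fix n
      have "xs (Suc n) \<ominus>\<^bsub>X\<^esub> xs n = g (ys n)" unfolding xsS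
        using g by (intro X.vec_eqI) (auto simp: X.ev_rules)
      then show "vnorm X (xs (Suc n) \<ominus>\<^bsub>X\<^esub> xs n) \<le> C * vnorm Y y * (1/2) ^ n" using gn by simp
    qed
    then obtain x where x: "x \<in> carrier X" and lim: "(\<lambda>n. vnorm X (xs n \<ominus>\<^bsub>X\<^esub> x)) \<longlonglongrightarrow> 0" by blast
    have "T x = y"
    proof (rule Y.limit_unique[of "\<lambda>n. T (xs n)"])
      show "(\<lambda>n. vnorm Y (T (xs n) \<ominus>\<^bsub>Y\<^esub> T x)) \<longlonglongrightarrow> 0"
        by (rule B_continuous[OF X' Y' T xsc x lim])
      have "T (xs n) \<ominus>\<^bsub>Y\<^esub> y = \<ominus>\<^bsub>Y\<^esub> ys n" for n
        unfolding Txs using y by (intro Y.vec_eqI) (auto simp: Y.ev_rules)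
      then have eq: "vnorm Y (T (xs n) \<ominus>\<^bsub>Y\<^esub> y) = vnorm Y (ys n)" for n by (simp add: Y.nm_neg)
      have "(\<lambda>n. vnorm Y y * (1/2) ^ n) \<longlonglongrightarrow> vnorm Y y * 0"
        by (intro tendsto_mult tendsto_const LIMSEQ_power_zero) auto
      then have lim0: "(\<lambda>n. vnorm Y y * (1/2) ^ n) \<longlonglongrightarrow> 0" by simp
      show "(\<lambda>n. vnorm Y (T (xs n) \<ominus>\<^bsub>Y\<^esub> y)) \<longlonglongrightarrow> 0" unfolding eq
        by (rule tendsto_sandwich[OF _ _ tendsto_const lim0])
          (use ysn Y.nm_nonneg in \<open>auto intro!: always_eventually\<close>)
    qed (use x y in auto)
    moreover have "vnorm X x \<le> 2 * C * vnorm Y y"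
    proof (rule LIMSEQ_le_const)
      have "(\<lambda>n. 2 * C * vnorm Y y + vnorm X (xs n \<ominus>\<^bsub>X\<^esub> x)) \<longlonglongrightarrow> 2 * C * vnorm Y y + 0"
        by (intro tendsto_add tendsto_const lim)
      then show "(\<lambda>n. 2 * C * vnorm Y y + vnorm X (xs n \<ominus>\<^bsub>X\<^esub> x)) \<longlonglongrightarrow> 2 * C * vnorm Y y" by simp
      have "vnorm X x \<le> 2 * C * vnorm Y y + vnorm X (xs n \<ominus>\<^bsub>X\<^esub> x)" for n
      proof -
        have "vnorm X (xs n) \<le> 2 * (C * vnorm Y y) * (1 - (1/2) ^ n)" by (rule xsn)
        also have "\<dots> \<le> 2 * (C * vnorm Y y) * 1"
          using C Y.nm_nonneg[OF y] by (intro mult_left_mono) auto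
        finally show ?thesis
          using X.nm_diff_le[OF x xsc[of n]] X.nm_minus_commute[OF x xsc[of n]] by simp
      qed
      then show "\<exists>N. \<forall>n\<ge>N. vnorm X x \<le> 2 * C * vnorm Y y + vnorm X (xs n \<ominus>\<^bsub>X\<^esub> x)" by blast
    qed
    ultimately show "\<exists>x\<in>carrier X. T x = y \<and> vnorm X x \<le> 2 * C * vnorm Y y" using x by blast
  qed
qed

lemma Lin_inverse:
  assumes X: "vspace X" and Y: "vspace Y" and T: "T \<in> Lin X Y"
    and bij: "inj_on T (carrier X)" "T ` carrier X = carrier Y"
  shows "inv_into (carrier X) T \<in> Lin Y X"
proof -
  note [simp] = Lin_rules[OF X Y T] X Y
  let ?S = "inv_into (carrier X) T"
  have S: "?S y \<in> carrier X" "T (?S y) = y" if "y \<in> carrier Y" for y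
    using that bij(2) inv_into_into[of y T "carrier X"] f_inv_into_f[of y T "carrier X"] by auto
  have eq: "a = b" if "a \<in> carrier X" "b \<in> carrier X" "T a = T b" for a b
    using that bij(1) by (auto dest: inj_onD)
  show ?thesis by (rule Lin_I) (auto simp: S intro!: eq)
qed

lemma bounded_inverse:
  assumes X: "banach_space X" and Y: "banach_space Y" and T: "T \<in> \<B> X Y"
    and inj: "inj_on T (carrier X)" and surj: "T ` carrier X = carrier Y"
  obtains S where "S \<in> \<B> Y X" "\<And>x. x \<in> carrier X \<Longrightarrow> S (T x) = x" "\<And>y. y \<in> carrier Y \<Longrightarrow> T (S y) = y"
proof -
  let ?S = "inv_into (carrier X) T"
  obtain K where K: "\<And>y. y \<in> carrier Y \<Longrightarrow> \<exists>x\<in>carrier X. T x = y \<and> vnorm X x \<le> K * vnorm Y y"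
    using open_mapping[OF X Y T surj] by blast
  have ST: "?S (T x) = x" if "x \<in> carrier X" for x using inj that by simp
  show thesis
  proof (rule that[of ?S])
    show "?S \<in> \<B> Y X"
    proof (rule B_I)
      show "?S \<in> Lin Y X" by (rule Lin_inverse) (use X Y B_Lin[OF T] inj surj in auto)
      show "vnorm X (?S y) \<le> K * vnorm Y y" if "y \<in> carrier Y" for y
        using K[OF that] ST by auto
    qed
  qed (use ST surj in \<open>auto simp: f_inv_into_f\<close>)
qed

text \<open>Only bijectivity is wanted, so the inverse is not summed as a series: solutions of
  \<open>x + K x = y\<close> are the fixed points of the contraction
  \<open>x -> y - K x\<close>.\<close>

lemma neumann:
  assumes X: "banach_space X" and K: "K \<in> Lin X X"
    and q: "q < 1" "\<And>x. x \<in> carrier X \<Longrightarrow> vnorm X (K x) \<le> q * vnorm X x"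
  shows "inj_on (\<lambda>x. x \<oplus>\<^bsub>X\<^esub> K x) (carrier X)" "(\<lambda>x. x \<oplus>\<^bsub>X\<^esub> K x) ` carrier X = carrier X"
proof -
  interpret normed X by (rule banach_normed[OF X])
  note [simp] = Lin_rules[OF banach_vspace[OF X] banach_vspace[OF X] K]
  show "inj_on (\<lambda>x. x \<oplus>\<^bsub>X\<^esub> K x) (carrier X)"
  proof (rule inj_onI)
    fix x y assume xy: "x \<in> carrier X" "y \<in> carrier X" and eq: "x \<oplus>\<^bsub>X\<^esub> K x = y \<oplus>\<^bsub>X\<^esub> K y"
    have "x \<ominus>\<^bsub>X\<^esub> y = \<ominus>\<^bsub>X\<^esub> K (x \<ominus>\<^bsub>X\<^esub> y)"
    proof (rule vec_eqI)
      fix f assume f: "f \<in> lfun X"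
      have "ev f (x \<oplus>\<^bsub>X\<^esub> K x) = ev f (y \<oplus>\<^bsub>X\<^esub> K y)" using eq by simp
      then show "ev f (x \<ominus>\<^bsub>X\<^esub> y) = ev f (\<ominus>\<^bsub>X\<^esub> K (x \<ominus>\<^bsub>X\<^esub> y))"
        using f xy by (simp add: ev_rules algebra_simps)
    qed (use xy in auto)
    then have "vnorm X (x \<ominus>\<^bsub>X\<^esub> y) = vnorm X (\<ominus>\<^bsub>X\<^esub> K (x \<ominus>\<^bsub>X\<^esub> y))" by (rule arg_cong)
    also have "\<dots> = vnorm X (K (x \<ominus>\<^bsub>X\<^esub> y))" using xy by (intro nm_neg) simp
    also have "\<dots> \<le> q * vnorm X (x \<ominus>\<^bsub>X\<^esub> y)" using xy by (intro q) simp
    finally have "(1 - q) * vnorm X (x \<ominus>\<^bsub>X\<^esub> y) \<le> 0" by (simp only: left_diff_distrib)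
    then have "vnorm X (x \<ominus>\<^bsub>X\<^esub> y) \<le> 0" using q(1) by (auto simp: mult_le_0_iff)
    then show "x = y" using nm_nonneg[of "x \<ominus>\<^bsub>X\<^esub> y"] nm_eq_0_iff[of "x \<ominus>\<^bsub>X\<^esub> y"] xy
      by (simp add: minus_eq_zero_iff)
  qed
  show "(\<lambda>x. x \<oplus>\<^bsub>X\<^esub> K x) ` carrier X = carrier X"
  proof (intro equalityI subsetI)
    fix y assume y: "y \<in> carrier X"
    obtain x where x: "x \<in> carrier X" "y \<ominus>\<^bsub>X\<^esub> K x = x"
    proof (rule Met.Banach_fixedpoint_thm[of "\<lambda>x. y \<ominus>\<^bsub>X\<^esub> K x" q])
      show "Met.mcomplete" using X by (rule banach_space.complete)
      show "carrier X \<noteq> {}" using y by blast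
      fix a b assume ab: "a \<in> carrier X" "b \<in> carrier X"
      have "(y \<ominus>\<^bsub>X\<^esub> K a) \<ominus>\<^bsub>X\<^esub> (y \<ominus>\<^bsub>X\<^esub> K b) = K (b \<ominus>\<^bsub>X\<^esub> a)"
        using y ab by (intro vec_eqI) (auto simp: ev_rules)
      then show "vdist X (y \<ominus>\<^bsub>X\<^esub> K a) (y \<ominus>\<^bsub>X\<^esub> K b) \<le> q * vdist X a b"
        using y ab q(2)[of "b \<ominus>\<^bsub>X\<^esub> a"] nm_minus_commute[of a b] by (simp add: vdist_def)
    qed (use y q in auto)
    have "x \<oplus>\<^bsub>X\<^esub> K x = y"
    proof (rule vec_eqI)
      fix f assume f: "f \<in> lfun X"
      have "ev f (y \<ominus>\<^bsub>X\<^esub> K x) = ev f x" using x(2) by simp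
      then show "ev f (x \<oplus>\<^bsub>X\<^esub> K x) = ev f y" using f x(1) y by (simp add: ev_rules algebra_simps)
    qed (use x y in auto)
    then show "y \<in> (\<lambda>x. x \<oplus>\<^bsub>X\<^esub> K x) ` carrier X" using x(1) by blast
  qed auto
qed

section \<open>Sequence spaces\<close>

text \<open>All sequence spaces share the type \<open>nat => complex\<close>: coordinate spaces can
  then occur with a variable dimension, and \<open>c0\<close> and \<open>l2\<close> live in one
  universe, as \<open>EAE\<close> demands.\<close>

definition seqsp :: "(nat \<Rightarrow> complex) set \<Rightarrow> ((nat \<Rightarrow> complex) \<Rightarrow> real) \<Rightarrow> (nat \<Rightarrow> complex) nspace"
  where "seqsp C N = \<lparr>carrier = C, mult = undefined, one = undefined, zero = (\<lambda>_. 0),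
    add = (\<lambda>f g i. f i + g i), smult = (\<lambda>c f i. c * f i), vnorm = N\<rparr>"

lemma seqsp_simps [simp]:
  "carrier (seqsp C N) = C" "\<zero>\<^bsub>seqsp C N\<^esub> = (\<lambda>_. 0)" "f \<oplus>\<^bsub>seqsp C N\<^esub> g = (\<lambda>i. f i + g i)"
  "c \<odot>\<^bsub>seqsp C N\<^esub> f = (\<lambda>i. c * f i)" "vnorm (seqsp C N) = N"
  by (simp_all add: seqsp_def)

lemma vspace_seqsp:
  assumes "(\<lambda>_. 0) \<in> C" "\<And>f g. f \<in> C \<Longrightarrow> g \<in> C \<Longrightarrow> (\<lambda>i. f i + g i) \<in> C"
    "\<And>c f. f \<in> C \<Longrightarrow> (\<lambda>i. c * f i) \<in> C"
  shows "vspace (seqsp C N)"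
  by (rule vspaceI) (use assms in \<open>auto simp: algebra_simps\<close>)

lemma seqsp_minus:
  assumes "vspace (seqsp C N)" "g \<in> C"
  shows "f \<ominus>\<^bsub>seqsp C N\<^esub> g = (\<lambda>i. f i - g i)"
  using vspace.neg_smult[OF assms(1), of g] assms(2) by (simp add: a_minus_def)

text \<open>By \<open>coord\<close> a Cauchy sequence converges in each coordinate;
  \<open>lim\<close> places the coordinatewise limit in the space, and \<open>fatou\<close> lets the
  second index of \<open>N (s n - s m)\<close> tend to infinity, which upgrades coordinatewise
  convergence to convergence in norm.\<close>

lemma banach_seqsp:
  assumes nm: "normed (seqsp C N)"
    and coord: "\<And>f i. f \<in> C \<Longrightarrow> cmod (f i) \<le> N f"
    and lim: "\<And>s f. (\<And>n. s n \<in> C) \<Longrightarrow> (\<And>e. e > 0 \<Longrightarrow> \<exists>M. \<forall>m\<ge>M. \<forall>n\<ge>M. N (\<lambda>i. s m i - s n i) < e) \<Longrightarrow>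
      (\<And>i. (\<lambda>n. s n i) \<longlonglongrightarrow> f i) \<Longrightarrow> f \<in> C"
    and fatou: "\<And>s f e. (\<And>n. s n \<in> C) \<Longrightarrow> f \<in> C \<Longrightarrow> (\<And>i. (\<lambda>n. s n i) \<longlonglongrightarrow> f i) \<Longrightarrow>
      (\<And>n. N (s n) \<le> e) \<Longrightarrow> N f \<le> e"
  shows "banach_space (seqsp C N)"
proof (rule banach_spaceI[OF nm])
  interpret normed "seqsp C N" by (rule nm)
  have mi: "f \<ominus>\<^bsub>seqsp C N\<^esub> g = (\<lambda>i. f i - g i)" if "g \<in> C" for f g
    using seqsp_minus[OF normed_vspace[OF nm] that] .
  have mC: "(\<lambda>i. f i - g i) \<in> C" if "f \<in> C" "g \<in> C" for f g
    using minus_in[of f g] that by (simp add: mi)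
  fix s :: "nat \<Rightarrow> nat \<Rightarrow> complex" 
  assume "\<And>n. s n \<in> carrier (seqsp C N)"
    and c: "\<And>e. e > 0 \<Longrightarrow> \<exists>M. \<forall>m\<ge>M. \<forall>n\<ge>M. vnorm (seqsp C N) (s m \<ominus>\<^bsub>seqsp C N\<^esub> s n) < e"
  then have s: "s n \<in> C" for n by simp
  have c: "\<exists>M. \<forall>m\<ge>M. \<forall>n\<ge>M. N (\<lambda>i. s m i - s n i) < e" if "e > 0" for e
    using c[OF that] s by (simp add: mi)
  have "Cauchy (\<lambda>n. s n i)" for i
  proof (rule CauchyI)
    fix e :: real assume "e > 0"
    from c[OF this] obtain M where M: "\<And>m n. m \<ge> M \<Longrightarrow> n \<ge> M \<Longrightarrow> N (\<lambda>i. s m i - s n i) < e" by blast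
    have "cmod (s m i - s n i) < e" if "m \<ge> M" "n \<ge> M" for m n
      using coord[OF mC[OF s[of m] s[of n]], of i] M[OF that] by simp
    then show "\<exists>M. \<forall>m\<ge>M. \<forall>n\<ge>M. cmod (s m i - s n i) < e" by blast
  qed
  then have "\<forall>i. \<exists>l. (\<lambda>n. s n i) \<longlonglongrightarrow> l" by (simp add: Cauchy_convergent_iff convergent_def)
  then obtain f where f: "\<And>i. (\<lambda>n. s n i) \<longlonglongrightarrow> f i" by metis
  have fC: "f \<in> C" using lim[OF s c f] by blast
  show "\<exists>x\<in>carrier (seqsp C N). (\<lambda>n. vnorm (seqsp C N) (s n \<ominus>\<^bsub>seqsp C N\<^esub> x)) \<longlonglongrightarrow> 0"
  proof (rule bexI[of _ f])
    show "(\<lambda>n. vnorm (seqsp C N) (s n \<ominus>\<^bsub>seqsp C N\<^esub> f)) \<longlonglongrightarrow> 0"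
    proof (rule LIMSEQ_I)
      fix e :: real assume e: "e > 0"
      then obtain M where M: "\<And>m n. m \<ge> M \<Longrightarrow> n \<ge> M \<Longrightarrow> N (\<lambda>i. s m i - s n i) < e / 2"
        using c[of "e / 2"] by auto
      have "norm (vnorm (seqsp C N) (s n \<ominus>\<^bsub>seqsp C N\<^esub> f) - 0) < e" if n: "n \<ge> M" for n
      proof -
        have "N (\<lambda>i. s n i - f i) \<le> e / 2"
        proof (rule fatou[of "\<lambda>m i. s n i - s (m + M) i"])
          show "(\<lambda>m. s n i - s (m + M) i) \<longlonglongrightarrow> s n i - f i" for i
            by (intro tendsto_diff tendsto_const LIMSEQ_ignore_initial_segment f)
          show "N (\<lambda>i. s n i - s (m + M) i) \<le> e / 2" for m
            using M[of n "m + M"] n by simp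
        qed (use mC s fC in auto)
        moreover have "0 \<le> N (\<lambda>i. s n i - f i)" using nm_nonneg[of "\<lambda>i. s n i - f i"] mC[OF s fC] by simp
        ultimately show ?thesis using e fC by (simp add: mi)
      qed
      then show "\<exists>no. \<forall>n\<ge>no. norm (vnorm (seqsp C N) (s n \<ominus>\<^bsub>seqsp C N\<^esub> f) - 0) < e" by blast
    qed
  qed (use fC in simp)
qed

section \<open>Spaces with the supremum norm\<close>

definition supn :: "(nat \<Rightarrow> complex) \<Rightarrow> real"
  where "supn f = (SUP i. cmod (f i))"

lemma supn_upper: "bdd_above (range (\<lambda>i. cmod (f i))) \<Longrightarrow> cmod (f i) \<le> supn f"
  unfolding supn_def by (rule cSUP_upper) auto

lemma supn_least: "(\<And>i. cmod (f i) \<le> e) \<Longrightarrow> supn f \<le> e"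
  unfolding supn_def by (rule cSUP_least) auto

lemma normed_supn:
  assumes C: "vspace (seqsp C supn)" and b: "\<And>f. f \<in> C \<Longrightarrow> bdd_above (range (\<lambda>i. cmod (f i)))"
  shows "normed (seqsp C supn)"
  unfolding normed_def normed_axioms_def
proof (intro conjI allI impI)
  show "vspace (seqsp C supn)" by (rule C)
  note up = supn_upper[OF b]
  fix f assume "f \<in> carrier (seqsp C supn)"
  then have f: "f \<in> C" by simp
  have nn: "0 \<le> supn f" using order_trans[OF norm_ge_zero up[OF f, of 0]] .
  then show "0 \<le> vnorm (seqsp C supn) f" by simp
  show "(vnorm (seqsp C supn) f = 0) = (f = \<zero>\<^bsub>seqsp C supn\<^esub>)"
  proof
    assume "vnorm (seqsp C supn) f = 0"
    then have "cmod (f i) \<le> 0" for i using up[OF f, of i] by simp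
    then show "f = \<zero>\<^bsub>seqsp C supn\<^esub>" by (simp add: fun_eq_iff)
  qed (simp add: supn_def)
  fix c :: complex
  have cf: "(\<lambda>i. c * f i) \<in> C" using vspace.smult_in[OF C, of f c] f by simp
  have le: "supn (\<lambda>i. c * f i) \<le> cmod c * supn f"
    by (rule supn_least) (simp add: norm_mult up[OF f] mult_left_mono)
  have ge: "cmod c * supn f \<le> supn (\<lambda>i. c * f i)"
  proof (cases "c = 0")
    case False
    have "supn f \<le> supn (\<lambda>i. c * f i) / cmod c"
      by (rule supn_least) (use up[OF cf] False in \<open>simp add: norm_mult field_simps\<close>)
    then show ?thesis using False by (simp add: field_simps)
  qed (use order_trans[OF norm_ge_zero up[OF cf, of 0]] in simp)
  show "vnorm (seqsp C supn) (c \<odot>\<^bsub>seqsp C supn\<^esub> f) = cmod c * vnorm (seqsp C supn) f"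
    using le ge by simp
next
  note up = supn_upper[OF b]
  fix f g assume "f \<in> carrier (seqsp C supn)" "g \<in> carrier (seqsp C supn)"
  then have fg: "f \<in> C" "g \<in> C" by simp_all
  have "supn (\<lambda>i. f i + g i) \<le> supn f + supn g"
    by (rule supn_least) (rule order_trans[OF norm_triangle_ineq add_mono[OF up[OF fg(1)] up[OF fg(2)]]])
  then show "vnorm (seqsp C supn) (f \<oplus>\<^bsub>seqsp C supn\<^esub> g) \<le> vnorm (seqsp C supn) f + vnorm (seqsp C supn) g"
    by simp
qed

lemma banach_supn:
  assumes C: "vspace (seqsp C supn)" and b: "\<And>f. f \<in> C \<Longrightarrow> bdd_above (range (\<lambda>i. cmod (f i)))"
    and lim: "\<And>s f. (\<And>n. s n \<in> C) \<Longrightarrow> (\<And>e. e > 0 \<Longrightarrow> \<exists>M. \<forall>m\<ge>M. \<forall>n\<ge>M. supn (\<lambda>i. s m i - s n i) < e) \<Longrightarrow>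
      (\<And>i. (\<lambda>n. s n i) \<longlonglongrightarrow> f i) \<Longrightarrow> f \<in> C"
  shows "banach_space (seqsp C supn)"
proof (rule banach_seqsp[OF normed_supn[OF C b] supn_upper[OF b] lim])
  fix s f e assume s: "\<And>n. s n \<in> C" "f \<in> C" "\<And>i. (\<lambda>n. s n i) \<longlonglongrightarrow> f i" "\<And>n. supn (s n) \<le> e"
  have "cmod (f i) \<le> e" for i
  proof (rule LIMSEQ_le_const2[OF tendsto_norm[OF s(3)[of i]]])
    have "cmod (s n i) \<le> e" for n using supn_upper[OF b[OF s(1)[of n]], of i] s(4)[of n] by linarith
    then show "\<exists>N. \<forall>n\<ge>N. cmod (s n i) \<le> e" by blast
  qed
  then show "supn f \<le> e" by (rule supn_least)
qed auto

text \<open>Sequences vanishing from \<open>n\<close> on, rather than functions on a finite index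
  type: \<open>n\<close> may depend on the operator, and \<open>Cn k\<close> is literally contained
  in \<open>Cn n\<close> for \<open>k \<le> n\<close>.\<close>

definition Cn :: "nat \<Rightarrow> (nat \<Rightarrow> complex) nspace"
  where "Cn n = seqsp {f. \<forall>i\<ge>n. f i = 0} supn"

lemma Cn_simps [simp]:
  "f \<in> carrier (Cn n) \<longleftrightarrow> (\<forall>i\<ge>n. f i = 0)" "\<zero>\<^bsub>Cn n\<^esub> = (\<lambda>_. 0)" "f \<oplus>\<^bsub>Cn n\<^esub> g = (\<lambda>i. f i + g i)"
  "c \<odot>\<^bsub>Cn n\<^esub> f = (\<lambda>i. c * f i)" "vnorm (Cn n) = supn"
  by (simp_all add: Cn_def)

lemma Cn_bdd: "f \<in> carrier (Cn n) \<Longrightarrow> bdd_above (range (\<lambda>i. cmod (f i)))"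
proof -
  assume f: "f \<in> carrier (Cn n)"
  have "cmod (f i) \<le> (\<Sum>k<n. cmod (f k))" for i
    using f member_le_sum[of i "{..<n}" "\<lambda>k. cmod (f k)"] by (cases "i < n") (auto simp: sum_nonneg)
  then show ?thesis by (auto intro!: bdd_aboveI)
qed

lemma vspace_Cn [simp]: "vspace (Cn n)"
  unfolding Cn_def by (rule vspace_seqsp) auto

lemma Cn_minus [simp]: "g \<in> carrier (Cn n) \<Longrightarrow> f \<ominus>\<^bsub>Cn n\<^esub> g = (\<lambda>i. f i - g i)"
  using seqsp_minus[of "{f. \<forall>i\<ge>n. f i = 0}" supn g f] vspace_Cn[of n] by (simp add: Cn_def)

lemma banach_Cn [simp]: "banach_space (Cn n)"
  unfolding Cn_def
proof (rule banach_supn)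
  fix s f assume s: "\<And>m. s m \<in> {f. \<forall>i\<ge>n. f i = (0::complex)}" and l: "\<And>i. (\<lambda>m. s m i) \<longlonglongrightarrow> f i"
  have "f i = 0" if "i \<ge> n" for i
  proof -
    have "(\<lambda>m. s m i) = (\<lambda>m. 0)" using s that by auto
    then show ?thesis using l[of i] LIMSEQ_unique[OF _ tendsto_const] by metis
  qed
  then show "f \<in> {f. \<forall>i\<ge>n. f i = 0}" by simp
qed (use vspace_Cn[of n] Cn_bdd[of _ n] in \<open>auto simp: Cn_def\<close>)

lemma normed_Cn [simp]: "normed (Cn n)"
  by (rule banach_normed) simp

section \<open>Linear algebra in coordinate spaces\<close>

definition un :: "nat \<Rightarrow> nat \<Rightarrow> complex" where "un k = (\<lambda>i. if i = k then 1 else 0)"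

text \<open>Serves as the projection of \<open>Cn n\<close> onto its first \<open>k\<close>
  coordinates, and as the inclusion into \<open>Cn k\<close> if \<open>n \<le> k\<close>. One
  formula thus relates kernel and cokernel coordinates whichever dimension is larger.\<close>

definition tr :: "nat \<Rightarrow> (nat \<Rightarrow> complex) \<Rightarrow> nat \<Rightarrow> complex"
  where "tr k f = (\<lambda>i. if i < k then f i else 0)"

text \<open>Defined by recursion so that linearity and estimates follow by induction on the number
  of vectors; \<open>finsum_lc\<close> relates it to sums in the additive group.\<close>

primrec lc :: "'a nspace \<Rightarrow> (nat \<Rightarrow> 'a) \<Rightarrow> nat \<Rightarrow> (nat \<Rightarrow> complex) \<Rightarrow> 'a" where
  "lc X b 0 c = \<zero>\<^bsub>X\<^esub>"
| "lc X b (Suc k) c = lc X b k c \<oplus>\<^bsub>X\<^esub> c k \<odot>\<^bsub>X\<^esub> b k"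

lemma lc_in: "vspace X \<Longrightarrow> (\<And>k. k < n \<Longrightarrow> b k \<in> carrier X) \<Longrightarrow> lc X b n c \<in> carrier X"
  by (induction n) auto

lemma un_in [simp]: "k < n \<Longrightarrow> un k \<in> carrier (Cn n)"
  by (auto simp: un_def)

lemma tr_in [simp]: "tr k f \<in> carrier (Cn k)"
  by (auto simp: tr_def)

lemma tr_id [simp]: "f \<in> carrier (Cn n) \<Longrightarrow> n \<le> k \<Longrightarrow> tr k f = f"
  by (auto simp: tr_def fun_eq_iff)

lemma Lin_lc:
  assumes X: "vspace X" and b: "\<And>k. k < n \<Longrightarrow> b k \<in> carrier X"
  shows "lc X b n \<in> Lin (Cn m) X"
  using b
proof (induction n)
  case 0
  then show ?case using Lin_zero[OF X] by (simp add: lc_def)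
next
  case (Suc n)
  have "(\<lambda>c. c n \<odot>\<^bsub>X\<^esub> b n) \<in> Lin (Cn m) X"
    by (rule Lin_I) (use X Suc.prems[of n] in \<open>auto simp: vspace.smult_add vspace.smult_smult\<close>)
  then show ?case using Lin_add[OF X Suc.IH, of "\<lambda>c. c n \<odot>\<^bsub>X\<^esub> b n"] Suc.prems by simp
qed

lemma Lin_expand:
  assumes X: "vspace X" and T: "T \<in> Lin (Cn n) X" and c: "c \<in> carrier (Cn n)"
  shows "T c = lc X (\<lambda>k. T (un k)) n c"
proof -
  note TR = Lin_rules[OF vspace_Cn X T]
  have "T (tr m c) = lc X (\<lambda>k. T (un k)) m c" if "m \<le> n" for m
    using that
  proof (induction m)
    case 0
    have "tr 0 c = (\<lambda>_. 0)" by (auto simp: tr_def)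
    then show ?case using TR(4) by simp
  next
    case (Suc m)
    have eq: "tr (Suc m) c = tr m c \<oplus>\<^bsub>Cn n\<^esub> c m \<odot>\<^bsub>Cn n\<^esub> un m"
      by (auto simp: tr_def un_def fun_eq_iff less_Suc_eq)
    have "tr m c \<in> carrier (Cn n)" "un m \<in> carrier (Cn n)" using Suc.prems by (auto simp: tr_def un_def)
    then have "T (tr (Suc m) c) = T (tr m c) \<oplus>\<^bsub>X\<^esub> c m \<odot>\<^bsub>X\<^esub> T (un m)"
      unfolding eq by (subst TR(2)) (auto simp: TR(3) simp del: Cn_simps)
    then show ?case using Suc by simp
  qed
  from this[of n] show ?thesis using c by simp
qed

lemma lc_cong: "(\<And>k. k < n \<Longrightarrow> b k = b' k) \<Longrightarrow> lc X b n c = lc X b' n c"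
  by (induction n) auto

lemma lc_comp:
  assumes X: "vspace X" and Y: "vspace Y" and T: "T \<in> Lin X Y" and b: "\<And>k. k < n \<Longrightarrow> b k \<in> carrier X"
  shows "T (lc X b n c) = lc Y (\<lambda>k. T (b k)) n c"
  using b
proof (induction n)
  case (Suc n)
  then show ?case using Lin_rules[OF X Y T] lc_in[OF X, of n b c] X by simp
qed (use Lin_rules[OF X Y T] in simp)

lemma lc_un: "c \<in> carrier (Cn n) \<Longrightarrow> lc (Cn n) un n c = c"
  using Lin_expand[OF vspace_Cn Lin_id, of c n] by simp

text \<open>Coordinates are bounded by the supremum norm, so the sum of the norms of the images of
  the unit vectors is a bound for \<open>T\<close>.\<close>

lemma B_Cn:
  assumes X: "normed X" and T: "T \<in> Lin (Cn n) X"
  shows "T \<in> \<B> (Cn n) X"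
proof (rule B_I[OF T])
  interpret normed X by (rule X)
  note TR = Lin_rules[OF vspace_Cn normed_vspace[OF X] T]
  fix c assume c: "c \<in> carrier (Cn n)"
  have "vnorm X (lc X (\<lambda>k. T (un k)) m c) \<le> (\<Sum>k<m. vnorm X (T (un k))) * supn c" if "m \<le> n" for m
    using that
  proof (induction m)
    case (Suc m)
    have T1: "T (un k) \<in> carrier X" if "k < n" for k using TR(1) un_in that by blast
    have 1: "lc X (\<lambda>k. T (un k)) m c \<in> carrier X" by (rule lc_in[OF normed_vspace[OF X]]) (use T1 Suc.prems in auto)
    have "vnorm X (lc X (\<lambda>k. T (un k)) (Suc m) c) \<le> vnorm X (lc X (\<lambda>k. T (un k)) m c) + cmod (c m) * vnorm X (T (un m))"
      using nm_triangle[OF 1, of "c m \<odot>\<^bsub>X\<^esub> T (un m)"] T1[of m] Suc.prems by (simp add: nm_smult)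
    also have "\<dots> \<le> (\<Sum>k<m. vnorm X (T (un k))) * supn c + supn c * vnorm X (T (un m))"
      using Suc supn_upper[OF Cn_bdd[OF c], of m] T1[of m] by (intro add_mono mult_right_mono) (auto simp: nm_nonneg)
    finally show ?case by (simp add: algebra_simps)
  qed simp
  from this[of n] show "vnorm X (T c) \<le> (\<Sum>k<n. vnorm X (T (un k))) * vnorm (Cn n) c"
    using Lin_expand[OF normed_vspace[OF X] T c] by simp
qed

section \<open>Counting dimensions in coordinate spaces\<close>

lemma inj_on_iff_kernel:
  assumes X: "vspace X" and Y: "vspace Y" and T: "T \<in> Lin X Y"
  shows "inj_on T (carrier X) \<longleftrightarrow> (\<forall>x\<in>carrier X. T x = \<zero>\<^bsub>Y\<^esub> \<longrightarrow> x = \<zero>\<^bsub>X\<^esub>)"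
proof
  note TR = Lin_rules[OF X Y T]
  assume "inj_on T (carrier X)"
  then show "\<forall>x\<in>carrier X. T x = \<zero>\<^bsub>Y\<^esub> \<longrightarrow> x = \<zero>\<^bsub>X\<^esub>"
    using TR(4) X by (auto dest: inj_onD[of _ _ _ "\<zero>\<^bsub>X\<^esub>"])
next
  note TR = Lin_rules[OF X Y T]
  assume k: "\<forall>x\<in>carrier X. T x = \<zero>\<^bsub>Y\<^esub> \<longrightarrow> x = \<zero>\<^bsub>X\<^esub>"
  show "inj_on T (carrier X)"
  proof (rule inj_onI)
    fix x y assume xy: "x \<in> carrier X" "y \<in> carrier X" "T x = T y"
    then have "T (x \<ominus>\<^bsub>X\<^esub> y) = \<zero>\<^bsub>Y\<^esub>" using TR Y by (simp add: vspace.minus_self)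
    then have "x \<ominus>\<^bsub>X\<^esub> y = \<zero>\<^bsub>X\<^esub>" using k vspace.minus_in[OF X xy(1,2)] by blast
    then show "x = y" using vspace.minus_eq_zero_iff[OF X xy(1,2)] by blast
  qed
qed

text \<open>Gaussian elimination by induction on the number \<open>l\<close> of equations. A last
  equation with all coefficients zero is dropped; otherwise a variable \<open>p\<close> with nonzero
  coefficient is eliminated, which removes one equation and one unknown.\<close>

lemma Cn_underdetermined:
  "T \<in> Lin (Cn k) (Cn l) \<Longrightarrow> l < k \<Longrightarrow> \<exists>c\<in>carrier (Cn k). c \<noteq> (\<lambda>_. 0) \<and> T c = (\<lambda>_. 0)"
proof (induction l arbitrary: k T)
  case 0
  have "T (un 0) \<in> carrier (Cn 0)" using Lin_rules(1)[OF vspace_Cn vspace_Cn 0(1)] un_in 0(2) by blast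
  then have "T (un 0) = (\<lambda>_. 0)" by auto
  moreover have "un 0 \<noteq> (\<lambda>_. 0)" by (auto simp: un_def fun_eq_iff)
  ultimately show ?case using 0(2) un_in by blast
next
  case (Suc l)
  note TR = Lin_rules[OF vspace_Cn vspace_Cn Suc.prems(1)]
  show ?case
  proof (cases "\<forall>p<k. T (un p) l = 0")
    case True
    have T0: "T c l = 0" if c: "c \<in> carrier (Cn k)" for c
    proof -
      have "lc (Cn (Suc l)) (\<lambda>k. T (un k)) m c l = 0" if "m \<le> k" for m
        using that True by (induction m) auto
      then show ?thesis using Lin_expand[OF vspace_Cn Suc.prems(1) c] by simp
    qed
    have "T \<in> Lin (Cn k) (Cn l)"
    proof (rule Lin_I)
      fix c assume c: "c \<in> carrier (Cn k)"
      then have "T c i = 0" if "i \<ge> l" for i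
        using TR(1)[OF c] T0[OF c] that by (cases "i = l") auto
      then show "T c \<in> carrier (Cn l)" by simp
    qed (use TR(2,3) in auto)
    then show ?thesis using Suc.IH[of T k] Suc.prems by simp
  next
    case False
    then obtain p where p: "p < k" "T (un p) l \<noteq> 0" by blast
    \<comment> \<open>\<open>ins\<close> places a zero at position \<open>p\<close> and moves the
      later entries up; \<open>g\<close> then sets the entry at \<open>p\<close> so that the last
      equation holds. Off position \<open>p\<close> the vector \<open>g c\<close> still shows
      \<open>c\<close>, so nonzero vectors stay nonzero.\<close>
    define ins where "ins c = (\<lambda>i. if i < p then c i else if i = p then 0 else c (i - 1))" for c :: "nat \<Rightarrow> complex"
    define g where "g c = (\<lambda>i. ins c i - T (ins c) l / T (un p) l * un p i)" for c
    have insL: "ins \<in> Lin (Cn (k - 1)) (Cn k)"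
      by (rule Lin_I) (use p in \<open>auto simp: ins_def fun_eq_iff\<close>)
    note IR = Lin_rules[OF vspace_Cn vspace_Cn insL]
    have gL: "g \<in> Lin (Cn (k - 1)) (Cn k)"
    proof (rule Lin_I)
      fix c assume c: "c \<in> carrier (Cn (k - 1))"
      show "g c \<in> carrier (Cn k)" using IR(1)[OF c] p by (auto simp: g_def un_def)
      fix d assume d: "d \<in> carrier (Cn (k - 1))"
      have "T (ins (\<lambda>i. c i + d i)) = (\<lambda>i. T (ins c) i + T (ins d) i)"
        using TR(2)[OF IR(1)[OF c] IR(1)[OF d]] IR(2)[OF c d] by simp
      then show "g (c \<oplus>\<^bsub>Cn (k - 1)\<^esub> d) = g c \<oplus>\<^bsub>Cn k\<^esub> g d"
        using IR(2)[OF c d] by (simp add: g_def fun_eq_iff add_divide_distrib algebra_simps)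
    next
      fix a c assume c: "c \<in> carrier (Cn (k - 1))"
      have "T (ins (\<lambda>i. a * c i)) = (\<lambda>i. a * T (ins c) i)"
        using TR(3)[OF IR(1)[OF c]] IR(3)[OF c] by simp
      then show "g (a \<odot>\<^bsub>Cn (k - 1)\<^esub> c) = a \<odot>\<^bsub>Cn k\<^esub> g c"
        using IR(3)[OF c] by (simp add: g_def fun_eq_iff algebra_simps)
    qed
    note GR = Lin_rules[OF vspace_Cn vspace_Cn gL]
    have Tg: "T (g c) l = 0" if c: "c \<in> carrier (Cn (k - 1))" for c
    proof -
      have u: "un p \<in> carrier (Cn k)" using p by (intro un_in)
      have "g c = ins c \<ominus>\<^bsub>Cn k\<^esub> (T (ins c) l / T (un p) l) \<odot>\<^bsub>Cn k\<^esub> un p"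
        using u by (simp add: g_def)
      then have "T (g c) = T (ins c) \<ominus>\<^bsub>Cn (Suc l)\<^esub> (T (ins c) l / T (un p) l) \<odot>\<^bsub>Cn (Suc l)\<^esub> T (un p)"
        by (simp only: TR(3)[OF u] TR(6)[OF IR(1)[OF c] vspace.smult_in[OF vspace_Cn u]])
      then show ?thesis using TR(1)[OF u] p by simp
    qed
    have TgL: "(\<lambda>c. T (g c)) \<in> Lin (Cn (k - 1)) (Cn l)"
    proof (rule Lin_I)
      fix c assume c: "c \<in> carrier (Cn (k - 1))"
      have "T (g c) i = 0" if "i \<ge> l" for i
        using TR(1)[OF GR(1)[OF c]] Tg[OF c] that by (cases "i = l") auto
      then show "T (g c) \<in> carrier (Cn l)" by simp
    qed (use GR TR(2,3) in \<open>auto simp del: Cn_simps(1)\<close>)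
    have "l < k - 1" using Suc.prems(2) by linarith
    then obtain c where c: "c \<in> carrier (Cn (k - 1))" "c \<noteq> (\<lambda>_. 0)" "T (g c) = (\<lambda>_. 0)"
      using Suc.IH[OF TgL] by blast
    have "g c \<noteq> (\<lambda>_. 0)"
    proof
      assume "g c = (\<lambda>_. 0)"
      then have "g c i = 0" for i by simp
      then have z: "ins c i = 0" if "i \<noteq> p" for i using that by (simp add: g_def un_def split: if_splits)
      have "c i = 0" for i
        using z[of i] z[of "Suc i"] by (cases "i < p") (auto simp: ins_def split: if_splits)
      then show False using c(2) by auto
    qed
    then show ?thesis using c(3) GR(1)[OF c(1)] by blast
  qed
qed

lemma Cn_inj_le:
  assumes "T \<in> Lin (Cn k) (Cn l)" "inj_on T (carrier (Cn k))"
  shows "k \<le> l"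
proof (rule ccontr)
  assume "\<not> k \<le> l"
  then obtain c where "c \<in> carrier (Cn k)" "c \<noteq> (\<lambda>_. 0)" "T c = (\<lambda>_. 0)"
    using Cn_underdetermined[OF assms(1)] by auto
  then show False
    using assms(2) unfolding inj_on_iff_kernel[OF vspace_Cn vspace_Cn assms(1)] by simp
qed

text \<open>Adds one basis vector. This step enlarges an injective map until it is onto
  (\<open>Cn_extend_full\<close>) or until its range exhausts a given subspace
  (\<open>Cn_subspace\<close>).\<close>

lemma Cn_extend:
  assumes T: "T \<in> Lin (Cn k) X" and X: "vspace X" and y: "y \<in> carrier X"
  shows "(\<lambda>c. T (tr k c) \<oplus>\<^bsub>X\<^esub> c k \<odot>\<^bsub>X\<^esub> y) \<in> Lin (Cn (Suc k)) X"
proof (rule Lin_add[OF X Lin_comp[OF T]])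
  show "tr k \<in> Lin (Cn (Suc k)) (Cn k)" by (rule Lin_I) (auto simp: tr_def)
  show "(\<lambda>c. c k \<odot>\<^bsub>X\<^esub> y) \<in> Lin (Cn (Suc k)) X"
    by (rule Lin_I) (use X y in \<open>auto simp: vspace.smult_add vspace.smult_smult\<close>)
qed

lemma Cn_extend_inj:
  assumes T: "T \<in> Lin (Cn k) X" and X: "vspace X" and y: "y \<in> carrier X"
    and inj: "inj_on T (carrier (Cn k))" and ny: "y \<notin> T ` carrier (Cn k)"
  shows "inj_on (\<lambda>c. T (tr k c) \<oplus>\<^bsub>X\<^esub> c k \<odot>\<^bsub>X\<^esub> y) (carrier (Cn (Suc k)))"
  unfolding inj_on_iff_kernel[OF vspace_Cn X Cn_extend[OF T X y]]
proof (intro ballI impI)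
  note TR = Lin_rules[OF vspace_Cn X T]
  interpret vspace X by (rule X)
  fix c assume c: "c \<in> carrier (Cn (Suc k))" and z: "T (tr k c) \<oplus>\<^bsub>X\<^esub> c k \<odot>\<^bsub>X\<^esub> y = \<zero>\<^bsub>X\<^esub>"
  have Tc: "T (tr k c) \<in> carrier X" by (rule TR(1)[OF tr_in])
  have ck: "c k = 0"
  proof (rule ccontr)
    assume nz: "c k \<noteq> 0"
    have "y = (-1 / c k) \<odot>\<^bsub>X\<^esub> T (tr k c)"
    proof (rule vec_eqI)
      fix f assume f: "f \<in> lfun X"
      have "ev f (T (tr k c) \<oplus>\<^bsub>X\<^esub> c k \<odot>\<^bsub>X\<^esub> y) = ev f \<zero>\<^bsub>X\<^esub>" using z by simp
      then show "ev f y = ev f ((-1 / c k) \<odot>\<^bsub>X\<^esub> T (tr k c))"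
        using f y Tc nz by (simp add: ev_rules field_simps add_eq_0_iff2)
    qed (use y Tc in auto)
    also have "\<dots> = T ((-1 / c k) \<odot>\<^bsub>Cn k\<^esub> tr k c)" by (rule TR(3)[OF tr_in, symmetric])
    finally show False using ny vspace.smult_in[OF vspace_Cn tr_in] by blast
  qed
  then have "T (tr k c) = \<zero>\<^bsub>X\<^esub>" using z Tc y by (simp add: M.r_zero)
  then have "tr k c = (\<lambda>_. 0)" using inj tr_in unfolding inj_on_iff_kernel[OF vspace_Cn X T] by simp
  then have z0: "tr k c i = 0" for i by simp
  have "c i = 0" for i
    using c ck z0[of i] by (cases i k rule: linorder_cases) (auto simp: tr_def split: if_splits)
  then show "c = \<zero>\<^bsub>Cn (Suc k)\<^esub>" by auto
qed

text \<open>A vector missed by \<open>T\<close> would allow an injective extension from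
  \<open>Cn (Suc n)\<close> into \<open>Cn n\<close>.\<close>

lemma Cn_inj_imp_surj:
  assumes T: "T \<in> Lin (Cn n) (Cn n)" and inj: "inj_on T (carrier (Cn n))"
  shows "T ` carrier (Cn n) = carrier (Cn n)"
proof (rule ccontr)
  assume ne: "\<not> ?thesis"
  have "T ` carrier (Cn n) \<subseteq> carrier (Cn n)" using Lin_rules(1)[OF vspace_Cn vspace_Cn T] by blast
  then obtain y where y: "y \<in> carrier (Cn n)" "y \<notin> T ` carrier (Cn n)" using ne by blast
  show False
    using Cn_inj_le[OF Cn_extend[OF T vspace_Cn y(1)] Cn_extend_inj[OF T vspace_Cn y(1) inj y(2)]] by simp
qed

text \<open>Preimages of the unit vectors are chosen and extended linearly.\<close>

lemma Cn_section:
  assumes X: "vspace X" and T: "T \<in> Lin X (Cn n)" and surj: "T ` carrier X = carrier (Cn n)"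
  obtains S where "S \<in> Lin (Cn n) X" "\<And>c. c \<in> carrier (Cn n) \<Longrightarrow> T (S c) = c"
proof -
  have "\<exists>x\<in>carrier X. T x = un k" if "k < n" for k
    using surj un_in[OF that] by (metis imageE)
  then obtain b where b: "\<And>k. k < n \<Longrightarrow> b k \<in> carrier X" "\<And>k. k < n \<Longrightarrow> T (b k) = un k" by metis
  show thesis
  proof (rule that)
    show "lc X b n \<in> Lin (Cn n) X" by (rule Lin_lc[OF X b(1)])
    fix c assume c: "c \<in> carrier (Cn n)"
    have "T (lc X b n c) = lc (Cn n) (\<lambda>k. T (b k)) n c" by (rule lc_comp[OF X vspace_Cn T b(1)])
    also have "\<dots> = lc (Cn n) un n c" by (rule lc_cong) (rule b)
    finally show "T (lc X b n c) = c" using lc_un[OF c] by simp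
  qed
qed

text \<open>A section of \<open>T\<close> is injective, hence onto, so \<open>T\<close> is its
  two-sided inverse.\<close>

lemma Cn_surj_imp_inj:
  assumes T: "T \<in> Lin (Cn n) (Cn n)" and surj: "T ` carrier (Cn n) = carrier (Cn n)"
  shows "inj_on T (carrier (Cn n))"
proof -
  obtain S where S: "S \<in> Lin (Cn n) (Cn n)" and TS: "\<And>c. c \<in> carrier (Cn n) \<Longrightarrow> T (S c) = c"
    using Cn_section[OF vspace_Cn T surj] by blast
  have "inj_on S (carrier (Cn n))" by (rule inj_on_inverseI[of _ T]) (rule TS)
  then have "S ` carrier (Cn n) = carrier (Cn n)" by (rule Cn_inj_imp_surj[OF S])
  then show ?thesis using TS by (metis (no_types, lifting) imageE inj_onI)
qed

text \<open>Extension of a basis, by induction on the number \<open>n - k\<close> of missing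
  vectors: the result is an automorphism that straightens the range of \<open>T\<close> to the first
  \<open>k\<close> coordinates.\<close>

lemma Cn_extend_full:
  assumes "k \<le> n" "T \<in> Lin (Cn k) (Cn n)" "inj_on T (carrier (Cn k))"
  shows "\<exists>E\<in>Lin (Cn n) (Cn n). inj_on E (carrier (Cn n)) \<and> (\<forall>c\<in>carrier (Cn k). E c = T c)"
  using assms
proof (induction "n - k" arbitrary: k T)
  case 0
  then show ?case by auto
next
  case (Suc d)
  have kn: "k < n" using Suc.hyps(2) by simp
  have TX: "T ` carrier (Cn k) \<subseteq> carrier (Cn n)" using Lin_rules(1)[OF vspace_Cn vspace_Cn Suc.prems(2)] by blast
  \<comment> \<open>A surjective \<open>T\<close> would have an inverse embedding
    \<open>Cn n\<close> into the smaller \<open>Cn k\<close>.\<close>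
  have "T ` carrier (Cn k) \<noteq> carrier (Cn n)"
  proof
    assume eq: "T ` carrier (Cn k) = carrier (Cn n)"
    have "inv_into (carrier (Cn k)) T \<in> Lin (Cn n) (Cn k)"
      by (rule Lin_inverse[OF vspace_Cn vspace_Cn Suc.prems(2,3) eq])
    moreover have "inj_on (inv_into (carrier (Cn k)) T) (carrier (Cn n))"
      using inj_on_inv_into[of "carrier (Cn n)" T "carrier (Cn k)"] eq by simp
    ultimately have "n \<le> k" by (rule Cn_inj_le)
    then show False using kn by simp
  qed
  then obtain y where y: "y \<in> carrier (Cn n)" "y \<notin> T ` carrier (Cn k)" using TX by blast
  let ?T = "\<lambda>c. T (tr k c) \<oplus>\<^bsub>Cn n\<^esub> c k \<odot>\<^bsub>Cn n\<^esub> y"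
  have "\<exists>E\<in>Lin (Cn n) (Cn n). inj_on E (carrier (Cn n)) \<and> (\<forall>c\<in>carrier (Cn (Suc k)). E c = ?T c)"
    by (rule Suc.hyps(1)) (use Suc.hyps(2) kn Cn_extend[OF Suc.prems(2) vspace_Cn y(1)]
      Cn_extend_inj[OF Suc.prems(2) vspace_Cn y(1) Suc.prems(3) y(2)] in auto)
  then obtain E where E: "E \<in> Lin (Cn n) (Cn n)" "inj_on E (carrier (Cn n))"
    "\<And>c. c \<in> carrier (Cn (Suc k)) \<Longrightarrow> E c = ?T c" by blast
  have "E c = T c" if c: "c \<in> carrier (Cn k)" for c
    using E(3)[of c] c by simp
  then show ?case using E by blast
qed

text \<open>An embedding of some \<open>Cn k\<close> into \<open>W\<close> with \<open>k\<close>
  maximal must fill \<open>W\<close>, since otherwise one more vector could be added;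
  \<open>k\<close> is bounded by \<open>n\<close>. Extending the embedding to all of
  \<open>Cn n\<close> gives the change of coordinates.\<close>

lemma Cn_subspace:
  assumes W: "subsp (Cn n) W"
  obtains k E E' where "k \<le> n" "E \<in> Lin (Cn n) (Cn n)" "E' \<in> Lin (Cn n) (Cn n)"
    "\<And>c. c \<in> carrier (Cn n) \<Longrightarrow> E (E' c) = c" "\<And>c. c \<in> carrier (Cn n) \<Longrightarrow> E' (E c) = c"
    "E ` carrier (Cn k) = W"
proof -
  define P where "P k \<longleftrightarrow> (\<exists>T\<in>Lin (Cn k) (Cn n). inj_on T (carrier (Cn k)) \<and> T ` carrier (Cn k) \<subseteq> W)" for k
  have P0: "P 0"
    unfolding P_def
  proof (intro bexI conjI)
    show "(\<lambda>_. \<zero>\<^bsub>Cn n\<^esub>) \<in> Lin (Cn 0) (Cn n)" by (rule Lin_zero) simp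
    show "inj_on (\<lambda>_. \<zero>\<^bsub>Cn n\<^esub>) (carrier (Cn 0))" by (auto simp: inj_on_def)
    show "(\<lambda>_. \<zero>\<^bsub>Cn n\<^esub>) ` carrier (Cn 0) \<subseteq> W" using W by (auto simp: subsp_def)
  qed
  have Pn: "k \<le> n" if "P k" for k using that Cn_inj_le unfolding P_def by blast
  define k where "k = (GREATEST k. P k)"
  have Pk: "P k" unfolding k_def using P0 Pn by (rule GreatestI_nat)
  have max: "m \<le> k" if "P m" for m unfolding k_def using that Pn by (rule Greatest_le_nat)
  obtain T where T: "T \<in> Lin (Cn k) (Cn n)" "inj_on T (carrier (Cn k))" "T ` carrier (Cn k) \<subseteq> W"
    using Pk P_def by blast
  have TW: "T ` carrier (Cn k) = W"
  proof (rule ccontr)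
    assume "\<not> ?thesis"
    then obtain y where y: "y \<in> W" "y \<notin> T ` carrier (Cn k)" using T(3) by blast
    have yn: "y \<in> carrier (Cn n)" using W y by (auto simp: subsp_def)
    let ?T = "\<lambda>c. T (tr k c) \<oplus>\<^bsub>Cn n\<^esub> c k \<odot>\<^bsub>Cn n\<^esub> y"
    have "?T c \<in> W" for c
      using W y(1) T(3) tr_in[of k c] unfolding subsp_def by blast
    then have "P (Suc k)" unfolding P_def
      using Cn_extend[OF T(1) vspace_Cn yn] Cn_extend_inj[OF T(1) vspace_Cn yn T(2) y(2)] by blast
    then show False using max[of "Suc k"] by simp
  qed
  obtain E where E: "E \<in> Lin (Cn n) (Cn n)" "inj_on E (carrier (Cn n))" "\<forall>c\<in>carrier (Cn k). E c = T c"
    using Cn_extend_full[OF Pn[OF Pk] T(1,2)] by blast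
  have surj: "E ` carrier (Cn n) = carrier (Cn n)" by (rule Cn_inj_imp_surj[OF E(1,2)])
  show thesis
  proof (rule that[of k E "inv_into (carrier (Cn n)) E"])
    show "inv_into (carrier (Cn n)) E \<in> Lin (Cn n) (Cn n)"
      by (rule Lin_inverse[OF vspace_Cn vspace_Cn E(1,2) surj])
    show "E (inv_into (carrier (Cn n)) E c) = c" if "c \<in> carrier (Cn n)" for c
      using that surj f_inv_into_f[of c E "carrier (Cn n)"] by simp
    show "inv_into (carrier (Cn n)) E (E c) = c" if "c \<in> carrier (Cn n)" for c
      by (rule inv_into_f_f[OF E(2) that])
    show "E ` carrier (Cn k) = W" using E(3) TW by (simp cong: image_cong_simp)
  qed (use Pn[OF Pk] E in auto)
qed

section \<open>Dimension and codimension\<close>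

text \<open>A relation, not a function: the coordinate isomorphism itself is what later
  constructions use, and uniqueness of \<open>n\<close> is proved in
  \<open>dimn_unique\<close>.\<close>

definition dimn :: "'a nspace \<Rightarrow> 'a set \<Rightarrow> nat \<Rightarrow> bool"
  where "dimn X M n \<longleftrightarrow> (\<exists>i\<in>Lin (Cn n) X. inj_on i (carrier (Cn n)) \<and> i ` carrier (Cn n) = M)"

text \<open>The dimension of the quotient by \<open>R\<close>, expressed without quotient and
  without choosing a complement.\<close>

definition codimn :: "'a nspace \<Rightarrow> 'a set \<Rightarrow> nat \<Rightarrow> bool"
  where "codimn X R m \<longleftrightarrow> (\<exists>f\<in>Lin X (Cn m). f ` carrier X = carrier (Cn m) \<and> R = {x \<in> carrier X. f x = (\<lambda>_. 0)})"

lemma Lin_corestrict: "T \<in> Lin X Y \<Longrightarrow> T ` carrier X \<subseteq> M \<Longrightarrow> T \<in> Lin X (Y\<lparr>carrier := M\<rparr>)"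
  by (auto simp: Lin_def)

lemma Lin_coextend: "T \<in> Lin X (Y\<lparr>carrier := M\<rparr>) \<Longrightarrow> M \<subseteq> carrier Y \<Longrightarrow> T \<in> Lin X Y"
  by (auto simp: Lin_def Pi_iff subset_eq)

lemma Lin_restrict: "T \<in> Lin X Y \<Longrightarrow> M \<subseteq> carrier X \<Longrightarrow> T \<in> Lin (X\<lparr>carrier := M\<rparr>) Y"
  by (auto simp: Lin_def Pi_iff subset_eq)

lemma dimn_subsp: "vspace X \<Longrightarrow> dimn X M n \<Longrightarrow> subsp X M"
  unfolding dimn_def using subsp_range[OF vspace_Cn] by blast

lemma dimn_coord:
  assumes X: "vspace X" and i: "i \<in> Lin (Cn n) X" "inj_on i (carrier (Cn n))" "i ` carrier (Cn n) = M"
  obtains p where "p \<in> Lin (X\<lparr>carrier := M\<rparr>) (Cn n)" "\<And>c. c \<in> carrier (Cn n) \<Longrightarrow> p (i c) = c"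
    "\<And>x. x \<in> M \<Longrightarrow> i (p x) = x" "\<And>x. x \<in> M \<Longrightarrow> p x \<in> carrier (Cn n)"
proof -
  have M: "subsp X M" using subsp_range[OF vspace_Cn X i(1)] i(3) by simp
  have iM: "i \<in> Lin (Cn n) (X\<lparr>carrier := M\<rparr>)" using Lin_corestrict[OF i(1)] i(3) by simp
  let ?p = "inv_into (carrier (Cn n)) i"
  have "?p \<in> Lin (X\<lparr>carrier := M\<rparr>) (Cn n)"
    by (rule Lin_inverse[OF vspace_Cn subsp_imp_vspace[OF X M] iM i(2)]) (use i(3) in simp)
  moreover have "?p (i c) = c" if "c \<in> carrier (Cn n)" for c by (rule inv_into_f_f[OF i(2) that])
  moreover have "i (?p x) = x" if "x \<in> M" for x
    using that i(3) f_inv_into_f[of x i "carrier (Cn n)"] by blast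
  moreover have "?p x \<in> carrier (Cn n)" if "x \<in> M" for x
    using that i(3) inv_into_into[of x i "carrier (Cn n)"] by blast
  ultimately show thesis using that by blast
qed

lemma dimn_le:
  assumes X: "vspace X" and n: "dimn X M n" and m: "dimn X M m"
  shows "n \<le> m"
proof -
  obtain i where i: "i \<in> Lin (Cn n) X" "inj_on i (carrier (Cn n))" "i ` carrier (Cn n) = M"
    using n unfolding dimn_def by blast
  obtain i' where i': "i' \<in> Lin (Cn m) X" "inj_on i' (carrier (Cn m))" "i' ` carrier (Cn m) = M"
    using m unfolding dimn_def by blast
  obtain p where p: "p \<in> Lin (X\<lparr>carrier := M\<rparr>) (Cn m)" "\<And>c. c \<in> carrier (Cn m) \<Longrightarrow> p (i' c) = c"
    "\<And>x. x \<in> M \<Longrightarrow> i' (p x) = x" "\<And>x. x \<in> M \<Longrightarrow> p x \<in> carrier (Cn m)"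
    by (rule dimn_coord[OF X i']) (rule that)
  have "(\<lambda>c. p (i c)) \<in> Lin (Cn n) (Cn m)"
    by (rule Lin_comp[OF p(1) Lin_corestrict[OF i(1)]]) (use i(3) in simp)
  moreover have "inj_on (\<lambda>c. p (i c)) (carrier (Cn n))"
  proof (rule inj_onI)
    fix c d assume c: "c \<in> carrier (Cn n)" "d \<in> carrier (Cn n)" "p (i c) = p (i d)"
    have M: "i c \<in> M" "i d \<in> M" using c(1,2) i(3) by blast+
    have "i c = i' (p (i c))" by (rule p(3)[OF M(1), symmetric])
    also have "\<dots> = i d" unfolding c(3) by (rule p(3)[OF M(2)])
    finally have "i c = i d" .
    then show "c = d" using i(2) c by (auto dest: inj_onD)
  qed
  ultimately show ?thesis by (rule Cn_inj_le)
qed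

lemma dimn_unique: "vspace X \<Longrightarrow> dimn X M n \<Longrightarrow> dimn X M m \<Longrightarrow> n = m"
  using dimn_le by (metis le_antisym)

section \<open>Comparison with finite bases\<close>

lemma finsum_lc:
  assumes X: "vspace X" and b: "\<And>k. k < n \<Longrightarrow> b k \<in> carrier X"
  shows "(\<Oplus>\<^bsub>X\<^esub>k\<in>{..<n}. c k \<odot>\<^bsub>X\<^esub> b k) = lc X b n c"
  using b
proof (induction n)
  interpret vspace X by (rule X)
  case 0
  then show ?case by simp
next
  interpret vspace X by (rule X)
  case (Suc n)
  have "(\<Oplus>\<^bsub>X\<^esub>k\<in>{..<Suc n}. c k \<odot>\<^bsub>X\<^esub> b k) = c n \<odot>\<^bsub>X\<^esub> b n \<oplus>\<^bsub>X\<^esub> (\<Oplus>\<^bsub>X\<^esub>k\<in>{..<n}. c k \<odot>\<^bsub>X\<^esub> b k)"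
    unfolding lessThan_Suc by (rule M.finsum_insert) (use Suc.prems in auto)
  also have "\<dots> = lc X b (Suc n) c"
    using Suc lc_in[OF X, of n b c] by (simp add: M.a_comm)
  finally show ?case .
qed

lemma lc_tr: "lc X b n (tr n c) = lc X b n c"
proof -
  have "lc X b m (tr n c) = lc X b m c" if "m \<le> n" for m
    using that by (induction m) (auto simp: tr_def)
  then show ?thesis by simp
qed

lemma finsum_image_lc:
  assumes X: "vspace X" and b: "\<And>k. k < n \<Longrightarrow> h k \<in> carrier X" and inj: "inj_on h {..<n}"
  shows "(\<Oplus>\<^bsub>X\<^esub>b\<in>h ` {..<n}. a b \<odot>\<^bsub>X\<^esub> b) = lc X h n (tr n (\<lambda>k. a (h k)))"
proof -
  interpret vspace X by (rule X)
  have "(\<Oplus>\<^bsub>X\<^esub>b\<in>h ` {..<n}. a b \<odot>\<^bsub>X\<^esub> b) = (\<Oplus>\<^bsub>X\<^esub>k\<in>{..<n}. a (h k) \<odot>\<^bsub>X\<^esub> h k)"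
    by (rule M.finsum_reindex[OF _ inj]) (use b in auto)
  also have "\<dots> = lc X h n (\<lambda>k. a (h k))" by (rule finsum_lc[OF X b])
  finally show ?thesis by (simp add: lc_tr)
qed

lemma lc_in_subsp: "subsp X M \<Longrightarrow> (\<And>k. k < n \<Longrightarrow> b k \<in> M) \<Longrightarrow> lc X b n c \<in> M"
  by (induction n) (auto simp: subsp_def)

lemma finite_basis_imp_dimn:
  assumes X: "vspace X" and M: "subsp X M" and B: "finite_basis X M B"
  shows "dimn X M (card B)"
proof -
  define n where "n = card B"
  have fB: "finite B" "B \<subseteq> M" using B by (auto simp: finite_basis_def)
  obtain h where "bij_betw h {0..<n} B" using ex_bij_betw_nat_finite[OF fB(1)] n_def by blast
  then have h: "inj_on h {..<n}" "h ` {..<n} = B" by (auto simp: bij_betw_def atLeast0LessThan)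
  have hM: "h k \<in> M" if "k < n" for k using that h(2) fB(2) by blast
  have hX: "h k \<in> carrier X" if "k < n" for k using hM[OF that] M by (auto simp: subsp_def)
  have sum: "(\<Oplus>\<^bsub>X\<^esub>b\<in>B. a b \<odot>\<^bsub>X\<^esub> b) = lc X h n (tr n (\<lambda>k. a (h k)))" for a
    using finsum_image_lc[OF X hX h(1), of a] h(2) by simp
  have ex1: "\<exists>!a. a \<in> extensional B \<and> x = lc X h n (tr n (\<lambda>k. a (h k)))" if "x \<in> M" for x
    using B that unfolding finite_basis_def sum by blast
  have lin: "lc X h n \<in> Lin (Cn n) X" by (rule Lin_lc[OF X hX])
  have "inj_on (lc X h n) (carrier (Cn n))"
  proof (rule inj_onI)
    fix c d assume c: "c \<in> carrier (Cn n)" "d \<in> carrier (Cn n)" and eq: "lc X h n c = lc X h n d"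
    \<comment> \<open>Turns coordinates into a coefficient function on \<open>B\<close> that is
      extensional, so that the uniqueness in \<open>finite_basis\<close> applies to it.\<close>
    define e where "e c = (\<lambda>b\<in>B. c (inv_into {..<n} h b) :: complex)" for c
    have e: "tr n (\<lambda>k. e c (h k)) = c" if "c \<in> carrier (Cn n)" for c
      using that h by (auto simp: tr_def e_def fun_eq_iff)
    have "lc X h n c \<in> M" by (rule lc_in_subsp[OF M hM])
    note ex1 = ex1[OF this]
    have "e c \<in> extensional B \<and> lc X h n c = lc X h n (tr n (\<lambda>k. e c (h k)))"
      "e d \<in> extensional B \<and> lc X h n c = lc X h n (tr n (\<lambda>k. e d (h k)))"
      unfolding e[OF c(1)] e[OF c(2)] eq by (simp_all add: e_def)
    then have "e c = e d" using ex1 by blast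
    then have "tr n (\<lambda>k. e c (h k)) = tr n (\<lambda>k. e d (h k))" by (rule arg_cong)
    then show "c = d" unfolding e[OF c(1)] e[OF c(2)] .
  qed
  moreover have "lc X h n ` carrier (Cn n) = M"
  proof (intro equalityI subsetI)
    fix x assume "x \<in> lc X h n ` carrier (Cn n)"
    then obtain c where "x = lc X h n c" by blast
    then show "x \<in> M" using lc_in_subsp[OF M hM, of n "\<lambda>k. k" c] by simp
  next
    fix x assume "x \<in> M"
    then obtain a where "x = lc X h n (tr n (\<lambda>k. a (h k)))" using ex1 by blast
    then show "x \<in> lc X h n ` carrier (Cn n)" using tr_in[of n "\<lambda>k. a (h k)"] by blast
  qed
  ultimately show ?thesis unfolding dimn_def n_def[symmetric] using lin by blast
qed

lemma dimn_imp_finite_basis: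
  assumes X: "vspace X" and n: "dimn X M n"
  obtains B where "finite_basis X M B" "card B = n"
proof -
  obtain i where i: "i \<in> Lin (Cn n) X" "inj_on i (carrier (Cn n))" "i ` carrier (Cn n) = M"
    using n unfolding dimn_def by blast
  have M: "subsp X M" by (rule dimn_subsp[OF X n])
  define h where "h k = i (un k)" for k
  have hM: "h k \<in> M" if "k < n" for k using i(3) un_in[OF that] by (auto simp: h_def)
  have hX: "h k \<in> carrier X" if "k < n" for k using hM[OF that] M by (auto simp: subsp_def)
  have "inj_on h {..<n}"
  proof (rule inj_onI)
    fix k l assume kl: "k \<in> {..<n}" "l \<in> {..<n}" "h k = h l"
    then have "un k = un l" using inj_onD[OF i(2), of "un k" "un l"] un_in by (simp add: h_def)
    then have "un k k = un l k" by simp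
    then show "k = l" by (simp add: un_def split: if_splits)
  qed
  note h = this
  define B where "B = h ` {..<n}"
  have ilc: "i c = lc X h n c" if "c \<in> carrier (Cn n)" for c
    using Lin_expand[OF X i(1) that] unfolding h_def by simp
  have sum: "(\<Oplus>\<^bsub>X\<^esub>b\<in>B. a b \<odot>\<^bsub>X\<^esub> b) = i (tr n (\<lambda>k. a (h k)))" for a
    using finsum_image_lc[OF X hX h, of a] ilc[OF tr_in] unfolding B_def by simp
  have "finite_basis X M B"
    unfolding finite_basis_def sum
  proof (intro conjI ballI)
    show "finite B" "B \<subseteq> M" using hM by (auto simp: B_def)
    fix x assume "x \<in> M"
    then obtain c where c: "c \<in> carrier (Cn n)" "x = i c" using i(3) by blast
    show "\<exists>!a. a \<in> extensional B \<and> x = i (tr n (\<lambda>k. a (h k)))"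
    proof (rule ex1I[of _ "\<lambda>b\<in>B. c (inv_into {..<n} h b)"])
      have "tr n (\<lambda>k. (\<lambda>b\<in>B. c (inv_into {..<n} h b)) (h k)) = c"
        using c h by (auto simp: tr_def B_def fun_eq_iff)
      then show "(\<lambda>b\<in>B. c (inv_into {..<n} h b)) \<in> extensional B \<and>
          x = i (tr n (\<lambda>k. (\<lambda>b\<in>B. c (inv_into {..<n} h b)) (h k)))" using c by simp
      fix a assume a: "a \<in> extensional B \<and> x = i (tr n (\<lambda>k. a (h k)))"
      then have "tr n (\<lambda>k. a (h k)) = c" using c i(2) tr_in[of n "\<lambda>k. a (h k)"] by (auto dest: inj_onD)
      then have z: "tr n (\<lambda>k. a (h k)) k = c k" for k by simp
      have ahk: "a (h k) = c k" if "k < n" for k using that z[of k] by (simp add: tr_def split: if_splits)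
      then show "a = (\<lambda>b\<in>B. c (inv_into {..<n} h b))"
        using a h ahk by (intro extensionalityI[of _ B]) (auto simp: B_def)
    qed
  qed
  moreover have "card B = n" unfolding B_def using card_image[OF h] by simp
  ultimately show thesis using that by blast
qed

lemma finite_dim_iff: "vspace X \<Longrightarrow> subsp X M \<Longrightarrow> finite_dim X M \<longleftrightarrow> (\<exists>n. dimn X M n)"
  unfolding finite_dim_def using finite_basis_imp_dimn dimn_imp_finite_basis by metis

lemma dimn_vdim:
  assumes X: "vspace X" and M: "subsp X M" and f: "finite_dim X M"
  shows "dimn X M (vdim X M)"
  unfolding vdim_def
  by (rule finite_basis_imp_dimn[OF X M someI_ex]) (use f in \<open>simp add: finite_dim_def\<close>)

lemma vdim_eq:
  assumes X: "vspace X" and n: "dimn X M n"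
  shows "finite_dim X M" "vdim X M = n"
proof -
  have M: "subsp X M" by (rule dimn_subsp[OF X n])
  show f: "finite_dim X M" using finite_dim_iff[OF X M] n by blast
  show "vdim X M = n" using dimn_unique[OF X dimn_vdim[OF X M f] n] .
qed

section \<open>Complements and codimension\<close>

lemma set_add_carrier:
  assumes "M <+>\<^bsub>X\<^esub> N = carrier X"
  shows "x \<in> carrier X \<Longrightarrow> \<exists>r\<in>M. \<exists>v\<in>N. x = r \<oplus>\<^bsub>X\<^esub> v" "r \<in> M \<Longrightarrow> v \<in> N \<Longrightarrow> r \<oplus>\<^bsub>X\<^esub> v \<in> carrier X"
proof -
  have "carrier X = {z. \<exists>r\<in>M. \<exists>v\<in>N. z = r \<oplus>\<^bsub>X\<^esub> v}"
    by (subst assms[symmetric]) (auto simp: set_add_defs)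
  then show "x \<in> carrier X \<Longrightarrow> \<exists>r\<in>M. \<exists>v\<in>N. x = r \<oplus>\<^bsub>X\<^esub> v" "r \<in> M \<Longrightarrow> v \<in> N \<Longrightarrow> r \<oplus>\<^bsub>X\<^esub> v \<in> carrier X"
    by blast+
qed

text \<open>The projection onto \<open>N\<close> along \<open>R\<close>, as a linear map only. The
  trivial intersection makes the \<open>N\<close>-part of a vector unique, and uniqueness yields
  linearity.\<close>

lemma complement_projection:
  assumes X: "vspace X" and R: "subsp X R" and N: "subsp X N"
    and int: "R \<inter> N = {\<zero>\<^bsub>X\<^esub>}" and sum: "R <+>\<^bsub>X\<^esub> N = carrier X"
  obtains p where "p \<in> Lin X (X\<lparr>carrier := N\<rparr>)" "\<And>x. x \<in> carrier X \<Longrightarrow> p x \<in> N"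
    "\<And>x. x \<in> carrier X \<Longrightarrow> x \<ominus>\<^bsub>X\<^esub> p x \<in> R" "\<And>x. x \<in> N \<Longrightarrow> p x = x" "\<And>x. x \<in> R \<Longrightarrow> p x = \<zero>\<^bsub>X\<^esub>"
proof -
  interpret vspace X by (rule X)
  have RX: "r \<in> carrier X" if "r \<in> R" for r using R that by (auto simp: subsp_def)
  have NX: "r \<in> carrier X" if "r \<in> N" for r using N that by (auto simp: subsp_def)
  have "\<exists>v. v \<in> N \<and> x \<ominus>\<^bsub>X\<^esub> v \<in> R" if x: "x \<in> carrier X" for x
  proof -
    obtain r v where rv: "r \<in> R" "v \<in> N" "x = r \<oplus>\<^bsub>X\<^esub> v" using set_add_carrier(1)[OF sum x] by blast
    have "x \<ominus>\<^bsub>X\<^esub> v = r" unfolding rv(3) using RX[OF rv(1)] NX[OF rv(2)]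
      by (intro vec_eqI) (auto simp: ev_rules)
    then show ?thesis using rv by blast
  qed
  then obtain p where p: "\<And>x. x \<in> carrier X \<Longrightarrow> p x \<in> N" "\<And>x. x \<in> carrier X \<Longrightarrow> x \<ominus>\<^bsub>X\<^esub> p x \<in> R" by metis
  have uniq: "p x = v" if x: "x \<in> carrier X" and v: "v \<in> N" "x \<ominus>\<^bsub>X\<^esub> v \<in> R" for x v
  proof -
    have "p x \<ominus>\<^bsub>X\<^esub> v \<in> N" using subsp_minus[OF N p(1)[OF x] v(1)] .
    moreover have "p x \<ominus>\<^bsub>X\<^esub> v = (x \<ominus>\<^bsub>X\<^esub> v) \<ominus>\<^bsub>X\<^esub> (x \<ominus>\<^bsub>X\<^esub> p x)"
      using x NX[OF p(1)[OF x]] NX[OF v(1)] by (intro vec_eqI) (auto simp: ev_rules)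
    then have "p x \<ominus>\<^bsub>X\<^esub> v \<in> R" using subsp_minus[OF R v(2) p(2)[OF x]] by simp
    ultimately have "p x \<ominus>\<^bsub>X\<^esub> v = \<zero>\<^bsub>X\<^esub>" using int by blast
    then show ?thesis using minus_eq_zero_iff NX[OF p(1)[OF x]] NX[OF v(1)] by blast
  qed
  have "p \<in> Lin X (X\<lparr>carrier := N\<rparr>)"
  proof (rule Lin_I)
    fix x y assume xy: "x \<in> carrier X" "y \<in> carrier X"
    have "(x \<oplus>\<^bsub>X\<^esub> y) \<ominus>\<^bsub>X\<^esub> (p x \<oplus>\<^bsub>X\<^esub> p y) = (x \<ominus>\<^bsub>X\<^esub> p x) \<oplus>\<^bsub>X\<^esub> (y \<ominus>\<^bsub>X\<^esub> p y)"
      using xy NX p(1) by (intro vec_eqI) (auto simp: ev_rules)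
    then have "p (x \<oplus>\<^bsub>X\<^esub> y) = p x \<oplus>\<^bsub>X\<^esub> p y"
      using p xy R N by (intro uniq) (auto simp: subsp_def)
    then show "p (x \<oplus>\<^bsub>X\<^esub> y) = p x \<oplus>\<^bsub>X\<lparr>carrier := N\<rparr>\<^esub> p y" by simp
  next
    fix c x assume x: "x \<in> carrier X"
    have "(c \<odot>\<^bsub>X\<^esub> x) \<ominus>\<^bsub>X\<^esub> (c \<odot>\<^bsub>X\<^esub> p x) = c \<odot>\<^bsub>X\<^esub> (x \<ominus>\<^bsub>X\<^esub> p x)"
      using x NX p(1) by (intro vec_eqI) (auto simp: ev_rules algebra_simps)
    then have "p (c \<odot>\<^bsub>X\<^esub> x) = c \<odot>\<^bsub>X\<^esub> p x"
      using p x R N by (intro uniq) (auto simp: subsp_def)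
    then show "p (c \<odot>\<^bsub>X\<^esub> x) = c \<odot>\<^bsub>X\<lparr>carrier := N\<rparr>\<^esub> p x" by simp
  qed (use p in simp)
  moreover have "p x = x" if "x \<in> N" for x
    using that NX[OF that] R by (intro uniq) (auto simp: minus_self subsp_def)
  moreover have "p x = \<zero>\<^bsub>X\<^esub>" if x: "x \<in> R" for x
  proof (rule uniq)
    have "x \<ominus>\<^bsub>X\<^esub> \<zero>\<^bsub>X\<^esub> = x" using RX[OF x] by (intro vec_eqI) (auto simp: ev_rules)
    then show "x \<ominus>\<^bsub>X\<^esub> \<zero>\<^bsub>X\<^esub> \<in> R" using x by simp
  qed (use RX[OF x] N in \<open>auto simp: subsp_def\<close>)
  ultimately show thesis using p that by blast
qed

text \<open>Coordinates of \<open>N\<close> composed with the projection along \<open>R\<close> form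
  a surjection with kernel \<open>R\<close>; conversely such a surjection restricts to an
  isomorphism on \<open>N\<close>. All complements thus have the same dimension, which makes the
  choice in \<open>Coker\<close> harmless.\<close>

lemma codimn_complement:
  assumes X: "vspace X" and R: "subsp X R" and N: "subsp X N"
    and int: "R \<inter> N = {\<zero>\<^bsub>X\<^esub>}" and sum: "R <+>\<^bsub>X\<^esub> N = carrier X"
  shows "dimn X N m \<longleftrightarrow> codimn X R m"
proof
  interpret vspace X by (rule X)
  have RX: "r \<in> carrier X" if "r \<in> R" for r using R that by (auto simp: subsp_def)
  have NX: "r \<in> carrier X" if "r \<in> N" for r using N that by (auto simp: subsp_def)
  obtain p where p: "p \<in> Lin X (X\<lparr>carrier := N\<rparr>)" "\<And>x. x \<in> carrier X \<Longrightarrow> p x \<in> N"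
    "\<And>x. x \<in> carrier X \<Longrightarrow> x \<ominus>\<^bsub>X\<^esub> p x \<in> R" "\<And>x. x \<in> N \<Longrightarrow> p x = x" "\<And>x. x \<in> R \<Longrightarrow> p x = \<zero>\<^bsub>X\<^esub>"
    by (rule complement_projection[OF assms]) (rule that)
  assume "dimn X N m"
  then obtain i where i: "i \<in> Lin (Cn m) X" "inj_on i (carrier (Cn m))" "i ` carrier (Cn m) = N"
    unfolding dimn_def by blast
  obtain q where q: "q \<in> Lin (X\<lparr>carrier := N\<rparr>) (Cn m)" "\<And>c. c \<in> carrier (Cn m) \<Longrightarrow> q (i c) = c"
    "\<And>x. x \<in> N \<Longrightarrow> i (q x) = x" "\<And>x. x \<in> N \<Longrightarrow> q x \<in> carrier (Cn m)"
    by (rule dimn_coord[OF X i]) (rule that)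
  note iR = Lin_rules[OF vspace_Cn X i(1)]
  note qR = Lin_rules[OF subsp_imp_vspace[OF X N] vspace_Cn q(1)]
  show "codimn X R m" unfolding codimn_def
  proof (intro bexI[of _ "\<lambda>x. q (p x)"] conjI)
    show "(\<lambda>x. q (p x)) \<in> Lin X (Cn m)" by (rule Lin_comp[OF q(1) p(1)])
    show "(\<lambda>x. q (p x)) ` carrier X = carrier (Cn m)"
    proof (intro equalityI subsetI)
      fix c assume c: "c \<in> carrier (Cn m)"
      have "i c \<in> N" using i(3) c by blast
      then show "c \<in> (\<lambda>x. q (p x)) ` carrier X"
        using q(2)[OF c] p(4) NX by (intro image_eqI[of _ _ "i c"]) auto
    qed (use q(4) p(2) in auto)
    show "R = {x \<in> carrier X. q (p x) = (\<lambda>_. 0)}"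
    proof (intro equalityI subsetI)
      fix x assume "x \<in> R"
      then show "x \<in> {x \<in> carrier X. q (p x) = (\<lambda>_. 0)}" using RX p(5) qR(4) by simp
    next
      fix x assume "x \<in> {x \<in> carrier X. q (p x) = (\<lambda>_. 0)}"
      then have x: "x \<in> carrier X" "q (p x) = (\<lambda>_. 0)" by auto
      have "p x = i (q (p x))" by (rule q(3)[OF p(2)[OF x(1)], symmetric])
      also have "\<dots> = \<zero>\<^bsub>X\<^esub>" using x iR(4) by simp
      finally have "x \<ominus>\<^bsub>X\<^esub> \<zero>\<^bsub>X\<^esub> \<in> R" using p(3)[OF x(1)] by simp
      moreover have "x \<ominus>\<^bsub>X\<^esub> \<zero>\<^bsub>X\<^esub> = x" using x by (intro vec_eqI) (auto simp: ev_rules)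
      ultimately show "x \<in> R" by simp
    qed
  qed
next
  have NX: "N \<subseteq> carrier X" using N by (auto simp: subsp_def)
  assume "codimn X R m"
  then obtain f where f: "f \<in> Lin X (Cn m)" "f ` carrier X = carrier (Cn m)" "R = {x \<in> carrier X. f x = (\<lambda>_. 0)}"
    unfolding codimn_def by blast
  note fR = Lin_rules[OF X vspace_Cn f(1)]
  have fN: "f \<in> Lin (X\<lparr>carrier := N\<rparr>) (Cn m)" using Lin_restrict[OF f(1) NX] .
  note vN = subsp_imp_vspace[OF X N]
  have inj: "inj_on f (carrier (X\<lparr>carrier := N\<rparr>))"
    unfolding inj_on_iff_kernel[OF vN vspace_Cn fN] using f(3) int NX by auto
  have surj: "f ` carrier (X\<lparr>carrier := N\<rparr>) = carrier (Cn m)"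
  proof (intro equalityI subsetI)
    fix c assume "c \<in> carrier (Cn m)"
    then obtain x where x: "x \<in> carrier X" "c = f x" using f(2) by blast
    obtain r v where rv: "r \<in> R" "v \<in> N" "x = r \<oplus>\<^bsub>X\<^esub> v" using set_add_carrier(1)[OF sum x(1)] by blast
    have "f x = f v" unfolding rv(3) using rv f(3) NX fR(2)[of r v] by auto
    then show "c \<in> f ` carrier (X\<lparr>carrier := N\<rparr>)" using x rv by simp
  qed (use fR(1) NX in auto)
  let ?i = "inv_into (carrier (X\<lparr>carrier := N\<rparr>)) f"
  have "?i \<in> Lin (Cn m) (X\<lparr>carrier := N\<rparr>)" by (rule Lin_inverse[OF vN vspace_Cn fN inj surj])
  then have "?i \<in> Lin (Cn m) X" by (rule Lin_coextend[OF _ NX])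
  moreover have "inj_on ?i (carrier (Cn m))" using inj_on_inv_into[of "carrier (Cn m)" f "carrier (X\<lparr>carrier := N\<rparr>)"] surj by simp
  moreover have "?i ` carrier (Cn m) = N" using inj surj inv_into_image_cancel[OF inj, of N] by simp
  ultimately show "dimn X N m" unfolding dimn_def by blast
qed

section \<open>Fredholm operators in coordinates\<close>

text \<open>From here on elements of coordinate spaces are abstract vectors like any others;
  unfolding the operations pointwise would take identities out of reach of \<open>ev_rules\<close>
  and of the rules for linear maps.\<close>

declare Cn_simps(1-4) [simp del] Cn_minus [simp del]

context vspace begin

lemma minus_zero_right: "x \<in> carrier X \<Longrightarrow> x \<ominus> \<zero> = x"
  by (intro vec_eqI) (auto simp: ev_rules)

lemma minus_minus_self: "x \<in> carrier X \<Longrightarrow> y \<in> carrier X \<Longrightarrow> x \<ominus> (x \<ominus> y) = y"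
  by (intro vec_eqI) (auto simp: ev_rules)

lemma minus_add_cancel: "x \<in> carrier X \<Longrightarrow> y \<in> carrier X \<Longrightarrow> (x \<ominus> y) \<oplus> y = x"
  by (intro vec_eqI) (auto simp: ev_rules)

lemma add_minus_cancel: "x \<in> carrier X \<Longrightarrow> y \<in> carrier X \<Longrightarrow> y \<oplus> (x \<ominus> y) = x"
  by (intro vec_eqI) (auto simp: ev_rules)

lemma add_zero_left: "x \<in> carrier X \<Longrightarrow> \<zero> \<oplus> x = x"
  by (intro vec_eqI) (auto simp: ev_rules)

lemma add_zero_right: "x \<in> carrier X \<Longrightarrow> x \<oplus> \<zero> = x"
  by (intro vec_eqI) (auto simp: ev_rules)

end

lemmas vec_cancel [simp] = vspace.minus_zero_right vspace.minus_minus_self vspace.minus_add_cancel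
  vspace.add_minus_cancel vspace.add_zero_left vspace.add_zero_right vspace.minus_self

lemmas B_rules = Lin_rules[OF _ _ B_Lin]

text \<open>The operator matrix with rows \<open>T, B\<close> and \<open>C, 0\<close> is invertible with inverse \<open>S, i\<close> and \<open>j, 0\<close>;
  thus \<open>n\<close> and \<open>m\<close> are the dimensions of the kernel and the cokernel of \<open>T\<close>.\<close>

definition fdec :: "'a nspace \<Rightarrow> 'b nspace \<Rightarrow> ('a \<Rightarrow> 'b) \<Rightarrow> nat \<Rightarrow> nat \<Rightarrow> ('b \<Rightarrow> 'a) \<Rightarrow>
    ((nat \<Rightarrow> complex) \<Rightarrow> 'a) \<Rightarrow> ('a \<Rightarrow> nat \<Rightarrow> complex) \<Rightarrow> ((nat \<Rightarrow> complex) \<Rightarrow> 'b) \<Rightarrow> ('b \<Rightarrow> nat \<Rightarrow> complex) \<Rightarrow> bool"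
  where "fdec X Y T n m S i C B j \<longleftrightarrow> T \<in> \<B> X Y \<and> S \<in> \<B> Y X \<and> i \<in> \<B> (Cn n) X \<and> C \<in> \<B> X (Cn n) \<and>
    B \<in> \<B> (Cn m) Y \<and> j \<in> \<B> Y (Cn m) \<and>
    (\<forall>x\<in>carrier X. S (T x) = x \<ominus>\<^bsub>X\<^esub> i (C x)) \<and> (\<forall>y\<in>carrier Y. T (S y) = y \<ominus>\<^bsub>Y\<^esub> B (j y)) \<and>
    (\<forall>c\<in>carrier (Cn n). T (i c) = \<zero>\<^bsub>Y\<^esub>) \<and> (\<forall>c\<in>carrier (Cn n). C (i c) = c) \<and>
    (\<forall>x\<in>carrier X. j (T x) = \<zero>\<^bsub>Cn m\<^esub>) \<and> (\<forall>c\<in>carrier (Cn m). j (B c) = c) \<and>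
    (\<forall>y\<in>carrier Y. C (S y) = \<zero>\<^bsub>Cn n\<^esub>) \<and> (\<forall>c\<in>carrier (Cn m). S (B c) = \<zero>\<^bsub>X\<^esub>)"

definition fdata :: "'a nspace \<Rightarrow> 'b nspace \<Rightarrow> ('a \<Rightarrow> 'b) \<Rightarrow> nat \<Rightarrow> nat \<Rightarrow> bool"
  where "fdata X Y T n m \<longleftrightarrow> (\<exists>S i C B j. fdec X Y T n m S i C B j)"

lemma fdataE:
  assumes "fdata X Y T n m"
  obtains S i C B j where "fdec X Y T n m S i C B j"
  using assms unfolding fdata_def by blast

lemma fdecD:
  assumes "fdec X Y T n m S i C B j"
  shows "T \<in> \<B> X Y" "S \<in> \<B> Y X" "i \<in> \<B> (Cn n) X" "C \<in> \<B> X (Cn n)" "B \<in> \<B> (Cn m) Y" "j \<in> \<B> Y (Cn m)"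
    "\<And>x. x \<in> carrier X \<Longrightarrow> S (T x) = x \<ominus>\<^bsub>X\<^esub> i (C x)"
    "\<And>y. y \<in> carrier Y \<Longrightarrow> T (S y) = y \<ominus>\<^bsub>Y\<^esub> B (j y)"
    "\<And>c. c \<in> carrier (Cn n) \<Longrightarrow> T (i c) = \<zero>\<^bsub>Y\<^esub>"
    "\<And>c. c \<in> carrier (Cn n) \<Longrightarrow> C (i c) = c"
    "\<And>x. x \<in> carrier X \<Longrightarrow> j (T x) = \<zero>\<^bsub>Cn m\<^esub>"
    "\<And>c. c \<in> carrier (Cn m) \<Longrightarrow> j (B c) = c"
    "\<And>y. y \<in> carrier Y \<Longrightarrow> C (S y) = \<zero>\<^bsub>Cn n\<^esub>"
    "\<And>c. c \<in> carrier (Cn m) \<Longrightarrow> S (B c) = \<zero>\<^bsub>X\<^esub>"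
  using assms unfolding fdec_def by blast+

text \<open>The last two conditions on \<open>S\<close> can be enforced by passing to \<open>S T S = S - i C S\<close>.\<close>

lemma fdataI:
  assumes X: "normed X" and Y: "normed Y"
    and T: "T \<in> \<B> X Y" and S: "S \<in> \<B> Y X" and i: "i \<in> \<B> (Cn n) X" and C: "C \<in> \<B> X (Cn n)"
    and B: "B \<in> \<B> (Cn m) Y" and j: "j \<in> \<B> Y (Cn m)"
    and ST [simp]: "\<And>x. x \<in> carrier X \<Longrightarrow> S (T x) = x \<ominus>\<^bsub>X\<^esub> i (C x)"
    and TS [simp]: "\<And>y. y \<in> carrier Y \<Longrightarrow> T (S y) = y \<ominus>\<^bsub>Y\<^esub> B (j y)"
    and Ti [simp]: "\<And>c. c \<in> carrier (Cn n) \<Longrightarrow> T (i c) = \<zero>\<^bsub>Y\<^esub>"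
    and Ci [simp]: "\<And>c. c \<in> carrier (Cn n) \<Longrightarrow> C (i c) = c"
    and jT [simp]: "\<And>x. x \<in> carrier X \<Longrightarrow> j (T x) = \<zero>\<^bsub>Cn m\<^esub>"
    and jB [simp]: "\<And>c. c \<in> carrier (Cn m) \<Longrightarrow> j (B c) = c"
  shows "fdata X Y T n m"
proof -
  note [simp] = X Y normed_vspace[OF X] normed_vspace[OF Y]
  note [simp] = B_rules[OF normed_vspace[OF X] normed_vspace[OF Y] T]
    B_rules[OF normed_vspace[OF Y] normed_vspace[OF X] S] B_rules[OF vspace_Cn normed_vspace[OF X] i]
    B_rules[OF normed_vspace[OF X] vspace_Cn C] B_rules[OF vspace_Cn normed_vspace[OF Y] B]
    B_rules[OF normed_vspace[OF Y] vspace_Cn j]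
  \<comment> \<open>\<open>T S B c = B c - B (j (B c))\<close> is zero, so \<open>S T S\<close>
    annihilates the range of \<open>B\<close>.\<close>
  have SB [simp]: "S (B c) \<ominus>\<^bsub>X\<^esub> i (C (S (B c))) = \<zero>\<^bsub>X\<^esub>" if c: "c \<in> carrier (Cn m)" for c
  proof -
    have "S (B c) \<ominus>\<^bsub>X\<^esub> i (C (S (B c))) = S (T (S (B c)))" by (rule ST[symmetric]) (use c in simp)
    also have "T (S (B c)) = \<zero>\<^bsub>Y\<^esub>" using c by simp
    finally show ?thesis by simp
  qed
  have S': "(\<lambda>y. S y \<ominus>\<^bsub>X\<^esub> i (C (S y))) \<in> \<B> Y X"
    by (rule B_minus[OF Y X S B_comp[OF Y normed_Cn i B_comp[OF Y X C S]]])
  have "fdec X Y T n m (\<lambda>y. S y \<ominus>\<^bsub>X\<^esub> i (C (S y))) i C B j"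
    unfolding fdec_def by (intro conjI ballI T i C B j S') simp_all
  then show ?thesis unfolding fdata_def by blast
qed

text \<open>The cokernel side is given by maps \<open>B\<close> and \<open>j\<close> that are only
  linear. They enter the bounded bijection \<open>(c, x) -> B c + T x\<close> from
  \<open>Cn m\<close> and the kernel of \<open>C\<close> onto \<open>Y\<close>; the open mapping
  theorem bounds its inverse, whose components are \<open>j'\<close> (in fact \<open>j\<close>
  again) and \<open>S\<close>.\<close>

lemma fdata_algebraic:
  assumes X: "banach_space X" and Y: "banach_space Y" and T: "T \<in> \<B> X Y"
    and i: "i \<in> \<B> (Cn n) X" and C: "C \<in> \<B> X (Cn n)" and B: "B \<in> Lin (Cn m) Y" and j: "j \<in> Lin Y (Cn m)"
    and Ci: "\<And>c. c \<in> carrier (Cn n) \<Longrightarrow> C (i c) = c"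
    and ker: "i ` carrier (Cn n) = {x \<in> carrier X. T x = \<zero>\<^bsub>Y\<^esub>}"
    and jB: "\<And>c. c \<in> carrier (Cn m) \<Longrightarrow> j (B c) = c"
    and ran: "T ` carrier X = {y \<in> carrier Y. j y = \<zero>\<^bsub>Cn m\<^esub>}"
  shows "fdata X Y T n m"
proof -
  note X' = banach_normed[OF X] note Y' = banach_normed[OF Y]
  note XV = banach_vspace[OF X] note YV = banach_vspace[OF Y]
  note TR = B_rules[OF XV YV T] note iR = B_rules[OF vspace_Cn XV i] note CR = B_rules[OF XV vspace_Cn C]
  note BR = Lin_rules[OF vspace_Cn YV B] note jR = Lin_rules[OF YV vspace_Cn j]
  note [simp] = XV YV TR iR CR BR jR Ci jB
  have Ti [simp]: "T (i c) = \<zero>\<^bsub>Y\<^esub>" if "c \<in> carrier (Cn n)" for c using ker that by blast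
  have jT [simp]: "j (T x) = \<zero>\<^bsub>Cn m\<^esub>" if "x \<in> carrier X" for x using ran that by blast
  define K where "K = {x \<in> carrier X. C x = \<zero>\<^bsub>Cn n\<^esub>}"
  have K: "closed_subspace X K" unfolding K_def by (rule closed_subspace_kernel[OF X' normed_Cn C])
  have KX: "K \<subseteq> carrier X" by (auto simp: K_def)
  define XK where "XK = X\<lparr>carrier := K\<rparr>"
  have XKc: "carrier XK = K" by (simp add: XK_def)
  have XK: "banach_space XK" unfolding XK_def by (rule banach_closed_subspace[OF X K])
  let ?Z = "Cn m \<oplus>\<^sub>B XK"
  have Z: "banach_space ?Z" by (rule banach_dsum[OF banach_Cn XK])
  have T_K: "T \<in> \<B> XK Y"
    using T KX unfolding bounded_ops_iff XK_def by (auto intro: Lin_restrict)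
  have incl: "(\<lambda>x. x) \<in> \<B> XK X"
    by (rule B_I[where K = 1]) (auto simp: XK_def Lin_def K_def)
  have BB: "B \<in> \<B> (Cn m) Y" by (rule B_Cn[OF Y' B])
  define \<Phi> where "\<Phi> z = B (fst z) \<oplus>\<^bsub>Y\<^esub> T (snd z)" for z
  note Zn = banach_normed[OF Z] note XKn = banach_normed[OF XK]
  have \<Phi>: "\<Phi> \<in> \<B> ?Z Y"
    unfolding \<Phi>_def
    by (rule B_add[OF Zn Y' B_comp[OF Zn normed_Cn BB B_fst[OF normed_Cn XKn]]
      B_comp[OF Zn XKn T_K B_snd[OF normed_Cn XKn]]])
  have proj: "x \<ominus>\<^bsub>X\<^esub> i (C x) \<in> K" if "x \<in> carrier X" for x
    using that by (simp add: K_def)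
  have inj: "inj_on \<Phi> (carrier ?Z)"
    unfolding inj_on_iff_kernel[OF banach_vspace[OF Z] YV B_Lin[OF \<Phi>]]
  proof (intro ballI impI)
    fix z assume z: "z \<in> carrier ?Z" and eq: "\<Phi> z = \<zero>\<^bsub>Y\<^esub>"
    obtain c x where zc: "z = (c, x)" by fastforce
    have cx: "c \<in> carrier (Cn m)" "x \<in> carrier X" "C x = \<zero>\<^bsub>Cn n\<^esub>"
      using z unfolding zc by (auto simp: XKc K_def)
    have "j (\<Phi> z) = c" unfolding \<Phi>_def zc using cx by simp
    then have c: "c = \<zero>\<^bsub>Cn m\<^esub>" unfolding eq by simp
    have "T x = \<zero>\<^bsub>Y\<^esub>" using eq cx(2) unfolding \<Phi>_def zc c by simp
    then obtain d where d: "d \<in> carrier (Cn n)" "x = i d" using ker cx(2) by blast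
    have "d = C x" using d by simp
    then have "x = \<zero>\<^bsub>X\<^esub>" using d cx(3) by simp
    then show "z = \<zero>\<^bsub>?Z\<^esub>" using zc c by (simp add: XK_def)
  qed
  have surj: "\<Phi> ` carrier ?Z = carrier Y"
  proof (intro equalityI subsetI)
    fix y assume y: "y \<in> carrier Y"
    have "y \<ominus>\<^bsub>Y\<^esub> B (j y) \<in> {y \<in> carrier Y. j y = \<zero>\<^bsub>Cn m\<^esub>}" using y by simp
    then obtain x where x: "x \<in> carrier X" "T x = y \<ominus>\<^bsub>Y\<^esub> B (j y)" using ran by (metis imageE)
    have "\<Phi> (j y, x \<ominus>\<^bsub>X\<^esub> i (C x)) = y" unfolding \<Phi>_def using x y by simp
    then show "y \<in> \<Phi> ` carrier ?Z"
      using x y proj by (intro image_eqI[of _ _ "(j y, x \<ominus>\<^bsub>X\<^esub> i (C x))"]) (auto simp: XKc)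
  next
    fix y assume "y \<in> \<Phi> ` carrier ?Z"
    then show "y \<in> carrier Y" using KX by (auto simp: \<Phi>_def XKc)
  qed
  obtain \<Psi> where \<Psi>: "\<Psi> \<in> \<B> Y ?Z" "\<And>z. z \<in> carrier ?Z \<Longrightarrow> \<Psi> (\<Phi> z) = z" "\<And>y. y \<in> carrier Y \<Longrightarrow> \<Phi> (\<Psi> y) = y"
    by (rule bounded_inverse[OF Z Y \<Phi> inj surj]) (rule that)
  define S where "S y = snd (\<Psi> y)" for y
  define j' where "j' y = fst (\<Psi> y)" for y
  have S: "S \<in> \<B> Y X" unfolding S_def
    by (rule B_comp[OF Y' XKn incl B_comp[OF Y' Zn B_snd[OF normed_Cn XKn] \<Psi>(1)]])
  have j': "j' \<in> \<B> Y (Cn m)" unfolding j'_def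
    by (rule B_comp[OF Y' Zn B_fst[OF normed_Cn XKn] \<Psi>(1)])
  show ?thesis
  proof (rule fdataI[OF X' Y' T S i C BB j'])
    fix x assume x: "x \<in> carrier X"
    have "\<Phi> (\<zero>\<^bsub>Cn m\<^esub>, x \<ominus>\<^bsub>X\<^esub> i (C x)) = T x" unfolding \<Phi>_def using x by simp
    moreover have "(\<zero>\<^bsub>Cn m\<^esub>, x \<ominus>\<^bsub>X\<^esub> i (C x)) \<in> carrier ?Z" using proj[OF x] by (simp add: XKc)
    ultimately have "\<Psi> (T x) = (\<zero>\<^bsub>Cn m\<^esub>, x \<ominus>\<^bsub>X\<^esub> i (C x))" using \<Psi>(2) by metis
    then show "S (T x) = x \<ominus>\<^bsub>X\<^esub> i (C x)" "j' (T x) = \<zero>\<^bsub>Cn m\<^esub>" by (simp_all add: S_def j'_def)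
  next
    fix y assume y: "y \<in> carrier Y"
    have c: "S y \<in> carrier X" "j' y \<in> carrier (Cn m)"
      using B_rules(1)[OF YV XV S y] B_rules(1)[OF YV vspace_Cn j' y] by auto
    have "B (j' y) \<oplus>\<^bsub>Y\<^esub> T (S y) = y" using \<Psi>(3)[OF y] by (simp add: \<Phi>_def S_def j'_def)
    then have "y \<ominus>\<^bsub>Y\<^esub> B (j' y) = (B (j' y) \<oplus>\<^bsub>Y\<^esub> T (S y)) \<ominus>\<^bsub>Y\<^esub> B (j' y)" by simp
    also have "\<dots> = T (S y)" using c by (intro vspace.vec_eqI[OF YV]) (auto simp: vec_ev[OF YV])
    finally show "T (S y) = y \<ominus>\<^bsub>Y\<^esub> B (j' y)" by simp
  next
    fix c assume c: "c \<in> carrier (Cn m)"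
    have 0: "\<zero>\<^bsub>X\<^esub> \<in> K" by (simp add: K_def)
    have "\<Phi> (c, \<zero>\<^bsub>X\<^esub>) = B c" unfolding \<Phi>_def using c by simp
    then have "\<Psi> (B c) = (c, \<zero>\<^bsub>X\<^esub>)" using \<Psi>(2)[of "(c, \<zero>\<^bsub>X\<^esub>)"] c 0 by (simp add: XKc)
    then show "j' (B c) = c" by (simp add: j'_def)
  qed auto
qed

section \<open>Equivalence of bordering data and the Fredholm property\<close>

lemma complements_closed:
  "complements X M N \<Longrightarrow> closed_subspace X M" "complements X M N \<Longrightarrow> closed_subspace X N"
  "complements X M N \<Longrightarrow> M \<inter> N = {\<zero>\<^bsub>X\<^esub>}" "complements X M N \<Longrightarrow> M <+>\<^bsub>X\<^esub> N = carrier X"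
  by (auto simp: complements_def)

lemma closed_subsp: "normed X \<Longrightarrow> closed_subspace X M \<Longrightarrow> subsp X M"
  using closed_subspace_iff by blast

lemma Ker_eq: "Ker X Y T = {x \<in> carrier X. T x = \<zero>\<^bsub>Y\<^esub>}"
  by (auto simp: a_kernel_def kernel_def)

text \<open>The complement \<open>M\<close> is closed, hence a Banach space, and
  \<open>(c, x) -> i c + x\<close> is a bounded bijection from \<open>Cn n\<close> and
  \<open>M\<close> onto \<open>X\<close>. The first component of its inverse is the required
  coordinate map.\<close>

lemma kernel_projection:
  assumes X: "banach_space X" and comp: "complements X N M"
    and i: "i \<in> Lin (Cn n) X" "inj_on i (carrier (Cn n))" "i ` carrier (Cn n) = N"
  obtains C where "C \<in> \<B> X (Cn n)" "\<And>c. c \<in> carrier (Cn n) \<Longrightarrow> C (i c) = c"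
proof -
  note X' = banach_normed[OF X] note XV = banach_vspace[OF X]
  note M = complements_closed(2)[OF comp]
  note iR [simp] = Lin_rules[OF vspace_Cn XV i(1)]
  have MX: "M \<subseteq> carrier X" using closed_subsp[OF X' M] by (auto simp: subsp_def)
  define XM where "XM = X\<lparr>carrier := M\<rparr>"
  have XMc: "carrier XM = M" by (simp add: XM_def)
  have XM: "banach_space XM" unfolding XM_def by (rule banach_closed_subspace[OF X M])
  let ?Z = "Cn n \<oplus>\<^sub>B XM"
  have Z: "banach_space ?Z" by (rule banach_dsum[OF banach_Cn XM])
  note Zn = banach_normed[OF Z] note XMn = banach_normed[OF XM]
  have incl: "(\<lambda>x. x) \<in> \<B> XM X"
    by (rule B_I[where K = 1]) (use MX in \<open>auto simp: XM_def Lin_def\<close>)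
  define \<Phi> where "\<Phi> z = i (fst z) \<oplus>\<^bsub>X\<^esub> snd z" for z
  have \<Phi>: "\<Phi> \<in> \<B> ?Z X"
    unfolding \<Phi>_def
    by (rule B_add[OF Zn X' B_comp[OF Zn normed_Cn B_Cn[OF X' i(1)] B_fst[OF normed_Cn XMn]]
      B_comp[OF Zn XMn incl B_snd[OF normed_Cn XMn]]])
  have inj: "inj_on \<Phi> (carrier ?Z)"
    unfolding inj_on_iff_kernel[OF banach_vspace[OF Z] XV B_Lin[OF \<Phi>]]
  proof (intro ballI impI)
    fix z assume z: "z \<in> carrier ?Z" and eq: "\<Phi> z = \<zero>\<^bsub>X\<^esub>"
    obtain c x where zc: "z = (c, x)" by fastforce
    have cx: "c \<in> carrier (Cn n)" "x \<in> M" "x \<in> carrier X"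
      using z MX unfolding zc by (auto simp: XMc)
    have "x = i (\<ominus>\<^bsub>Cn n\<^esub> c)"
    proof (rule vspace.vec_eqI[OF XV])
      fix f assume f: "f \<in> lfun X"
      have "ev f (\<Phi> z) = 0" using eq vec_ev(3)[OF XV f] by simp
      then show "ev f x = ev f (i (\<ominus>\<^bsub>Cn n\<^esub> c))"
        using f cx XV by (simp add: \<Phi>_def zc vec_ev[OF XV] add_eq_0_iff)
    qed (use cx XV in auto)
    then have "x \<in> N" using i(3) vspace.neg_in[OF vspace_Cn cx(1)] by blast
    then have x: "x = \<zero>\<^bsub>X\<^esub>" using cx complements_closed(3)[OF comp] by blast
    then have "i c = \<zero>\<^bsub>X\<^esub>" using eq cx XV by (simp add: \<Phi>_def zc)
    then have "c = \<zero>\<^bsub>Cn n\<^esub>" using i(2) cx(1) unfolding inj_on_iff_kernel[OF vspace_Cn XV i(1)] by blast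
    then show "z = \<zero>\<^bsub>?Z\<^esub>" using zc x by (simp add: XM_def)
  qed
  have surj: "\<Phi> ` carrier ?Z = carrier X"
  proof (intro equalityI subsetI)
    fix y assume y: "y \<in> carrier X"
    obtain r v where rv: "r \<in> N" "v \<in> M" "y = r \<oplus>\<^bsub>X\<^esub> v"
      using set_add_carrier(1)[OF complements_closed(4)[OF comp] y] by blast
    obtain c where c: "c \<in> carrier (Cn n)" "r = i c" using i(3) rv(1) by blast
    show "y \<in> \<Phi> ` carrier ?Z"
      using c rv by (intro image_eqI[of _ _ "(c, v)"]) (auto simp: XMc \<Phi>_def)
  next
    fix y assume "y \<in> \<Phi> ` carrier ?Z"
    then show "y \<in> carrier X" using MX XV by (auto simp: \<Phi>_def XMc)
  qed
  obtain \<Psi> where \<Psi>: "\<Psi> \<in> \<B> X ?Z" "\<And>z. z \<in> carrier ?Z \<Longrightarrow> \<Psi> (\<Phi> z) = z" "\<And>y. y \<in> carrier X \<Longrightarrow> \<Phi> (\<Psi> y) = y"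
    by (rule bounded_inverse[OF Z X \<Phi> inj surj]) (rule that)
  show thesis
  proof (rule that[of "\<lambda>x. fst (\<Psi> x)"])
    show "(\<lambda>x. fst (\<Psi> x)) \<in> \<B> X (Cn n)"
      by (rule B_comp[OF X' Zn B_fst[OF normed_Cn XMn] \<Psi>(1)])
    fix c assume c: "c \<in> carrier (Cn n)"
    have 0: "\<zero>\<^bsub>X\<^esub> \<in> M" using closed_subsp[OF X' M] by (simp add: subsp_def)
    have "\<Phi> (c, \<zero>\<^bsub>X\<^esub>) = i c" unfolding \<Phi>_def using c XV by simp
    then have "\<Psi> (i c) = (c, \<zero>\<^bsub>X\<^esub>)" using \<Psi>(2)[of "(c, \<zero>\<^bsub>X\<^esub>)"] c 0 by (simp add: XMc)
    then show "fst (\<Psi> (i c)) = c" by simp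
  qed
qed

lemma Coker_complements:
  assumes "complemented Y (Ran X T)"
  shows "complements Y (Ran X T) (Coker X Y T)"
  unfolding Coker_def by (rule someI_ex) (use assms in \<open>simp add: complemented_def\<close>)

text \<open>On the kernel side the closed complement gives bounded coordinates. On the cokernel side
  algebraic coordinates are enough, as \<open>fdata_algebraic\<close> provides bounded ones.\<close>

lemma fredholm_imp_fdata:
  assumes X: "banach_space X" and Y: "banach_space Y" and T: "fredholm X Y T"
  shows "fdata X Y T (vdim X (Ker X Y T)) (vdim Y (Coker X Y T))"
proof -
  note X' = banach_normed[OF X] note Y' = banach_normed[OF Y]
  note XV = banach_vspace[OF X] note YV = banach_vspace[OF Y]
  have TB: "T \<in> \<B> X Y" and cR: "complemented Y (Ran X T)" and fK: "finite_dim X (Ker X Y T)"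
    and fC: "finite_dim Y (Coker X Y T)" using T by (auto simp: fredholm_def)
  obtain M where M: "complements X (Ker X Y T) M" using T by (auto simp: fredholm_def complemented_def)
  note KN = closed_subsp[OF X' complements_closed(1)[OF M]]
  note CC = Coker_complements[OF cR]
  let ?n = "vdim X (Ker X Y T)" and ?m = "vdim Y (Coker X Y T)"
  have "dimn X (Ker X Y T) ?n" by (rule dimn_vdim[OF XV KN fK])
  then obtain i where i: "i \<in> Lin (Cn ?n) X" "inj_on i (carrier (Cn ?n))" "i ` carrier (Cn ?n) = Ker X Y T"
    unfolding dimn_def by blast
  obtain C where C: "C \<in> \<B> X (Cn ?n)" "\<And>c. c \<in> carrier (Cn ?n) \<Longrightarrow> C (i c) = c"
    by (rule kernel_projection[OF X M i]) (rule that)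
  note CN = closed_subsp[OF Y' complements_closed(2)[OF CC]]
  note RN = closed_subsp[OF Y' complements_closed(1)[OF CC]]
  have "dimn Y (Coker X Y T) ?m" by (rule dimn_vdim[OF YV CN fC])
  then have "codimn Y (Ran X T) ?m"
    unfolding codimn_complement[OF YV RN CN complements_closed(3,4)[OF CC]] .
  then obtain f where f: "f \<in> Lin Y (Cn ?m)" "f ` carrier Y = carrier (Cn ?m)"
    "Ran X T = {y \<in> carrier Y. f y = (\<lambda>_. 0)}" unfolding codimn_def by blast
  obtain B where B: "B \<in> Lin (Cn ?m) Y" "\<And>c. c \<in> carrier (Cn ?m) \<Longrightarrow> f (B c) = c"
    by (rule Cn_section[OF YV f(1,2)]) (rule that)
  show ?thesis
  proof (rule fdata_algebraic[OF X Y TB B_Cn[OF X' i(1)] C(1) B(1) f(1) C(2) _ B(2)])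
    show "i ` carrier (Cn ?n) = {x \<in> carrier X. T x = \<zero>\<^bsub>Y\<^esub>}" using i(3) by (simp add: Ker_eq)
    show "T ` carrier X = {y \<in> carrier Y. f y = \<zero>\<^bsub>Cn ?m\<^esub>}"
      using f(3) by (simp add: Ran_def Cn_simps)
  qed
qed

lemma set_add_carrierI:
  assumes X: "vspace X" and M: "M \<subseteq> carrier X" and N: "N \<subseteq> carrier X"
    and ex: "\<And>x. x \<in> carrier X \<Longrightarrow> \<exists>r\<in>M. \<exists>v\<in>N. x = r \<oplus>\<^bsub>X\<^esub> v"
  shows "M <+>\<^bsub>X\<^esub> N = carrier X"
proof (intro equalityI subsetI)
  fix x assume "x \<in> carrier X"
  then show "x \<in> M <+>\<^bsub>X\<^esub> N" using ex by (auto simp: set_add_defs)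
next
  fix x assume "x \<in> M <+>\<^bsub>X\<^esub> N"
  then show "x \<in> carrier X" using M N X by (auto simp: set_add_defs subset_eq)
qed

lemma fdata_imp_fredholm:
  assumes X: "banach_space X" and Y: "banach_space Y" and T: "fdata X Y T n m"
  shows "fredholm X Y T" "vdim X (Ker X Y T) = n" "vdim Y (Coker X Y T) = m"
proof -
  note X' = banach_normed[OF X] note Y' = banach_normed[OF Y]
  note XV = banach_vspace[OF X] note YV = banach_vspace[OF Y]
  obtain S i C B j where D: "fdec X Y T n m S i C B j" using T by (rule fdataE)
  note d = fdecD[OF D]
  note [simp] = XV YV B_rules[OF XV YV d(1)] B_rules[OF YV XV d(2)] B_rules[OF vspace_Cn XV d(3)]
    B_rules[OF XV vspace_Cn d(4)] B_rules[OF vspace_Cn YV d(5)] B_rules[OF YV vspace_Cn d(6)]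
  note [simp] = d(7-14)
  have ker: "i ` carrier (Cn n) = Ker X Y T"
  proof (intro equalityI subsetI)
    fix x assume "x \<in> Ker X Y T"
    then have x: "x \<in> carrier X" "T x = \<zero>\<^bsub>Y\<^esub>" by (auto simp: Ker_eq)
    have "x = x \<ominus>\<^bsub>X\<^esub> S (T x)" unfolding x(2) using x(1) by simp
    also have "\<dots> = i (C x)" using x(1) by simp
    finally show "x \<in> i ` carrier (Cn n)" using x(1) B_rules(1)[OF XV vspace_Cn d(4)] by blast
  qed (auto simp: Ker_eq)
  have inj: "inj_on i (carrier (Cn n))" by (rule inj_on_inverseI[of _ C]) simp
  have dK: "dimn X (Ker X Y T) n" unfolding dimn_def using B_Lin[OF d(3)] inj ker by blast
  have ran: "Ran X T = {y \<in> carrier Y. j y = \<zero>\<^bsub>Cn m\<^esub>}"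
  proof (intro equalityI subsetI)
    fix y assume "y \<in> {y \<in> carrier Y. j y = \<zero>\<^bsub>Cn m\<^esub>}"
    then have y: "y \<in> carrier Y" "j y = \<zero>\<^bsub>Cn m\<^esub>" by auto
    have "T (S y) = y" using y by simp
    then show "y \<in> Ran X T" unfolding Ran_def using B_rules(1)[OF YV XV d(2) y(1)] by (metis imageI)
  qed (auto simp: Ran_def)
  have cd: "codimn Y (Ran X T) m" unfolding codimn_def
  proof (intro bexI[of _ j] conjI)
    show "j \<in> Lin Y (Cn m)" by (rule B_Lin[OF d(6)])
    show "Ran X T = {x \<in> carrier Y. j x = (\<lambda>_. 0)}" using ran by (simp add: Cn_simps)
    show "j ` carrier Y = carrier (Cn m)"
    proof (intro equalityI subsetI)
      fix c assume c: "c \<in> carrier (Cn m)"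
      then show "c \<in> j ` carrier Y" using B_rules(1)[OF vspace_Cn YV d(5) c] d(12)[OF c] by (metis imageI)
    qed auto
  qed
  have compK: "complements X (Ker X Y T) {x \<in> carrier X. C x = \<zero>\<^bsub>Cn n\<^esub>}"
    unfolding complements_def
  proof (intro conjI)
    show "closed_subspace X (Ker X Y T)" unfolding Ker_eq by (rule closed_subspace_kernel[OF X' Y' d(1)])
    show "closed_subspace X {x \<in> carrier X. C x = \<zero>\<^bsub>Cn n\<^esub>}" by (rule closed_subspace_kernel[OF X' normed_Cn d(4)])
    show "Ker X Y T \<inter> {x \<in> carrier X. C x = \<zero>\<^bsub>Cn n\<^esub>} = {\<zero>\<^bsub>X\<^esub>}"
      unfolding ker[symmetric] by auto (metis B_rules(4)[OF XV vspace_Cn d(4)] B_rules(4)[OF vspace_Cn XV d(3)] imageI vspace.zero_in[OF vspace_Cn])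
    show "Ker X Y T <+>\<^bsub>X\<^esub> {x \<in> carrier X. C x = \<zero>\<^bsub>Cn n\<^esub>} = carrier X"
    proof (rule set_add_carrierI[OF XV])
      fix x assume x: "x \<in> carrier X"
      show "\<exists>r\<in>Ker X Y T. \<exists>v\<in>{x \<in> carrier X. C x = \<zero>\<^bsub>Cn n\<^esub>}. x = r \<oplus>\<^bsub>X\<^esub> v"
        by (rule bexI[of _ "i (C x)"], rule bexI[of _ "x \<ominus>\<^bsub>X\<^esub> i (C x)"]) (use x in \<open>auto simp: Ker_eq\<close>)
    qed (auto simp: Ker_eq)
  qed
  \<comment> \<open>The kernel of \<open>S\<close> is the range of \<open>B\<close>; in this form
    the complement is visibly closed.\<close>
  have compR: "complements Y (Ran X T) {y \<in> carrier Y. S y = \<zero>\<^bsub>X\<^esub>}"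
    unfolding complements_def
  proof (intro conjI)
    show "closed_subspace Y (Ran X T)" unfolding ran by (rule closed_subspace_kernel[OF Y' normed_Cn d(6)])
    show "closed_subspace Y {y \<in> carrier Y. S y = \<zero>\<^bsub>X\<^esub>}" by (rule closed_subspace_kernel[OF Y' X' d(2)])
    show "Ran X T \<inter> {y \<in> carrier Y. S y = \<zero>\<^bsub>X\<^esub>} = {\<zero>\<^bsub>Y\<^esub>}"
    proof (intro equalityI subsetI)
      fix y assume "y \<in> Ran X T \<inter> {y \<in> carrier Y. S y = \<zero>\<^bsub>X\<^esub>}"
      then have y: "y \<in> carrier Y" "j y = \<zero>\<^bsub>Cn m\<^esub>" "S y = \<zero>\<^bsub>X\<^esub>" using ran by auto
      have "y = T (S y)" using y(1,2) by simp
      also have "\<dots> = \<zero>\<^bsub>Y\<^esub>" unfolding y(3) by simp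
      finally show "y \<in> {\<zero>\<^bsub>Y\<^esub>}" by simp
    qed (auto simp: ran)
    show "Ran X T <+>\<^bsub>Y\<^esub> {y \<in> carrier Y. S y = \<zero>\<^bsub>X\<^esub>} = carrier Y"
    proof (rule set_add_carrierI[OF YV])
      fix y assume y: "y \<in> carrier Y"
      show "\<exists>r\<in>Ran X T. \<exists>v\<in>{y \<in> carrier Y. S y = \<zero>\<^bsub>X\<^esub>}. y = r \<oplus>\<^bsub>Y\<^esub> v"
        by (rule bexI[of _ "y \<ominus>\<^bsub>Y\<^esub> B (j y)"], rule bexI[of _ "B (j y)"]) (use y in \<open>auto simp: ran\<close>)
    qed (auto simp: ran)
  qed
  have cR: "complemented Y (Ran X T)" using compR by (auto simp: complemented_def)
  note CC = Coker_complements[OF cR]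
  note CN = closed_subsp[OF Y' complements_closed(2)[OF CC]]
  note RN = closed_subsp[OF Y' complements_closed(1)[OF CC]]
  have dC: "dimn Y (Coker X Y T) m"
    unfolding codimn_complement[OF YV RN CN complements_closed(3,4)[OF CC]] by (rule cd)
  show "vdim X (Ker X Y T) = n" "vdim Y (Coker X Y T) = m"
    using vdim_eq(2)[OF XV dK] vdim_eq(2)[OF YV dC] by simp_all
  show "fredholm X Y T" unfolding fredholm_def
    using d(1) cR compK vdim_eq(1)[OF XV dK] vdim_eq(1)[OF YV dC] by (auto simp: complemented_def)
qed

section \<open>Stability of the index\<close>

text \<open>The operators \<open>I + P Q\<close> on \<open>X\<close> and \<open>I + Q P\<close> on
  \<open>Cn k\<close> are injective together and surjective together, since \<open>P\<close> and
  \<open>Q\<close> intertwine them; in \<open>Cn k\<close> the two properties coincide.\<close>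

lemma id_plus_finrk_inj_iff_surj:
  assumes X: "vspace X" and P: "P \<in> Lin (Cn k) X" and Q: "Q \<in> Lin X (Cn k)"
  shows "inj_on (\<lambda>x. x \<oplus>\<^bsub>X\<^esub> P (Q x)) (carrier X) \<longleftrightarrow> (\<lambda>x. x \<oplus>\<^bsub>X\<^esub> P (Q x)) ` carrier X = carrier X"
proof -
  interpret X: vspace X by (rule X)
  interpret Ck: vspace "Cn k" by simp
  note [simp] = X Lin_rules[OF vspace_Cn X P] Lin_rules[OF X vspace_Cn Q]
  let ?A = "\<lambda>x. x \<oplus>\<^bsub>X\<^esub> P (Q x)" and ?Ak = "\<lambda>c. c \<oplus>\<^bsub>Cn k\<^esub> Q (P c)"
  have AL: "?A \<in> Lin X X" by (rule Lin_add[OF X Lin_id Lin_comp[OF P Q]])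
  have AkL: "?Ak \<in> Lin (Cn k) (Cn k)" by (rule Lin_add[OF vspace_Cn Lin_id Lin_comp[OF Q P]])
  have injk: "inj_on ?Ak (carrier (Cn k)) \<longleftrightarrow> ?Ak ` carrier (Cn k) = carrier (Cn k)"
    using Cn_inj_imp_surj[OF AkL] Cn_surj_imp_inj[OF AkL] by blast
  show ?thesis
  proof
    assume inj: "inj_on ?A (carrier X)"
    have "inj_on ?Ak (carrier (Cn k))"
      unfolding inj_on_iff_kernel[OF vspace_Cn vspace_Cn AkL]
    proof (intro ballI impI)
      fix c assume c: "c \<in> carrier (Cn k)" and z: "c \<oplus>\<^bsub>Cn k\<^esub> Q (P c) = \<zero>\<^bsub>Cn k\<^esub>"
      have "?A (P c) = P (c \<oplus>\<^bsub>Cn k\<^esub> Q (P c))" using c by simp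
      then have "?A (P c) = \<zero>\<^bsub>X\<^esub>" unfolding z by simp
      moreover have "P c \<in> carrier X" using c by simp
      ultimately have "P c = \<zero>\<^bsub>X\<^esub>" using inj unfolding inj_on_iff_kernel[OF X X AL] by blast
      then have "Q (P c) = \<zero>\<^bsub>Cn k\<^esub>" by simp
      then show "c = \<zero>\<^bsub>Cn k\<^esub>" using z c by simp
    qed
    then have surjk: "?Ak ` carrier (Cn k) = carrier (Cn k)" using injk by blast
    show "?A ` carrier X = carrier X"
    proof (intro equalityI subsetI)
      fix x assume x: "x \<in> carrier X"
      then have "Q x \<in> ?Ak ` carrier (Cn k)" using surjk by simp
      then obtain w where w: "w \<in> carrier (Cn k)" "Q x = w \<oplus>\<^bsub>Cn k\<^esub> Q (P w)" by blast
      \<comment> \<open>If \<open>w + Q P w = Q x\<close>, then \<open>x - P w\<close> solves the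
        equation on \<open>X\<close>. The opposite passage below uses \<open>c - Q z\<close> in the
        same way.\<close>
      have Pw: "P (Q x) = P w \<oplus>\<^bsub>X\<^esub> P (Q (P w))" unfolding w(2) using w(1) by simp
      have "?A (x \<ominus>\<^bsub>X\<^esub> P w) = x"
        using x w(1) by (intro X.vec_eqI) (auto simp: X.ev_rules Pw)
      then show "x \<in> ?A ` carrier X" using x w(1) by (intro image_eqI[of _ _ "x \<ominus>\<^bsub>X\<^esub> P w"]) auto
    qed auto
  next
    assume surj: "?A ` carrier X = carrier X"
    have "?Ak ` carrier (Cn k) = carrier (Cn k)"
    proof (intro equalityI subsetI)
      fix c assume c: "c \<in> carrier (Cn k)"
      then have "P c \<in> ?A ` carrier X" using surj by simp
      then obtain z where z: "z \<in> carrier X" "P c = z \<oplus>\<^bsub>X\<^esub> P (Q z)" by blast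
      have QP: "Q (P c) = Q z \<oplus>\<^bsub>Cn k\<^esub> Q (P (Q z))" unfolding z(2) using z(1) by simp
      have "?Ak (c \<ominus>\<^bsub>Cn k\<^esub> Q z) = c"
        using c z(1) by (intro Ck.vec_eqI) (auto simp: Ck.ev_rules QP)
      then show "c \<in> ?Ak ` carrier (Cn k)"
        using c z(1) by (intro image_eqI[of _ _ "c \<ominus>\<^bsub>Cn k\<^esub> Q z"]) auto
    qed auto
    then have inj: "inj_on ?Ak (carrier (Cn k))" using injk by blast
    show "inj_on ?A (carrier X)"
      unfolding inj_on_iff_kernel[OF X X AL]
    proof (intro ballI impI)
      fix x assume x: "x \<in> carrier X" and z: "x \<oplus>\<^bsub>X\<^esub> P (Q x) = \<zero>\<^bsub>X\<^esub>"
      have "?Ak (Q x) = Q (x \<oplus>\<^bsub>X\<^esub> P (Q x))" using x by simp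
      then have "?Ak (Q x) = \<zero>\<^bsub>Cn k\<^esub>" unfolding z by simp
      moreover have "Q x \<in> carrier (Cn k)" using x by simp
      ultimately have "Q x = \<zero>\<^bsub>Cn k\<^esub>"
        using inj unfolding inj_on_iff_kernel[OF vspace_Cn vspace_Cn AkL] by blast
      then have "P (Q x) = \<zero>\<^bsub>X\<^esub>" by simp
      then show "x = \<zero>\<^bsub>X\<^esub>" using z x by simp
    qed
  qed
qed

text \<open>Finite rank as a factorization through a coordinate space. The notion is purely
  algebraic, because it only serves to compare injectivity with surjectivity.\<close>

definition finrk :: "'a nspace \<Rightarrow> 'b nspace \<Rightarrow> ('a \<Rightarrow> 'b) \<Rightarrow> bool"
  where "finrk X Y F \<longleftrightarrow> (\<exists>k. \<exists>Q\<in>Lin X (Cn k). \<exists>P\<in>Lin (Cn k) Y. \<forall>x\<in>carrier X. F x = P (Q x))"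

lemma finrkE:
  assumes "finrk X Y F"
  obtains k P Q where "P \<in> Lin (Cn k) Y" "Q \<in> Lin X (Cn k)" "\<And>x. x \<in> carrier X \<Longrightarrow> F x = P (Q x)"
  using assms unfolding finrk_def by blast

lemma finrkI: "P \<in> Lin (Cn k) Y \<Longrightarrow> Q \<in> Lin X (Cn k) \<Longrightarrow> (\<And>x. x \<in> carrier X \<Longrightarrow> F x = P (Q x)) \<Longrightarrow> finrk X Y F"
  unfolding finrk_def by blast

lemma finrk_cong: "finrk X Y F \<Longrightarrow> (\<And>x. x \<in> carrier X \<Longrightarrow> F' x = F x) \<Longrightarrow> finrk X Y F'"
  unfolding finrk_def by simp

lemma finrk_left: "finrk X Y F \<Longrightarrow> L \<in> Lin Y Z \<Longrightarrow> finrk X Z (\<lambda>x. L (F x))"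
proof (erule finrkE)
  fix k P Q assume L: "L \<in> Lin Y Z" and P: "P \<in> Lin (Cn k) Y" and "Q \<in> Lin X (Cn k)" "\<And>x. x \<in> carrier X \<Longrightarrow> F x = P (Q x)"
  then show "finrk X Z (\<lambda>x. L (F x))" by (intro finrkI[OF Lin_comp[OF L P]]) auto
qed

lemma finrk_right: "finrk X Y F \<Longrightarrow> L \<in> Lin Z X \<Longrightarrow> finrk Z Y (\<lambda>x. F (L x))"
proof (erule finrkE)
  fix k P Q assume L: "L \<in> Lin Z X" and P: "P \<in> Lin (Cn k) Y" and Q: "Q \<in> Lin X (Cn k)" and "\<And>x. x \<in> carrier X \<Longrightarrow> F x = P (Q x)"
  moreover have "L x \<in> carrier X" if "x \<in> carrier Z" for x using L that by (auto simp: Lin_def)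
  ultimately show "finrk Z Y (\<lambda>x. F (L x))" by (intro finrkI[OF P Lin_comp[OF Q L]]) auto
qed

lemma Lin_tr [simp]: "tr k \<in> Lin (Cn n) (Cn k)"
  by (rule Lin_I) (auto simp: tr_def Cn_simps)

lemma finrk_minus:
  assumes Y: "vspace Y" and F: "finrk X Y F" and G: "finrk X Y G"
  shows "finrk X Y (\<lambda>x. F x \<ominus>\<^bsub>Y\<^esub> G x)"
proof -
  obtain k P Q where F: "P \<in> Lin (Cn k) Y" "Q \<in> Lin X (Cn k)" "\<And>x. x \<in> carrier X \<Longrightarrow> F x = P (Q x)"
    by (rule finrkE[OF F]) (rule that)
  obtain l R S where G: "R \<in> Lin (Cn l) Y" "S \<in> Lin X (Cn l)" "\<And>x. x \<in> carrier X \<Longrightarrow> G x = R (S x)"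
    by (rule finrkE[OF G]) (rule that)
  \<comment> \<open>The two factorizations are put side by side in \<open>Cn (k + l)\<close>:
    coordinates below \<open>k\<close> belong to \<open>F\<close>, the others, shifted down by
    \<open>k\<close>, to \<open>G\<close>.\<close>
  define sh where "sh c = (\<lambda>i. if i < l then c (i + k) else 0)" for c :: "nat \<Rightarrow> complex"
  define Q' where "Q' x = (\<lambda>i. if i < k then Q x i else S x (i - k))" for x
  have sh: "sh \<in> Lin (Cn (k + l)) (Cn l)"
    by (rule Lin_I) (auto simp: sh_def Cn_simps)
  have Qz: "Q x i = 0" if "x \<in> carrier X" "i \<ge> k" for x i using F(2) that by (auto simp: Lin_def Cn_simps Pi_iff)
  have Sz: "S x i = 0" if "x \<in> carrier X" "i \<ge> l" for x i using G(2) that by (auto simp: Lin_def Cn_simps Pi_iff)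
  have Q': "Q' \<in> Lin X (Cn (k + l))"
  proof (rule Lin_I)
    fix x assume "x \<in> carrier X"
    then show "Q' x \<in> carrier (Cn (k + l))" using Qz Sz by (auto simp: Q'_def Cn_simps)
  qed (use F(2) G(2) in \<open>auto simp: Q'_def Lin_def Cn_simps fun_eq_iff\<close>)
  have P': "(\<lambda>c. P (tr k c) \<ominus>\<^bsub>Y\<^esub> R (sh c)) \<in> Lin (Cn (k + l)) Y"
    by (rule Lin_minus[OF Y Lin_comp[OF F(1) Lin_tr] Lin_comp[OF G(1) sh]])
  show ?thesis
  proof (rule finrkI[OF P' Q'])
    fix x assume x: "x \<in> carrier X"
    have "tr k (Q' x) = Q x" using Qz[OF x] by (auto simp: tr_def Q'_def fun_eq_iff)
    moreover have "sh (Q' x) = S x" using Sz[OF x] by (auto simp: sh_def Q'_def fun_eq_iff)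
    ultimately show "F x \<ominus>\<^bsub>Y\<^esub> G x = P (tr k (Q' x)) \<ominus>\<^bsub>Y\<^esub> R (sh (Q' x))" using F(3)[OF x] G(3)[OF x] by simp
  qed
qed

definition bijL :: "'a nspace \<Rightarrow> 'b nspace \<Rightarrow> ('a \<Rightarrow> 'b) \<Rightarrow> bool"
  where "bijL X Y T \<longleftrightarrow> T \<in> Lin X Y \<and> inj_on T (carrier X) \<and> T ` carrier X = carrier Y"

text \<open>Because \<open>G - J = P Q\<close> and \<open>P\<close> can be pulled back through the
  bijection \<open>J\<close>, the map \<open>G\<close> is \<open>J\<close> after an identity plus
  finite rank; both properties of \<open>G\<close> are those of the latter.\<close>

lemma finrk_perturbation:
  assumes X: "vspace X" and Y: "vspace Y" and J: "bijL X Y J" and G: "G \<in> Lin X Y"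
    and F: "finrk X Y (\<lambda>x. G x \<ominus>\<^bsub>Y\<^esub> J x)"
  shows "inj_on G (carrier X) \<longleftrightarrow> G ` carrier X = carrier Y"
proof -
  have JL: "J \<in> Lin X Y" and Ji: "inj_on J (carrier X)" and Js: "J ` carrier X = carrier Y"
    using J by (auto simp: bijL_def)
  define J' where "J' = inv_into (carrier X) J"
  have J'L: "J' \<in> Lin Y X" unfolding J'_def by (rule Lin_inverse[OF X Y JL Ji Js])
  have JJ': "J (J' y) = y" if "y \<in> carrier Y" for y
    unfolding J'_def using that Js f_inv_into_f[of y J "carrier X"] by blast
  obtain k P Q where PQ: "P \<in> Lin (Cn k) Y" "Q \<in> Lin X (Cn k)" "\<And>x. x \<in> carrier X \<Longrightarrow> G x \<ominus>\<^bsub>Y\<^esub> J x = P (Q x)"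
    by (rule finrkE[OF F]) (rule that)
  note [simp] = X Y Lin_rules[OF X Y JL] Lin_rules[OF Y X J'L] Lin_rules[OF X Y G]
    Lin_rules[OF vspace_Cn Y PQ(1)] Lin_rules[OF X vspace_Cn PQ(2)]
  let ?A = "\<lambda>x. x \<oplus>\<^bsub>X\<^esub> J' (P (Q x))"
  have JA: "J (?A x) = G x" if x: "x \<in> carrier X" for x
  proof -
    have "J (?A x) = J x \<oplus>\<^bsub>Y\<^esub> (G x \<ominus>\<^bsub>Y\<^esub> J x)" using x JJ'[of "P (Q x)"] by (simp add: PQ(3))
    also have "\<dots> = G x" using x by simp
    finally show ?thesis .
  qed
  have AX: "?A x \<in> carrier X" if "x \<in> carrier X" for x using that by simp
  have "inj_on G (carrier X) \<longleftrightarrow> inj_on ?A (carrier X)"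
  proof
    assume "inj_on G (carrier X)"
    then show "inj_on ?A (carrier X)" using JA unfolding inj_on_def by metis
  next
    assume i: "inj_on ?A (carrier X)"
    show "inj_on G (carrier X)"
    proof (rule inj_onI)
      fix x y assume xy: "x \<in> carrier X" "y \<in> carrier X" "G x = G y"
      then have "J (?A x) = J (?A y)" using JA by simp
      then have "?A x = ?A y" by (rule inj_onD[OF Ji _ AX[OF xy(1)] AX[OF xy(2)]])
      then show "x = y" by (rule inj_onD[OF i _ xy(1,2)])
    qed
  qed
  also have "\<dots> \<longleftrightarrow> ?A ` carrier X = carrier X"
    by (rule id_plus_finrk_inj_iff_surj[OF X Lin_comp[OF J'L PQ(1)] PQ(2)])
  also have "\<dots> \<longleftrightarrow> G ` carrier X = carrier Y"
  proof -
    have GA: "G ` carrier X = J ` (?A ` carrier X)"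
      unfolding image_image by (rule image_cong[OF refl JA[symmetric]])
    have sub: "?A ` carrier X \<subseteq> carrier X" using AX by blast
    show ?thesis unfolding GA Js[symmetric] using inj_on_image_eq_iff[OF Ji sub subset_refl] by simp
  qed
  finally show ?thesis .
qed

text \<open>Index 0 without dimensions: an algebraic isomorphism up to finite rank.
  \<open>index0_near\<close> relates it to equal defects, also for neighbouring operators.\<close>

definition index0 :: "'a nspace \<Rightarrow> ('a \<Rightarrow> 'a) \<Rightarrow> bool"
  where "index0 X T \<longleftrightarrow> (\<exists>H. bijL X X H \<and> finrk X X (\<lambda>x. H x \<ominus>\<^bsub>X\<^esub> T x))"

text \<open>Neumann's argument keeps \<open>L G\<close> or \<open>G L\<close> bijective, where
  \<open>G\<close> is the finite-rank modification \<open>T1 + F0\<close> of a neighbour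
  \<open>T1\<close> of \<open>T\<close>. If \<open>n = m\<close>, both are bijective and
  \<open>G\<close> is the bijection that \<open>index0\<close> asks for. If
  \<open>n \<noteq> m\<close> and some bijective \<open>H\<close> differed from \<open>T1\<close> by
  finite rank, then \<open>L H\<close> or \<open>H L\<close> would be bijective by
  \<open>finrk_perturbation\<close>, although \<open>L\<close> is not injective for
  \<open>n < m\<close> and not surjective for \<open>m < n\<close>.\<close>

lemma index0_near:
  assumes X: "banach_space X" and D: "fdec X X T n m S i C B j"
  shows "\<exists>\<delta>>0. \<forall>T1\<in>Lin X X. (\<forall>x\<in>carrier X. vnorm X (T1 x \<ominus>\<^bsub>X\<^esub> T x) \<le> \<delta> * vnorm X x) \<longrightarrow> (index0 X T1 \<longleftrightarrow> n = m)"
proof -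
  interpret X: normed X by (rule banach_normed[OF X])
  note Xn = banach_normed[OF X] note XV = banach_vspace[OF X]
  note d = fdecD[OF D]
  note [simp] = XV B_rules[OF XV XV d(1)] B_rules[OF XV XV d(2)] B_rules[OF vspace_Cn XV d(3)]
    B_rules[OF XV vspace_Cn d(4)] B_rules[OF vspace_Cn XV d(5)] B_rules[OF XV vspace_Cn d(6)]
  note [simp] = d(7-14)
  have trr [simp]: "tr a \<in> \<B> (Cn b) (Cn a)" for a b by (rule B_Cn) auto
  note [simp] = B_rules[OF vspace_Cn vspace_Cn trr]
  \<comment> \<open>\<open>F0\<close> sends kernel coordinates to cokernel coordinates as far as
    both exist, and \<open>L\<close> goes back. Hence \<open>L\<close> is a left inverse of
    \<open>T + F0\<close> if \<open>n \<le> m\<close> and a right inverse if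
    \<open>m \<le> n\<close>.\<close>
  define F0 where "F0 x = B (tr m (C x))" for x
  define L where "L y = S y \<oplus>\<^bsub>X\<^esub> i (tr n (j y))" for y
  have F0: "F0 \<in> Lin X X" unfolding F0_def
    by (rule Lin_comp[OF B_Lin[OF d(5)] Lin_comp[OF Lin_tr B_Lin[OF d(4)]]])
  have F0f: "finrk X X F0" unfolding F0_def
    by (rule finrkI[OF B_Lin[OF d(5)] Lin_comp[OF Lin_tr B_Lin[OF d(4)]]]) simp
  have LB: "L \<in> \<B> X X" unfolding L_def
    by (rule B_add[OF Xn Xn d(2) B_comp[OF Xn normed_Cn d(3) B_comp[OF Xn normed_Cn trr d(6)]]])
  note LL = B_Lin[OF LB]
  note [simp] = Lin_rules[OF XV XV LL] Lin_rules[OF XV XV F0]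
  have LT: "L (T x \<oplus>\<^bsub>X\<^esub> F0 x) = x" if x: "x \<in> carrier X" and nm: "n \<le> m" for x
  proof -
    have "tr n (tr m (C x)) = C x" using x nm by (simp add: tr_id[of _ n])
    then show ?thesis using x unfolding L_def F0_def by simp
  qed
  have TL: "T (L y) \<oplus>\<^bsub>X\<^esub> F0 (L y) = y" if y: "y \<in> carrier X" and nm: "m \<le> n" for y
  proof -
    have "tr m (tr n (j y)) = j y" using y nm by (simp add: tr_id[of _ m])
    then show ?thesis using y unfolding L_def F0_def by simp
  qed
  obtain l where l: "l > 0" "\<And>x. x \<in> carrier X \<Longrightarrow> vnorm X (L x) \<le> l * vnorm X x"
    by (rule B_bound[OF Xn LB]) (rule that)
  show ?thesis
  \<comment> \<open>\<open>l\<close> bounds \<open>L\<close>, so a perturbation of this size has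
    norm at most 1/2 after composition with \<open>L\<close> on either side.\<close>
  proof (intro exI[of _ "1 / (2 * l)"] conjI ballI impI)
    show "0 < 1 / (2 * l)" using l by simp
    fix T1 assume T1: "T1 \<in> Lin X X" and near: "\<forall>x\<in>carrier X. vnorm X (T1 x \<ominus>\<^bsub>X\<^esub> T x) \<le> 1 / (2 * l) * vnorm X x"
    note [simp] = Lin_rules[OF XV XV T1]
    define E where "E x = T1 x \<ominus>\<^bsub>X\<^esub> T x" for x
    define G where "G x = T1 x \<oplus>\<^bsub>X\<^esub> F0 x" for x
    have EL: "E \<in> Lin X X" unfolding E_def by (rule Lin_minus[OF XV T1 B_Lin[OF d(1)]])
    have GL: "G \<in> Lin X X" unfolding G_def by (rule Lin_add[OF XV T1 F0])
    note [simp] = Lin_rules[OF XV XV EL] Lin_rules[OF XV XV GL]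
    have En: "vnorm X (E x) \<le> 1 / (2 * l) * vnorm X x" if "x \<in> carrier X" for x
      using near that unfolding E_def by blast
    have GE: "G x = (T x \<oplus>\<^bsub>X\<^esub> F0 x) \<oplus>\<^bsub>X\<^esub> E x" if "x \<in> carrier X" for x
      using that unfolding G_def E_def by (intro X.vec_eqI) (auto simp: X.ev_rules)
    have GT1: "finrk X X (\<lambda>x. G x \<ominus>\<^bsub>X\<^esub> T1 x)"
    proof (rule finrk_cong[OF F0f])
      fix x assume "x \<in> carrier X"
      then show "G x \<ominus>\<^bsub>X\<^esub> T1 x = F0 x" unfolding G_def by (intro X.vec_eqI) (auto simp: X.ev_rules)
    qed
    have J1: "bijL X X (\<lambda>x. L (G x))" if nm: "n \<le> m"
    proof -
      have eq: "L (G x) = x \<oplus>\<^bsub>X\<^esub> L (E x)" if x: "x \<in> carrier X" for x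
        using LT[OF x nm] x by (simp add: GE)
      have b: "vnorm X (L (E x)) \<le> 1/2 * vnorm X x" if x: "x \<in> carrier X" for x
      proof -
        have "vnorm X (L (E x)) \<le> l * vnorm X (E x)" using x by (intro l) simp
        also have "\<dots> \<le> l * (1 / (2 * l) * vnorm X x)" using l(1) En[OF x] by (intro mult_left_mono) auto
        finally show ?thesis using l(1) by simp
      qed
      note N = neumann[OF X Lin_comp[OF LL EL], of "1/2", OF _ b]
      show ?thesis unfolding bijL_def
        using N Lin_comp[OF LL GL] by (simp add: eq cong: inj_on_cong image_cong)
    qed
    have J2: "bijL X X (\<lambda>x. G (L x))" if nm: "m \<le> n"
    proof -
      have eq: "G (L x) = x \<oplus>\<^bsub>X\<^esub> E (L x)" if x: "x \<in> carrier X" for x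
        using TL[OF x nm] x by (simp add: GE)
      have b: "vnorm X (E (L x)) \<le> 1/2 * vnorm X x" if x: "x \<in> carrier X" for x
      proof -
        have "vnorm X (E (L x)) \<le> 1 / (2 * l) * vnorm X (L x)" using x by (intro En) simp
        also have "\<dots> \<le> 1 / (2 * l) * (l * vnorm X x)" using l(1) l(2)[OF x] by (intro mult_left_mono) auto
        finally show ?thesis using l(1) by simp
      qed
      note N = neumann[OF X Lin_comp[OF EL LL], of "1/2", OF _ b]
      show ?thesis unfolding bijL_def
        using N Lin_comp[OF GL LL] by (simp add: eq cong: inj_on_cong image_cong)
    qed
    have GH: "finrk X X (\<lambda>x. H x \<ominus>\<^bsub>X\<^esub> G x)" if H: "H \<in> Lin X X" "finrk X X (\<lambda>x. H x \<ominus>\<^bsub>X\<^esub> T1 x)" for H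
    proof (rule finrk_cong[OF finrk_minus[OF XV H(2) F0f]])
      fix x assume "x \<in> carrier X"
      then show "H x \<ominus>\<^bsub>X\<^esub> G x = H x \<ominus>\<^bsub>X\<^esub> T1 x \<ominus>\<^bsub>X\<^esub> F0 x"
        using Lin_rules(1)[OF XV XV H(1)] unfolding G_def by (intro X.vec_eqI) (auto simp: X.ev_rules)
    qed
    show "index0 X T1 \<longleftrightarrow> n = m"
    proof
      assume nm: "n = m"
      have "inj_on G (carrier X)"
        using J1 nm by (auto simp: bijL_def inj_on_def)
      moreover have "G ` carrier X = carrier X"
      proof (intro equalityI subsetI)
        fix y assume "y \<in> carrier X"
        then have "y \<in> (\<lambda>x. G (L x)) ` carrier X" using J2 nm by (simp add: bijL_def)
        then show "y \<in> G ` carrier X" by auto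
      qed auto
      ultimately show "index0 X T1" unfolding index0_def bijL_def using GL GT1 by blast
    next
      assume "index0 X T1"
      then obtain H where H: "bijL X X H" and HT: "finrk X X (\<lambda>x. H x \<ominus>\<^bsub>X\<^esub> T1 x)" unfolding index0_def by blast
      have HL: "H \<in> Lin X X" and Hi: "inj_on H (carrier X)" and Hs: "H ` carrier X = carrier X"
        using H by (auto simp: bijL_def)
      note [simp] = Lin_rules[OF XV XV HL]
      show "n = m"
      proof (rule ccontr)
        assume "n \<noteq> m"
        then consider "n < m" | "m < n" by linarith
        then show False
        proof cases
          case 1
          have J: "bijL X X (\<lambda>x. L (G x))" using J1 1 by simp
          have fr: "finrk X X (\<lambda>x. L (H x) \<ominus>\<^bsub>X\<^esub> L (G x))"
            by (rule finrk_cong[OF finrk_left[OF GH[OF HL HT] LL]]) simp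
          have Ls: "x \<in> L ` carrier X" if "x \<in> carrier X" for x
          proof -
            have "x \<in> (\<lambda>x. L (G x)) ` carrier X" using J that by (simp add: bijL_def)
            then show ?thesis by auto
          qed
          have "(\<lambda>x. L (H x)) ` carrier X = carrier X"
          proof (intro equalityI subsetI)
            fix y assume "y \<in> carrier X"
            then obtain z where z: "z \<in> carrier X" "y = L z" using Ls by blast
            then obtain x where "x \<in> carrier X" "z = H x" using Hs by blast
            then show "y \<in> (\<lambda>x. L (H x)) ` carrier X" using z by blast
          qed auto
          then have inj: "inj_on (\<lambda>x. L (H x)) (carrier X)"
            using finrk_perturbation[OF XV XV J Lin_comp[OF LL HL] fr] by blast
          \<comment> \<open>Coordinate \<open>n\<close> exists in \<open>Cn m\<close> but is cut off
            by \<open>tr n\<close>, so \<open>L\<close> annihilates the nonzero vector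
            \<open>B e\<close>.\<close>
          define e where "e = un n"
          have e: "e \<in> carrier (Cn m)" "e \<noteq> \<zero>\<^bsub>Cn m\<^esub>" "tr n e = \<zero>\<^bsub>Cn n\<^esub>"
            using 1 by (auto simp: e_def un_def tr_def Cn_simps fun_eq_iff)
          obtain x where x: "x \<in> carrier X" "B e = H x" using Hs e(1) by (metis imageE d(5) B_rules(1) XV vspace_Cn)
          have "L (B e) = \<zero>\<^bsub>X\<^esub>" unfolding L_def using e by simp
          then have "L (H x) = L (H \<zero>\<^bsub>X\<^esub>)" using x by simp
          then have "x = \<zero>\<^bsub>X\<^esub>" using inj_onD[OF inj _ x(1)] by simp
          then have "B e = \<zero>\<^bsub>X\<^esub>" using x by simp
          then have "j (B e) = \<zero>\<^bsub>Cn m\<^esub>" by simp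
          then show False using e by simp
        next
          case 2
          have J: "bijL X X (\<lambda>x. G (L x))" using J2 2 by simp
          have fr: "finrk X X (\<lambda>x. H (L x) \<ominus>\<^bsub>X\<^esub> G (L x))"
            by (rule finrk_right[OF GH[OF HL HT] LL])
          have "inj_on (\<lambda>x. H (L x)) (carrier X)"
          proof (rule inj_onI)
            fix x y assume xy: "x \<in> carrier X" "y \<in> carrier X" "H (L x) = H (L y)"
            then have "L x = L y" using inj_onD[OF Hi] by simp
            then have "G (L x) = G (L y)" by simp
            then show "x = y" using J xy unfolding bijL_def by (auto dest: inj_onD)
          qed
          then have surj: "(\<lambda>x. H (L x)) ` carrier X = carrier X"
            using finrk_perturbation[OF XV XV J Lin_comp[OF HL LL] fr] by blast
          \<comment> \<open>Coordinate \<open>m\<close> exists in \<open>Cn n\<close>, but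
            \<open>C (L y) = tr n (j y)\<close> always vanishes there, so \<open>i e\<close> is not
            in the range of \<open>L\<close>.\<close>
          define e where "e = un m"
          have e: "e \<in> carrier (Cn n)" using 2 by (simp add: e_def)
          have "H (i e) \<in> (\<lambda>x. H (L x)) ` carrier X" using surj e by simp
          then obtain y where y: "y \<in> carrier X" "H (i e) = H (L y)" by blast
          then have "i e = L y" using inj_onD[OF Hi] e by simp
          then have "C (i e) = C (L y)" by simp
          then have "e = tr n (j y)" using e y(1) unfolding L_def by simp
          then have "e m = tr n (j y) m" by simp
          moreover have "j y \<in> carrier (Cn m)" using y(1) by simp
          then have "j y m = 0" by (simp add: Cn_simps)
          ultimately show False by (simp add: e_def un_def tr_def split: if_splits)
        qed
      qed
    qed
  qed
qed

lemma index0_homotopy: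
  assumes X: "banach_space X" and K: "K \<in> \<B> X X"
    and fred: "\<And>t::real. \<exists>n m. fdata X X (\<lambda>x. x \<ominus>\<^bsub>X\<^esub> complex_of_real t \<odot>\<^bsub>X\<^esub> K x) n m"
    and D: "fdata X X (\<lambda>x. x \<ominus>\<^bsub>X\<^esub> K x) n m"
  shows "n = m"
proof -
  interpret X: normed X by (rule banach_normed[OF X])
  note Xn = banach_normed[OF X] note XV = banach_vspace[OF X]
  note [simp] = XV B_rules[OF XV XV K]
  define T where "T t x = x \<ominus>\<^bsub>X\<^esub> complex_of_real t \<odot>\<^bsub>X\<^esub> K x" for t x
  have TL: "T t \<in> Lin X X" for t unfolding T_def
    by (rule Lin_minus[OF XV Lin_id Lin_smult[OF XV B_Lin[OF K]]])
  obtain k where k: "k > 0" "\<And>x. x \<in> carrier X \<Longrightarrow> vnorm X (K x) \<le> k * vnorm X x"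
    by (rule B_bound[OF Xn K]) (rule that)
  have local: "\<exists>e>0. \<forall>t. \<bar>t - t0\<bar> < e \<longrightarrow> (index0 X (T t) \<longleftrightarrow> n = m)" if fd: "fdata X X (T t0) n m" for t0 n m
  proof -
    obtain S i C B j where "fdec X X (T t0) n m S i C B j" using fd by (rule fdataE)
    from index0_near[OF X this] obtain \<delta> where \<delta>: "\<delta> > 0"
      "\<And>T1. T1 \<in> Lin X X \<Longrightarrow> (\<And>x. x \<in> carrier X \<Longrightarrow> vnorm X (T1 x \<ominus>\<^bsub>X\<^esub> T t0 x) \<le> \<delta> * vnorm X x) \<Longrightarrow> index0 X T1 \<longleftrightarrow> n = m"
      by blast
    have "index0 X (T t) \<longleftrightarrow> n = m" if t: "\<bar>t - t0\<bar> < \<delta> / k" for t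
    proof (rule \<delta>(2)[OF TL])
      fix x assume x: "x \<in> carrier X"
      have "T t x \<ominus>\<^bsub>X\<^esub> T t0 x = complex_of_real (t0 - t) \<odot>\<^bsub>X\<^esub> K x"
        unfolding T_def using x by (intro X.vec_eqI) (auto simp: X.ev_rules algebra_simps)
      then have "vnorm X (T t x \<ominus>\<^bsub>X\<^esub> T t0 x) = \<bar>t - t0\<bar> * vnorm X (K x)"
        using x by (simp only: X.nm_smult B_rules(1)[OF XV XV K] norm_of_real abs_minus_commute)
      also have "\<dots> \<le> \<bar>t - t0\<bar> * (k * vnorm X x)" using k(2)[OF x] by (intro mult_left_mono) auto
      also have "\<dots> \<le> \<delta> / k * (k * vnorm X x)"
        using t k(1) X.nm_nonneg[OF x] by (intro mult_right_mono) auto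
      finally show "vnorm X (T t x \<ominus>\<^bsub>X\<^esub> T t0 x) \<le> \<delta> * vnorm X x" using k(1) by simp
    qed
    then show ?thesis using \<delta>(1) k(1) by (intro exI[of _ "\<delta> / k"]) auto
  qed
  \<comment> \<open>The defects of \<open>T t0\<close> may change with \<open>t0\<close>, but near
    each \<open>t0\<close> the truth value of \<open>index0\<close> is that of \<open>n = m\<close>
    at \<open>t0\<close>, hence constant. Connectedness of the real line then compares
    \<open>t = 0\<close> with \<open>t = 1\<close>.\<close>
  have lc: "\<forall>\<^sub>F t in at t0 within UNIV. index0 X (T t0) = index0 X (T t)" for t0
  proof -
    obtain n m where "fdata X X (T t0) n m" using fred[of t0] unfolding T_def by blast
    from local[OF this] obtain e where e: "e > 0" "\<And>t. \<bar>t - t0\<bar> < e \<Longrightarrow> (index0 X (T t) \<longleftrightarrow> n = m)" by blast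
    have "index0 X (T t0) = index0 X (T t)" if "\<bar>t - t0\<bar> < e" for t
      using e(2)[OF that] e(2)[of t0] e(1) by simp
    then show ?thesis unfolding eventually_at using e(1) by (auto simp: dist_real_def)
  qed
  have "index0 X (T 0) = index0 X (T 1)"
    by (rule connected_local_const[of UNIV "0::real" 1]) (use lc in auto)
  moreover have "index0 X (T 0)" unfolding index0_def
  proof (intro exI[of _ "\<lambda>x. x"] conjI)
    show "bijL X X (\<lambda>x. x)" by (simp add: bijL_def Lin_id)
    \<comment> \<open>At \<open>t = 0\<close> the operator is the identity, and the zero map factors
      through \<open>Cn 0\<close>.\<close>
    show "finrk X X (\<lambda>x. x \<ominus>\<^bsub>X\<^esub> T 0 x)"
      by (rule finrkI[OF Lin_zero[OF XV] Lin_zero[OF vspace_Cn, of 0]]) (simp add: T_def)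
  qed
  ultimately have "index0 X (T 1)" by simp
  have T1: "T 1 x = x \<ominus>\<^bsub>X\<^esub> K x" if "x \<in> carrier X" for x using that by (simp add: T_def)
  obtain S i C B j where D: "fdec X X (\<lambda>x. x \<ominus>\<^bsub>X\<^esub> K x) n m S i C B j" using D by (rule fdataE)
  have "fdec X X (T 1) n m S i C B j"
    using D unfolding fdec_def by (simp add: T1 bounded_ops_def Pi_iff)
  then have "fdata X X (T 1) n m" unfolding fdata_def by blast
  from local[OF this] have "index0 X (T 1) \<longleftrightarrow> n = m" by force
  then show "n = m" using \<open>index0 X (T 1)\<close> by simp
qed

section \<open>Equivalence after extension\<close>

lemma Lin_pair_minus:
  assumes "vspace X" "vspace Y" "vspace Z" "F \<in> Lin (X \<oplus>\<^sub>B Y) Z"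
    "a \<in> carrier X" "c \<in> carrier X" "b \<in> carrier Y" "d \<in> carrier Y"
  shows "F (a \<ominus>\<^bsub>X\<^esub> c, b \<ominus>\<^bsub>Y\<^esub> d) = F (a, b) \<ominus>\<^bsub>Z\<^esub> F (c, d)"
  using Lin_rules(6)[OF vspace_dsum[OF assms(1,2)] assms(3,4), of "(a, b)" "(c, d)"] assms by simp

lemma fst_snd_minus:
  assumes "vspace X" "vspace Y" "z \<in> carrier (X \<oplus>\<^sub>B Y)" "w \<in> carrier (X \<oplus>\<^sub>B Y)"
  shows "fst (z \<ominus>\<^bsub>X \<oplus>\<^sub>B Y\<^esub> w) = fst z \<ominus>\<^bsub>X\<^esub> fst w" "snd (z \<ominus>\<^bsub>X \<oplus>\<^sub>B Y\<^esub> w) = snd z \<ominus>\<^bsub>Y\<^esub> snd w"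
  using assms by (cases z; cases w; simp)+

text \<open>\<open>H\<close> and \<open>G\<close> name the inverses of \<open>E\<close> and
  \<open>F\<close>. The equivalence is then used in the two forms \<open>HU\<close>, with
  \<open>E\<close> moved to the left, and \<open>UG\<close>, with \<open>F\<close> moved to the
  left.\<close>

locale eae =
  fixes X :: "'a nspace" and Y :: "'b nspace" and U V and X\<^sub>0 :: "'c nspace" and Y\<^sub>0 :: "'d nspace" and E H F G
  assumes X: "banach_space X" and Y: "banach_space Y" and X0: "banach_space X\<^sub>0" and Y0: "banach_space Y\<^sub>0"
    and U: "U \<in> \<B> X X" and V: "V \<in> \<B> Y Y"
    and EH: "inverse_ops (Y \<oplus>\<^sub>B Y\<^sub>0) (X \<oplus>\<^sub>B X\<^sub>0) E H"
    and FG: "inverse_ops (X \<oplus>\<^sub>B X\<^sub>0) (Y \<oplus>\<^sub>B Y\<^sub>0) F G"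
    and equiv: "z \<in> carrier (X \<oplus>\<^sub>B X\<^sub>0) \<Longrightarrow> map_prod U id z = E (map_prod V id (F z))"
begin

lemma vspaces [simp]: "vspace X" "vspace Y" "vspace X\<^sub>0" "vspace Y\<^sub>0"
  using X Y X0 Y0 by auto

lemma normeds: "normed X" "normed Y" "normed X\<^sub>0" "normed Y\<^sub>0" "normed (X \<oplus>\<^sub>B X\<^sub>0)" "normed (Y \<oplus>\<^sub>B Y\<^sub>0)"
  using X Y X0 Y0 by (auto intro: banach_normed normed_dsum)

lemma opB: "E \<in> \<B> (Y \<oplus>\<^sub>B Y\<^sub>0) (X \<oplus>\<^sub>B X\<^sub>0)" "H \<in> \<B> (X \<oplus>\<^sub>B X\<^sub>0) (Y \<oplus>\<^sub>B Y\<^sub>0)"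
  "F \<in> \<B> (X \<oplus>\<^sub>B X\<^sub>0) (Y \<oplus>\<^sub>B Y\<^sub>0)" "G \<in> \<B> (Y \<oplus>\<^sub>B Y\<^sub>0) (X \<oplus>\<^sub>B X\<^sub>0)"
  using EH FG by (auto simp: inverse_ops_def)

lemma inv: "w \<in> carrier (Y \<oplus>\<^sub>B Y\<^sub>0) \<Longrightarrow> H (E w) = w" "z \<in> carrier (X \<oplus>\<^sub>B X\<^sub>0) \<Longrightarrow> E (H z) = z"
  "z \<in> carrier (X \<oplus>\<^sub>B X\<^sub>0) \<Longrightarrow> G (F z) = z" "w \<in> carrier (Y \<oplus>\<^sub>B Y\<^sub>0) \<Longrightarrow> F (G w) = w"
  using EH FG unfolding inverse_ops_def by blast+

lemmas UR = B_rules[OF vspaces(1) vspaces(1) U]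
lemmas VR = B_rules[OF vspaces(2) vspaces(2) V]
lemmas ER = B_rules[OF vspace_dsum[OF vspaces(2,4)] vspace_dsum[OF vspaces(1,3)] opB(1)]
lemmas HR = B_rules[OF vspace_dsum[OF vspaces(1,3)] vspace_dsum[OF vspaces(2,4)] opB(2)]
lemmas FR = B_rules[OF vspace_dsum[OF vspaces(1,3)] vspace_dsum[OF vspaces(2,4)] opB(3)]
lemmas GR = B_rules[OF vspace_dsum[OF vspaces(2,4)] vspace_dsum[OF vspaces(1,3)] opB(4)]

lemma mapV: "z \<in> carrier (Y \<oplus>\<^sub>B Y\<^sub>0) \<Longrightarrow> map_prod V id z \<in> carrier (Y \<oplus>\<^sub>B Y\<^sub>0)"
  using VR(1) by (cases z) auto

lemma HU: "z \<in> carrier (X \<oplus>\<^sub>B X\<^sub>0) \<Longrightarrow> H (map_prod U id z) = map_prod V id (F z)"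
  using equiv[of z] inv(1)[OF mapV[OF FR(1)], of z] by simp

lemma UG: "w \<in> carrier (Y \<oplus>\<^sub>B Y\<^sub>0) \<Longrightarrow> map_prod U id (G w) = E (map_prod V id w)"
  using equiv[OF GR(1), of w] inv(4)[of w] by simp

lemma fst_in: "z \<in> carrier (P \<oplus>\<^sub>B Q) \<Longrightarrow> fst z \<in> carrier P" "z \<in> carrier (P \<oplus>\<^sub>B Q) \<Longrightarrow> snd z \<in> carrier Q"
  by auto

lemma blocks:
  "T \<in> \<B> (P \<oplus>\<^sub>B P0) (Q \<oplus>\<^sub>B Q0) \<Longrightarrow> normed P \<Longrightarrow> normed P0 \<Longrightarrow> normed Q \<Longrightarrow> normed Q0 \<Longrightarrow>
    (\<lambda>x. fst (T (x, \<zero>\<^bsub>P0\<^esub>))) \<in> \<B> P Q"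
  "T \<in> \<B> (P \<oplus>\<^sub>B P0) (Q \<oplus>\<^sub>B Q0) \<Longrightarrow> normed P \<Longrightarrow> normed P0 \<Longrightarrow> normed Q \<Longrightarrow> normed Q0 \<Longrightarrow>
    (\<lambda>x. snd (T (x, \<zero>\<^bsub>P0\<^esub>))) \<in> \<B> P Q0"
  "T \<in> \<B> (P \<oplus>\<^sub>B P0) (Q \<oplus>\<^sub>B Q0) \<Longrightarrow> normed P \<Longrightarrow> normed P0 \<Longrightarrow> normed Q \<Longrightarrow> normed Q0 \<Longrightarrow>
    (\<lambda>x. fst (T (\<zero>\<^bsub>P\<^esub>, x))) \<in> \<B> P0 Q"
proof -
  assume T: "T \<in> \<B> (P \<oplus>\<^sub>B P0) (Q \<oplus>\<^sub>B Q0)" and n: "normed P" "normed P0" "normed Q" "normed Q0"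
  note PP = normed_dsum[OF n(1,2)] note QQ = normed_dsum[OF n(3,4)]
  have 1: "(\<lambda>x. (x, \<zero>\<^bsub>P0\<^esub>)) \<in> \<B> P (P \<oplus>\<^sub>B P0)" by (rule B_pair[OF n(1) B_id B_zero[OF n(1,2)]])
  have 2: "(\<lambda>x. (\<zero>\<^bsub>P\<^esub>, x)) \<in> \<B> P0 (P \<oplus>\<^sub>B P0)" by (rule B_pair[OF n(2) B_zero[OF n(2,1)] B_id])
  show "(\<lambda>x. fst (T (x, \<zero>\<^bsub>P0\<^esub>))) \<in> \<B> P Q"
    by (rule B_comp[OF n(1) QQ B_fst[OF n(3,4)] B_comp[OF n(1) PP T 1]])
  show "(\<lambda>x. snd (T (x, \<zero>\<^bsub>P0\<^esub>))) \<in> \<B> P Q0"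
    by (rule B_comp[OF n(1) QQ B_snd[OF n(3,4)] B_comp[OF n(1) PP T 1]])
  show "(\<lambda>x. fst (T (\<zero>\<^bsub>P\<^esub>, x))) \<in> \<B> P0 Q"
    by (rule B_comp[OF n(2) QQ B_fst[OF n(3,4)] B_comp[OF n(2) PP T 2]])
qed

lemmas EB = blocks[OF opB(1) normeds(2,4,1,3)]
lemmas HB = blocks[OF opB(2) normeds(1,3,2,4)]
lemmas FB = blocks[OF opB(3) normeds(1,3,2,4)]
lemmas GB = blocks[OF opB(4) normeds(2,4,1,3)]

text \<open>Since \<open>V \<oplus> I = H (U \<oplus> I) G\<close>, bordering data of
  \<open>U\<close>, extended by the identity, can be moved to
  \<open>Y \<oplus>\<^sub>B Y\<^sub>0\<close> and cut down to \<open>Y\<close>. The operator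
  replacing \<open>S\<close> is the upper left entry of \<open>F (S \<oplus> I) E\<close>; kernel
  vectors travel by \<open>F\<close>, complements of the range by \<open>H\<close>.\<close>

lemma fdata_transfer:
  assumes "fdata X X U n m"
  shows "fdata Y Y V n m"
proof -
  obtain S i C B j where D: "fdec X X U n m S i C B j" using assms by (rule fdataE)
  note d = fdecD[OF D]
  note SR = B_rules[OF vspaces(1,1) d(2)] and iR = B_rules[OF vspace_Cn vspaces(1) d(3)]
    and CR = B_rules[OF vspaces(1) vspace_Cn d(4)] and BR = B_rules[OF vspace_Cn vspaces(1) d(5)]
    and jR = B_rules[OF vspaces(1) vspace_Cn d(6)]
  note [simp] = d(7-12) UR SR iR CR BR jR
  note [simp] = vspace.zero_in[OF vspaces(3)] vspace.zero_in[OF vspaces(4)]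
  note Xn = normeds(1) note Yn = normeds(2)
  define e where "e y = E (y, \<zero>\<^bsub>Y\<^sub>0\<^esub>)" for y
  define g where "g y = G (y, \<zero>\<^bsub>Y\<^sub>0\<^esub>)" for y
  have e: "e y \<in> carrier (X \<oplus>\<^sub>B X\<^sub>0)" if "y \<in> carrier Y" for y unfolding e_def using that by (intro ER(1)) simp
  have g: "g y \<in> carrier (X \<oplus>\<^sub>B X\<^sub>0)" if "y \<in> carrier Y" for y unfolding g_def using that by (intro GR(1)) simp
  have e1: "fst (e y) \<in> carrier X" "snd (e y) \<in> carrier X\<^sub>0" if "y \<in> carrier Y" for y
    using fst_in[OF e[OF that]] by auto
  have g1: "fst (g y) \<in> carrier X" "snd (g y) \<in> carrier X\<^sub>0" if "y \<in> carrier Y" for y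
    using fst_in[OF g[OF that]] by auto
  have eV: "e (V y) = (U (fst (g y)), snd (g y))" if y: "y \<in> carrier Y" for y
  proof -
    have "e (V y) = E (map_prod V id (y, \<zero>\<^bsub>Y\<^sub>0\<^esub>))" by (simp add: e_def)
    also have "\<dots> = map_prod U id (g y)" unfolding g_def by (rule UG[symmetric]) (use y in simp)
    finally show ?thesis by (simp add: map_prod_def case_prod_beta)
  qed
  have eB: "e \<in> \<B> Y (X \<oplus>\<^sub>B X\<^sub>0)" unfolding e_def
    by (rule B_comp[OF Yn normeds(6) opB(1) B_pair[OF Yn B_id B_zero[OF Yn normeds(4)]]])
  define s where "s y = (S (fst (e y)), snd (e y))" for y
  have sB: "s \<in> \<B> Y (X \<oplus>\<^sub>B X\<^sub>0)" unfolding s_def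
    by (rule B_pair[OF Yn B_comp[OF Yn Xn d(2) B_comp[OF Yn normeds(5) B_fst[OF normeds(1,3)] eB]]
          B_comp[OF Yn normeds(5) B_snd[OF normeds(1,3)] eB]])
  \<comment> \<open>\<open>H (U \<oplus> I) = (V \<oplus> I) F\<close> at a kernel vector of
    \<open>U\<close>: both sides vanish, so its image under \<open>F\<close> has no
    \<open>Y\<^sub>0\<close> component, and the \<open>Y\<close> component lies in the kernel of
    \<open>V\<close>.\<close>
  have Fi: "F (i c, \<zero>\<^bsub>X\<^sub>0\<^esub>) = (fst (F (i c, \<zero>\<^bsub>X\<^sub>0\<^esub>)), \<zero>\<^bsub>Y\<^sub>0\<^esub>)" "V (fst (F (i c, \<zero>\<^bsub>X\<^sub>0\<^esub>))) = \<zero>\<^bsub>Y\<^esub>"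
    if c: "c \<in> carrier (Cn n)" for c
  proof -
    have "map_prod V id (F (i c, \<zero>\<^bsub>X\<^sub>0\<^esub>)) = H (map_prod U id (i c, \<zero>\<^bsub>X\<^sub>0\<^esub>))"
      by (rule HU[symmetric]) (use c in simp)
    also have "\<dots> = (\<zero>\<^bsub>Y\<^esub>, \<zero>\<^bsub>Y\<^sub>0\<^esub>)" using c HR(4) by simp
    finally have "V (fst (F (i c, \<zero>\<^bsub>X\<^sub>0\<^esub>))) = \<zero>\<^bsub>Y\<^esub>" "snd (F (i c, \<zero>\<^bsub>X\<^sub>0\<^esub>)) = \<zero>\<^bsub>Y\<^sub>0\<^esub>"
      by (simp_all add: map_prod_def case_prod_beta)
    then show "F (i c, \<zero>\<^bsub>X\<^sub>0\<^esub>) = (fst (F (i c, \<zero>\<^bsub>X\<^sub>0\<^esub>)), \<zero>\<^bsub>Y\<^sub>0\<^esub>)" "V (fst (F (i c, \<zero>\<^bsub>X\<^sub>0\<^esub>))) = \<zero>\<^bsub>Y\<^esub>"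
      by (simp_all add: prod_eq_iff)
  qed
  show ?thesis
  proof (rule fdataI[OF Yn Yn V])
    show "(\<lambda>y. fst (F (s y))) \<in> \<B> Y Y"
      by (rule B_comp[OF Yn normeds(6) B_fst[OF normeds(2,4)] B_comp[OF Yn normeds(5) opB(3) sB]])
    show "(\<lambda>c. fst (F (i c, \<zero>\<^bsub>X\<^sub>0\<^esub>))) \<in> \<B> (Cn n) Y" by (rule B_comp[OF normed_Cn Xn FB(1) d(3)])
    show "(\<lambda>y. C (fst (g y))) \<in> \<B> Y (Cn n)" unfolding g_def by (rule B_comp[OF Yn Xn d(4) GB(1)])
    show "(\<lambda>c. fst (H (B c, \<zero>\<^bsub>X\<^sub>0\<^esub>))) \<in> \<B> (Cn m) Y" by (rule B_comp[OF normed_Cn Xn HB(1) d(5)])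
    show "(\<lambda>y. j (fst (e y))) \<in> \<B> Y (Cn m)" unfolding e_def by (rule B_comp[OF Yn Xn d(6) EB(1)])
  next
    fix y assume y: "y \<in> carrier Y"
    let ?g1 = "fst (g y)" and ?g2 = "snd (g y)"
    have "s (V y) = (?g1 \<ominus>\<^bsub>X\<^esub> i (C ?g1), ?g2 \<ominus>\<^bsub>X\<^sub>0\<^esub> \<zero>\<^bsub>X\<^sub>0\<^esub>)"
      using g1[OF y] by (simp add: s_def eV[OF y])
    then have "F (s (V y)) = F (?g1, ?g2) \<ominus>\<^bsub>Y \<oplus>\<^sub>B Y\<^sub>0\<^esub> F (i (C ?g1), \<zero>\<^bsub>X\<^sub>0\<^esub>)"
      using Lin_pair_minus[OF vspaces(1,3) vspace_dsum[OF vspaces(2,4)] B_Lin[OF opB(3)], of ?g1 "i (C ?g1)" ?g2 "\<zero>\<^bsub>X\<^sub>0\<^esub>"] g1[OF y]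
      by simp
    also have "F (?g1, ?g2) = (y, \<zero>\<^bsub>Y\<^sub>0\<^esub>)" using inv(4)[of "(y, \<zero>\<^bsub>Y\<^sub>0\<^esub>)"] y by (simp add: g_def)
    finally show "fst (F (s (V y))) = y \<ominus>\<^bsub>Y\<^esub> fst (F (i (C ?g1), \<zero>\<^bsub>X\<^sub>0\<^esub>))"
      using fst_snd_minus(1)[OF vspaces(2,4), of "(y, \<zero>\<^bsub>Y\<^sub>0\<^esub>)" "F (i (C ?g1), \<zero>\<^bsub>X\<^sub>0\<^esub>)"] FR(1)[of "(i (C ?g1), \<zero>\<^bsub>X\<^sub>0\<^esub>)"] y g1[OF y]
      by simp
    show "j (fst (e (V y))) = \<zero>\<^bsub>Cn m\<^esub>" using eV[OF y] g1[OF y] by simp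
    let ?e1 = "fst (e y)" and ?e2 = "snd (e y)"
    have sy: "s y \<in> carrier (X \<oplus>\<^sub>B X\<^sub>0)" using e1[OF y] by (simp add: s_def)
    have "map_prod V id (F (s y)) = H (map_prod U id (s y))" by (rule HU[OF sy, symmetric])
    also have "map_prod U id (s y) = (?e1 \<ominus>\<^bsub>X\<^esub> B (j ?e1), ?e2 \<ominus>\<^bsub>X\<^sub>0\<^esub> \<zero>\<^bsub>X\<^sub>0\<^esub>)"
      using e1[OF y] by (simp add: s_def)
    also have "H \<dots> = H (?e1, ?e2) \<ominus>\<^bsub>Y \<oplus>\<^sub>B Y\<^sub>0\<^esub> H (B (j ?e1), \<zero>\<^bsub>X\<^sub>0\<^esub>)"
      by (rule Lin_pair_minus[OF vspaces(1,3) vspace_dsum[OF vspaces(2,4)] B_Lin[OF opB(2)]]) (use e1[OF y] in auto)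
    also have "H (?e1, ?e2) = (y, \<zero>\<^bsub>Y\<^sub>0\<^esub>)" using inv(1)[of "(y, \<zero>\<^bsub>Y\<^sub>0\<^esub>)"] y by (simp add: e_def)
    finally have eq: "map_prod V id (F (s y)) = (y, \<zero>\<^bsub>Y\<^sub>0\<^esub>) \<ominus>\<^bsub>Y \<oplus>\<^sub>B Y\<^sub>0\<^esub> H (B (j ?e1), \<zero>\<^bsub>X\<^sub>0\<^esub>)" .
    have "V (fst (F (s y))) = fst (map_prod V id (F (s y)))" by simp
    also have "\<dots> = y \<ominus>\<^bsub>Y\<^esub> fst (H (B (j ?e1), \<zero>\<^bsub>X\<^sub>0\<^esub>))" unfolding eq
      using fst_snd_minus(1)[OF vspaces(2,4), of "(y, \<zero>\<^bsub>Y\<^sub>0\<^esub>)" "H (B (j ?e1), \<zero>\<^bsub>X\<^sub>0\<^esub>)"] HR(1)[of "(B (j ?e1), \<zero>\<^bsub>X\<^sub>0\<^esub>)"] y e1[OF y]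
      by simp
    finally show "V (fst (F (s y))) = y \<ominus>\<^bsub>Y\<^esub> fst (H (B (j ?e1), \<zero>\<^bsub>X\<^sub>0\<^esub>))" .
  next
    fix c assume c: "c \<in> carrier (Cn n)"
    show "V (fst (F (i c, \<zero>\<^bsub>X\<^sub>0\<^esub>))) = \<zero>\<^bsub>Y\<^esub>" by (rule Fi(2)[OF c])
    have "g (fst (F (i c, \<zero>\<^bsub>X\<^sub>0\<^esub>))) = G (F (i c, \<zero>\<^bsub>X\<^sub>0\<^esub>))" unfolding g_def by (subst (2) Fi(1)[OF c]) (rule refl)
    also have "\<dots> = (i c, \<zero>\<^bsub>X\<^sub>0\<^esub>)" by (rule inv(3)) (use c in simp)
    finally show "C (fst (g (fst (F (i c, \<zero>\<^bsub>X\<^sub>0\<^esub>))))) = c" using c by simp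
  next
    fix c assume c: "c \<in> carrier (Cn m)"
    define h1 where "h1 = fst (H (B c, \<zero>\<^bsub>X\<^sub>0\<^esub>))"
    define h2 where "h2 = snd (H (B c, \<zero>\<^bsub>X\<^sub>0\<^esub>))"
    have hH: "H (B c, \<zero>\<^bsub>X\<^sub>0\<^esub>) = (h1, h2)" by (simp add: h1_def h2_def)
    have h: "h1 \<in> carrier Y" "h2 \<in> carrier Y\<^sub>0"
      using HR(1)[of "(B c, \<zero>\<^bsub>X\<^sub>0\<^esub>)"] c unfolding hH by auto
    have z: "(\<zero>\<^bsub>Y\<^esub>, h2) \<in> carrier (Y \<oplus>\<^sub>B Y\<^sub>0)" using h vspace.zero_in[OF vspaces(2)] by simp
    \<comment> \<open>Dropping the component \<open>h2\<close> changes the first component of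
      \<open>E\<close> by a vector in the range of \<open>U\<close>, which \<open>j\<close>
      annihilates.\<close>
    have E0: "fst (E (\<zero>\<^bsub>Y\<^esub>, h2)) = U (fst (G (\<zero>\<^bsub>Y\<^esub>, h2)))"
    proof -
      have "map_prod U id (G (\<zero>\<^bsub>Y\<^esub>, h2)) = E (map_prod V id (\<zero>\<^bsub>Y\<^esub>, h2))" by (rule UG[OF z])
      then show ?thesis using VR(4) by (simp add: map_prod_def case_prod_beta) (metis fst_conv)
    qed
    have "e h1 = E (h1 \<ominus>\<^bsub>Y\<^esub> \<zero>\<^bsub>Y\<^esub>, h2 \<ominus>\<^bsub>Y\<^sub>0\<^esub> h2)" using h by (simp add: e_def)
    also have "\<dots> = E (h1, h2) \<ominus>\<^bsub>X \<oplus>\<^sub>B X\<^sub>0\<^esub> E (\<zero>\<^bsub>Y\<^esub>, h2)"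
      by (rule Lin_pair_minus[OF vspaces(2,4) vspace_dsum[OF vspaces(1,3)] B_Lin[OF opB(1)]]) (use h in auto)
    also have "E (h1, h2) = (B c, \<zero>\<^bsub>X\<^sub>0\<^esub>)" unfolding hH[symmetric] by (rule inv(2)) (use c in simp)
    finally have "fst (e h1) = B c \<ominus>\<^bsub>X\<^esub> fst (E (\<zero>\<^bsub>Y\<^esub>, h2))"
      using fst_snd_minus(1)[OF vspaces(1,3), of "(B c, \<zero>\<^bsub>X\<^sub>0\<^esub>)" "E (\<zero>\<^bsub>Y\<^esub>, h2)"] ER(1)[OF z] c by simp
    then have "j (fst (e h1)) = c"
      using c fst_in(1)[OF GR(1)[OF z]] unfolding E0 by simp
    then show "j (fst (e (fst (H (B c, \<zero>\<^bsub>X\<^sub>0\<^esub>))))) = c" unfolding h1_def .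
  qed
qed

text \<open>\<open>W\<close> leads through \<open>Y\<^sub>0\<close> only: the entry of
  \<open>H\<close> from \<open>X\<close> to \<open>Y\<^sub>0\<close>, followed by the entry of
  \<open>G\<close> from \<open>Y\<^sub>0\<close> to \<open>X\<close>. On \<open>Y\<^sub>0\<close>
  the operator \<open>V \<oplus> I\<close> is the identity, so the failure of \<open>W\<close> to
  invert \<open>U\<close> consists of the paths through \<open>Y\<close>, which are
  \<open>Q P\<close> and \<open>Q' P'\<close>.\<close>

lemma parametrix:
  obtains W P Q P' Q' where "W \<in> \<B> X X" "P \<in> \<B> X Y" "Q \<in> \<B> Y X" "P' \<in> \<B> X Y" "Q' \<in> \<B> Y X"
    "\<And>x. x \<in> carrier X \<Longrightarrow> U (W x) = x \<ominus>\<^bsub>X\<^esub> Q (P x)"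
    "\<And>x. x \<in> carrier X \<Longrightarrow> W (U x) = x \<ominus>\<^bsub>X\<^esub> Q' (P' x)"
proof (rule that)
  let ?W = "\<lambda>x. fst (G (\<zero>\<^bsub>Y\<^esub>, snd (H (x, \<zero>\<^bsub>X\<^sub>0\<^esub>))))"
  let ?P = "\<lambda>x. fst (H (x, \<zero>\<^bsub>X\<^sub>0\<^esub>))" and ?Q = "\<lambda>y. fst (E (y, \<zero>\<^bsub>Y\<^sub>0\<^esub>))"
  let ?P' = "\<lambda>x. fst (F (x, \<zero>\<^bsub>X\<^sub>0\<^esub>))" and ?Q' = "\<lambda>y. fst (G (y, \<zero>\<^bsub>Y\<^sub>0\<^esub>))"
  show "?W \<in> \<B> X X" by (rule B_comp[OF normeds(1,4) GB(3) HB(2)])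
  show "?P \<in> \<B> X Y" "?Q \<in> \<B> Y X" "?P' \<in> \<B> X Y" "?Q' \<in> \<B> Y X" using HB(1) EB(1) FB(1) GB(1) by simp_all
  note [simp] = vspace.zero_in[OF vspaces(3)] vspace.zero_in[OF vspaces(4)] vspace.zero_in[OF vspaces(2)]
  have split: "fst (T (\<zero>\<^bsub>Y\<^esub>, b)) = x \<ominus>\<^bsub>X\<^esub> fst (T (a, \<zero>\<^bsub>Y\<^sub>0\<^esub>))"
    if T: "T \<in> \<B> (Y \<oplus>\<^sub>B Y\<^sub>0) (X \<oplus>\<^sub>B X\<^sub>0)" and ab: "a \<in> carrier Y" "b \<in> carrier Y\<^sub>0" and Tx: "T (a, b) = (x, \<zero>\<^bsub>X\<^sub>0\<^esub>)"
      and x: "x \<in> carrier X" for T a b x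
  proof -
    note TR = B_rules[OF vspace_dsum[OF vspaces(2,4)] vspace_dsum[OF vspaces(1,3)] T]
    have "T (\<zero>\<^bsub>Y\<^esub>, b) = T (a \<ominus>\<^bsub>Y\<^esub> a, b \<ominus>\<^bsub>Y\<^sub>0\<^esub> \<zero>\<^bsub>Y\<^sub>0\<^esub>)" using ab by simp
    also have "\<dots> = T (a, b) \<ominus>\<^bsub>X \<oplus>\<^sub>B X\<^sub>0\<^esub> T (a, \<zero>\<^bsub>Y\<^sub>0\<^esub>)"
      by (rule Lin_pair_minus[OF vspaces(2,4) vspace_dsum[OF vspaces(1,3)] B_Lin[OF T]]) (use ab in auto)
    finally show ?thesis
      using fst_snd_minus(1)[OF vspaces(1,3), of "T (a, b)" "T (a, \<zero>\<^bsub>Y\<^sub>0\<^esub>)"] TR(1)[of "(a, b)"] TR(1)[of "(a, \<zero>\<^bsub>Y\<^sub>0\<^esub>)"] ab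
      by (simp add: Tx)
  qed
  fix x assume x: "x \<in> carrier X"
  have xc: "(x, \<zero>\<^bsub>X\<^sub>0\<^esub>) \<in> carrier (X \<oplus>\<^sub>B X\<^sub>0)" using x by simp
  obtain h1 h2 where h: "H (x, \<zero>\<^bsub>X\<^sub>0\<^esub>) = (h1, h2)" by fastforce
  have hc: "h1 \<in> carrier Y" "h2 \<in> carrier Y\<^sub>0" using HR(1)[OF xc] unfolding h by auto
  have "map_prod U id (G (\<zero>\<^bsub>Y\<^esub>, h2)) = E (map_prod V id (\<zero>\<^bsub>Y\<^esub>, h2))" by (rule UG) (use hc in simp)
  then have "U (fst (G (\<zero>\<^bsub>Y\<^esub>, h2))) = fst (E (\<zero>\<^bsub>Y\<^esub>, h2))"
    using VR(4) by (simp add: map_prod_def case_prod_beta) (metis fst_conv)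
  also have "\<dots> = x \<ominus>\<^bsub>X\<^esub> fst (E (h1, \<zero>\<^bsub>Y\<^sub>0\<^esub>))"
    by (rule split[OF opB(1) hc _ x]) (use inv(2)[OF xc] h in simp)
  finally show "U (?W x) = x \<ominus>\<^bsub>X\<^esub> ?Q (?P x)" unfolding h by simp
  obtain f1 f2 where f: "F (x, \<zero>\<^bsub>X\<^sub>0\<^esub>) = (f1, f2)" by fastforce
  have fc: "f1 \<in> carrier Y" "f2 \<in> carrier Y\<^sub>0" using FR(1)[OF xc] unfolding f by auto
  have "H (U x, \<zero>\<^bsub>X\<^sub>0\<^esub>) = (V f1, f2)" using HU[OF xc] f by simp
  then have "?W (U x) = fst (G (\<zero>\<^bsub>Y\<^esub>, f2))" by simp
  also have "\<dots> = x \<ominus>\<^bsub>X\<^esub> fst (G (f1, \<zero>\<^bsub>Y\<^sub>0\<^esub>))"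
    by (rule split[OF opB(4) fc _ x]) (use inv(3)[OF xc] f in simp)
  finally show "?W (U x) = x \<ominus>\<^bsub>X\<^esub> ?Q' (?P' x)" unfolding f by simp
qed

end

lemma EAE_viaE:
  assumes "EAE_via X Y U V X\<^sub>0 Y\<^sub>0" "banach_space X" "banach_space Y" "U \<in> \<B> X X" "V \<in> \<B> Y Y"
  obtains E H F G where "eae X Y U V X\<^sub>0 Y\<^sub>0 E H F G"
  using assms unfolding EAE_via_def invertible_op_def eae_def by blast

section \<open>Fredholm operators from products\<close>

lemma fdata_cong:
  assumes "vspace X" "fdata X Y T n m" "\<And>x. x \<in> carrier X \<Longrightarrow> T' x = T x"
  shows "fdata X Y T' n m"
proof -
  obtain S i C B j where D: "fdec X Y T n m S i C B j" using assms(2) by (rule fdataE)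
  then have "fdec X Y T' n m S i C B j"
    using assms(1,3) unfolding fdec_def by (simp add: bounded_ops_def Pi_iff)
  then show ?thesis unfolding fdata_def by blast
qed

text \<open>The kernel of \<open>U\<close> lies in that of \<open>W U\<close>, and the range of
  \<open>U\<close> contains that of \<open>U W\<close>, so both defects of \<open>U\<close> are
  finite; dimension theory inside \<open>Cn n2\<close> and \<open>Cn m1\<close> turns this into
  bordering data.\<close>

lemma fdata_of_products:
  assumes X: "banach_space X" and U: "U \<in> \<B> X X" and W: "W \<in> \<B> X X"
    and UW: "fdata X X (\<lambda>x. U (W x)) n1 m1" and WU: "fdata X X (\<lambda>x. W (U x)) n2 m2"
  shows "\<exists>n m. fdata X X U n m"
proof -
  note Xn = banach_normed[OF X] note XV = banach_vspace[OF X]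
  obtain S1 i1 C1 B1 j1 where D1: "fdec X X (\<lambda>x. U (W x)) n1 m1 S1 i1 C1 B1 j1" using UW by (rule fdataE)
  obtain S2 i2 C2 B2 j2 where D2: "fdec X X (\<lambda>x. W (U x)) n2 m2 S2 i2 C2 B2 j2" using WU by (rule fdataE)
  note d1 = fdecD[OF D1] note d2 = fdecD[OF D2]
  note UR = B_rules[OF XV XV U] and WR = B_rules[OF XV XV W] and S1R = B_rules[OF XV XV d1(2)]
    and B1R = B_rules[OF vspace_Cn XV d1(5)] and j1R = B_rules[OF XV vspace_Cn d1(6)]
    and S2R = B_rules[OF XV XV d2(2)] and i2R = B_rules[OF vspace_Cn XV d2(3)] and C2R = B_rules[OF XV vspace_Cn d2(4)]
  note [simp] = XV UR WR S1R B1R j1R S2R i2R C2R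
  \<comment> \<open>The kernel of \<open>U\<close> in the coordinates of the kernel of
    \<open>W U\<close>; \<open>E\<close> below straightens it to the first \<open>k\<close>
    coordinates.\<close>
  let ?W1 = "{c \<in> carrier (Cn n2). U (i2 c) = \<zero>\<^bsub>X\<^esub>}"
  have W1: "subsp (Cn n2) ?W1"
    by (rule subsp_kernel[OF vspace_Cn XV Lin_comp[OF B_Lin[OF U] B_Lin[OF d2(3)]]])
  obtain k E E' where kn: "k \<le> n2" and E: "E \<in> Lin (Cn n2) (Cn n2)" and E': "E' \<in> Lin (Cn n2) (Cn n2)"
    and EE': "\<And>c. c \<in> carrier (Cn n2) \<Longrightarrow> E (E' c) = c" and E'E: "\<And>c. c \<in> carrier (Cn n2) \<Longrightarrow> E' (E c) = c"
    and EW: "E ` carrier (Cn k) = ?W1"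
    by (rule Cn_subspace[OF W1]) (rule that)
  \<comment> \<open>\<open>y - B1 (j1 y)\<close> is in the range of \<open>U W\<close>, so
    \<open>y\<close> is in the range of \<open>U\<close> exactly if \<open>j1 y\<close> lies in this
    subspace.\<close>
  let ?W2 = "{c \<in> carrier (Cn m1). B1 c \<in> U ` carrier X}"
  have sU: "subsp X (U ` carrier X)" by (rule subsp_range[OF XV XV B_Lin[OF U]])
  have W2: "subsp (Cn m1) ?W2"
    using sU unfolding subsp_def by auto
  obtain l D D' where lm: "l \<le> m1" and D: "D \<in> Lin (Cn m1) (Cn m1)" and D': "D' \<in> Lin (Cn m1) (Cn m1)"
    and DD': "\<And>c. c \<in> carrier (Cn m1) \<Longrightarrow> D (D' c) = c" and D'D: "\<And>c. c \<in> carrier (Cn m1) \<Longrightarrow> D' (D c) = c"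
    and DW: "D ` carrier (Cn l) = ?W2"
    by (rule Cn_subspace[OF W2]) (rule that)
  note ER = Lin_rules[OF vspace_Cn vspace_Cn E] and E'R = Lin_rules[OF vspace_Cn vspace_Cn E']
    and DR = Lin_rules[OF vspace_Cn vspace_Cn D] and D'R = Lin_rules[OF vspace_Cn vspace_Cn D']
  have Ck: "c \<in> carrier (Cn n2)" if "c \<in> carrier (Cn k)" for c using that kn by (auto simp: Cn_simps)
  have Cl: "c \<in> carrier (Cn m1)" if "c \<in> carrier (Cn l)" for c using that lm by (auto simp: Cn_simps)
  have incl: "(\<lambda>c. c) \<in> Lin (Cn k) (Cn n2)" by (rule Lin_I) (use Ck in \<open>auto simp: Cn_simps(3,4)\<close>)
  \<comment> \<open>After \<open>D'\<close> has straightened \<open>?W2\<close> to the first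
    \<open>l\<close> coordinates, \<open>q\<close> forgets these and keeps the other
    \<open>m1 - l\<close>; \<open>u\<close> puts them back, so \<open>D\<close> after
    \<open>u\<close> is a section of \<open>q\<close>.\<close>
  define q where "q c = (\<lambda>i. if i < m1 - l then D' c (i + l) else 0)" for c
  define u where "u d = (\<lambda>i. if i < l then 0 else d (i - l))" for d :: "nat \<Rightarrow> complex"
  have q: "q \<in> Lin (Cn m1) (Cn (m1 - l))"
    by (rule Lin_I) (use D'R in \<open>auto simp: q_def Cn_simps fun_eq_iff\<close>)
  have u: "u \<in> Lin (Cn (m1 - l)) (Cn m1)"
    by (rule Lin_I) (auto simp: u_def Cn_simps fun_eq_iff)
  note uR = Lin_rules[OF vspace_Cn vspace_Cn u]
  have q0: "q c = \<zero>\<^bsub>Cn (m1 - l)\<^esub> \<longleftrightarrow> c \<in> ?W2" if c: "c \<in> carrier (Cn m1)" for c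
  proof -
    have "q c = \<zero>\<^bsub>Cn (m1 - l)\<^esub> \<longleftrightarrow> D' c \<in> carrier (Cn l)"
    proof
      assume z: "q c = \<zero>\<^bsub>Cn (m1 - l)\<^esub>"
      have "D' c i = 0" if "i \<ge> l" for i
      proof (cases "i < m1")
        case True
        have "q c (i - l) = 0" using z by (simp add: Cn_simps)
        then show ?thesis using True that by (simp add: q_def split: if_splits)
      next
        case False
        then show ?thesis using D'R(1)[OF c] by (simp add: Cn_simps)
      qed
      then show "D' c \<in> carrier (Cn l)" by (simp add: Cn_simps)
    qed (auto simp: q_def Cn_simps)
    also have "\<dots> \<longleftrightarrow> c \<in> ?W2"
    proof
      assume "D' c \<in> carrier (Cn l)"
      then have "D (D' c) \<in> ?W2" using DW by blast
      then show "c \<in> ?W2" unfolding DD'[OF c] .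
    next
      assume "c \<in> ?W2"
      then obtain a where a: "a \<in> carrier (Cn l)" "c = D a" using DW by blast
      then show "D' c \<in> carrier (Cn l)" using D'D[OF Cl[OF a(1)]] by simp
    qed
    finally show ?thesis .
  qed
  have qDu: "q (D (u d)) = d" if d: "d \<in> carrier (Cn (m1 - l))" for d
  proof -
    have "D' (D (u d)) = u d" by (rule D'D[OF uR(1)[OF d]])
    then show ?thesis using d by (auto simp: q_def u_def Cn_simps fun_eq_iff)
  qed
  have "fdata X X U k (m1 - l)"
  proof (rule fdata_algebraic[OF X X U])
    show "(\<lambda>c. i2 (E c)) \<in> \<B> (Cn k) X"
      by (rule B_Cn[OF Xn Lin_comp[OF B_Lin[OF d2(3)] Lin_comp[OF E incl]]])
    show "(\<lambda>x. tr k (E' (C2 x))) \<in> \<B> X (Cn k)"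
      by (rule B_comp[OF Xn normed_Cn B_Cn[OF normed_Cn Lin_tr] B_comp[OF Xn normed_Cn B_Cn[OF normed_Cn E'] d2(4)]])
    show "(\<lambda>d. B1 (D (u d))) \<in> Lin (Cn (m1 - l)) X"
      by (rule Lin_comp[OF B_Lin[OF d1(5)] Lin_comp[OF D u]])
    show "(\<lambda>y. q (j1 y)) \<in> Lin X (Cn (m1 - l))" by (rule Lin_comp[OF q B_Lin[OF d1(6)]])
  next
    fix c assume c: "c \<in> carrier (Cn k)"
    have "C2 (i2 (E c)) = E c" by (rule d2(10)[OF ER(1)[OF Ck[OF c]]])
    then show "tr k (E' (C2 (i2 (E c)))) = c" using E'E[OF Ck[OF c]] c by simp
  next
    have "(\<lambda>c. i2 (E c)) ` carrier (Cn k) = i2 ` ?W1" unfolding EW[symmetric] by (simp add: image_image)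
    also have "\<dots> = {x \<in> carrier X. U x = \<zero>\<^bsub>X\<^esub>}"
    proof (intro equalityI subsetI)
      fix x assume "x \<in> {x \<in> carrier X. U x = \<zero>\<^bsub>X\<^esub>}"
      then have x: "x \<in> carrier X" "U x = \<zero>\<^bsub>X\<^esub>" by auto
      have "x \<ominus>\<^bsub>X\<^esub> i2 (C2 x) = \<zero>\<^bsub>X\<^esub>" using d2(7)[OF x(1)] x(2) by simp
      then have "i2 (C2 x) = x" using x(1) vspace.minus_eq_zero_iff[OF XV x(1), of "i2 (C2 x)"] by simp
      then show "x \<in> i2 ` ?W1" using x by (intro image_eqI[of _ _ "C2 x"]) auto
    qed auto
    finally show "(\<lambda>c. i2 (E c)) ` carrier (Cn k) = {x \<in> carrier X. U x = \<zero>\<^bsub>X\<^esub>}" .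
  next
    fix d assume d: "d \<in> carrier (Cn (m1 - l))"
    have "j1 (B1 (D (u d))) = D (u d)" by (rule d1(12)[OF DR(1)[OF uR(1)[OF d]]])
    then show "q (j1 (B1 (D (u d)))) = d" using qDu[OF d] by simp
  next
    have UA: "U (W (S1 y)) = y \<ominus>\<^bsub>X\<^esub> B1 (j1 y)" if "y \<in> carrier X" for y by (rule d1(8)[OF that])
    show "U ` carrier X = {y \<in> carrier X. q (j1 y) = \<zero>\<^bsub>Cn (m1 - l)\<^esub>}"
    proof (intro equalityI subsetI)
      fix y assume "y \<in> U ` carrier X"
      then obtain x where x: "x \<in> carrier X" "y = U x" by blast
      have y: "y \<in> carrier X" using x by simp
      have "B1 (j1 y) = y \<ominus>\<^bsub>X\<^esub> U (W (S1 y))" using UA[OF y] y by simp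
      also have "\<dots> = U (x \<ominus>\<^bsub>X\<^esub> W (S1 y))" using x y by simp
      finally have "B1 (j1 y) = U (x \<ominus>\<^bsub>X\<^esub> W (S1 y))" .
      moreover have "x \<ominus>\<^bsub>X\<^esub> W (S1 y) \<in> carrier X" using x(1) y by simp
      ultimately have "B1 (j1 y) \<in> U ` carrier X" by blast
      then show "y \<in> {y \<in> carrier X. q (j1 y) = \<zero>\<^bsub>Cn (m1 - l)\<^esub>}" using q0[of "j1 y"] y by simp
    next
      fix y assume "y \<in> {y \<in> carrier X. q (j1 y) = \<zero>\<^bsub>Cn (m1 - l)\<^esub>}"
      then have y: "y \<in> carrier X" "j1 y \<in> ?W2" using q0[of "j1 y"] by auto
      then obtain x where x: "x \<in> carrier X" "B1 (j1 y) = U x" by blast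
      have "y = U (W (S1 y)) \<oplus>\<^bsub>X\<^esub> U x" unfolding UA[OF y(1)] x(2)[symmetric] using y(1) by simp
      also have "\<dots> = U (W (S1 y) \<oplus>\<^bsub>X\<^esub> x)" using x y(1) by simp
      finally have "y = U (W (S1 y) \<oplus>\<^bsub>X\<^esub> x)" .
      moreover have "W (S1 y) \<oplus>\<^bsub>X\<^esub> x \<in> carrier X" using x(1) y(1) by simp
      ultimately show "y \<in> U ` carrier X" by blast
    qed
  qed
  then show ?thesis by blast
qed

section \<open>Schur coupling\<close>

lemma inverse_opsD:
  assumes "inverse_ops X Y T S"
  shows "T \<in> \<B> X Y" "S \<in> \<B> Y X" "\<And>x. x \<in> carrier X \<Longrightarrow> S (T x) = x" "\<And>y. y \<in> carrier Y \<Longrightarrow> T (S y) = y"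
  using assms unfolding inverse_ops_def by blast+

lemma fdata_invertible_comp:
  assumes X: "banach_space X" and T: "fdata X X T n m" and A: "inverse_ops X X A A'"
  shows "fdata X X (\<lambda>x. A (T x)) n m"
proof -
  note Xn = banach_normed[OF X] note XV = banach_vspace[OF X]
  obtain S i C B j where D: "fdec X X T n m S i C B j" using T by (rule fdataE)
  note d = fdecD[OF D] and a = inverse_opsD[OF A]
  note [simp] = XV B_rules[OF XV XV d(1)] B_rules[OF XV XV d(2)] B_rules[OF vspace_Cn XV d(3)]
    B_rules[OF XV vspace_Cn d(4)] B_rules[OF vspace_Cn XV d(5)] B_rules[OF XV vspace_Cn d(6)]
    B_rules[OF XV XV a(1)] B_rules[OF XV XV a(2)] a(3,4) d(7-12)
  show ?thesis
    by (rule fdataI[OF Xn Xn B_comp[OF Xn Xn a(1) d(1)] B_comp[OF Xn Xn d(2) a(2)] d(3,4)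
      B_comp[OF normed_Cn Xn a(1) d(5)] B_comp[OF Xn Xn d(6) a(2)]]) simp_all
qed

lemma incomparable_fredholm:
  "essentially_incomparable X Y \<Longrightarrow> P \<in> \<B> X Y \<Longrightarrow> Q \<in> \<B> Y X \<Longrightarrow>
    fredholm X X (\<lambda>x. x \<ominus>\<^bsub>X\<^esub> Q (P x))"
  unfolding essentially_incomparable_def inessential_def by blast

text \<open>For every real \<open>t\<close> the multiple \<open>t Q\<close> is again an operator
  from \<open>Y\<close> to \<open>X\<close>, so incomparability makes the whole segment starting at
  the identity Fredholm and the homotopy argument applies.\<close>

lemma fdata_incomparable:
  assumes X: "banach_space X" and Y: "banach_space Y" and inc: "essentially_incomparable X Y"
    and P: "P \<in> \<B> X Y" and Q: "Q \<in> \<B> Y X"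
  shows "\<exists>n. fdata X X (\<lambda>x. x \<ominus>\<^bsub>X\<^esub> Q (P x)) n n"
proof -
  note Xn = banach_normed[OF X] note Yn = banach_normed[OF Y]
  have fd: "\<exists>n m. fdata X X (\<lambda>x. x \<ominus>\<^bsub>X\<^esub> R (P x)) n m" if "R \<in> \<B> Y X" for R
    using fredholm_imp_fdata[OF X X incomparable_fredholm[OF inc P that]] by blast
  obtain n m where nm: "fdata X X (\<lambda>x. x \<ominus>\<^bsub>X\<^esub> Q (P x)) n m" using fd[OF Q] by blast
  have "n = m"
    by (rule index0_homotopy[OF X B_comp[OF Xn Yn Q P] _ nm]) (rule fd[OF B_smult[OF Yn Xn Q]])
  then show ?thesis using nm by blast
qed

text \<open>Write \<open>(u, y)\<close> for the image of \<open>(x, v)\<close> under the block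
  operator. As \<open>D\<close> is invertible, \<open>(x, y)\<close> determines
  \<open>(v, u)\<close>: this is \<open>F\<close>; invertibility of \<open>A\<close> gives its
  inverse \<open>G\<close>. Up to the order of the summands, \<open>E\<close> is a product of two
  triangular steps: \<open>C A' u\<close> is added to the \<open>Y\<close> entry, then
  \<open>B D'\<close> of the result is subtracted from \<open>u\<close>. \<open>H\<close> undoes
  them in reverse order.\<close>

lemma SC_imp_EAE_via:
  assumes X: "banach_space X" and Y: "banach_space Y" and U: "U \<in> \<B> X X" and V: "V \<in> \<B> Y Y"
    and SC: "SC X Y U V"
  shows "EAE_via X Y U V Y X"
proof -
  note Xn = banach_normed[OF X] note Yn = banach_normed[OF Y]
  note XV = banach_vspace[OF X] note YV = banach_vspace[OF Y]
  interpret X: vspace X by (rule XV)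
  interpret Y: vspace Y by (rule YV)
  obtain A B C D A' D' where A: "A \<in> \<B> X X" and B: "B \<in> \<B> Y X" and C: "C \<in> \<B> X Y" and D: "D \<in> \<B> Y Y"
    and AA: "inverse_ops X X A A'" and DD: "inverse_ops Y Y D D'"
    and Ueq: "\<And>x. x \<in> carrier X \<Longrightarrow> U x = A x \<ominus>\<^bsub>X\<^esub> B (D' (C x))"
    and Veq: "\<And>y. y \<in> carrier Y \<Longrightarrow> V y = D y \<ominus>\<^bsub>Y\<^esub> C (A' (B y))"
    using SC unfolding SC_def by blast
  note a = inverse_opsD[OF AA] and dd = inverse_opsD[OF DD]
  note [simp] = XV YV B_rules[OF XV XV A] B_rules[OF YV XV B] B_rules[OF XV YV C] B_rules[OF YV YV D]
    B_rules[OF XV XV a(2)] B_rules[OF YV YV dd(2)] a(3,4) dd(3,4) Ueq Veq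
  define F where "F z = (D' (snd z \<ominus>\<^bsub>Y\<^esub> C (fst z)), U (fst z) \<oplus>\<^bsub>X\<^esub> B (D' (snd z)))" for z
  define G where "G w = (A' (snd w \<ominus>\<^bsub>X\<^esub> B (fst w)), D (fst w) \<oplus>\<^bsub>Y\<^esub> C (A' (snd w \<ominus>\<^bsub>X\<^esub> B (fst w))))" for w
  define E where "E w = (snd w \<ominus>\<^bsub>X\<^esub> B (D' (fst w \<oplus>\<^bsub>Y\<^esub> C (A' (snd w)))), fst w \<oplus>\<^bsub>Y\<^esub> C (A' (snd w)))" for w
  define H where "H z = (snd z \<ominus>\<^bsub>Y\<^esub> C (A' (fst z \<oplus>\<^bsub>X\<^esub> B (D' (snd z)))), fst z \<oplus>\<^bsub>X\<^esub> B (D' (snd z)))" for z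
  note intros = B_pair B_add B_minus B_comp[OF _ _ A] B_comp[OF _ _ B] B_comp[OF _ _ C] B_comp[OF _ _ D]
    B_comp[OF _ _ a(2)] B_comp[OF _ _ dd(2)] B_comp[OF _ _ U] B_fst B_snd normed_dsum Xn Yn
  have ops: "F \<in> \<B> (X \<oplus>\<^sub>B Y) (Y \<oplus>\<^sub>B X)" "G \<in> \<B> (Y \<oplus>\<^sub>B X) (X \<oplus>\<^sub>B Y)"
    "E \<in> \<B> (Y \<oplus>\<^sub>B X) (X \<oplus>\<^sub>B Y)" "H \<in> \<B> (X \<oplus>\<^sub>B Y) (Y \<oplus>\<^sub>B X)"
    unfolding F_def G_def E_def H_def by (intro intros)+
  have FG: "inverse_ops (X \<oplus>\<^sub>B Y) (Y \<oplus>\<^sub>B X) F G"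
    unfolding inverse_ops_def
  proof (intro conjI ops ballI)
    fix z assume "z \<in> carrier (X \<oplus>\<^sub>B Y)"
    then obtain x y where z: "z = (x, y)" "x \<in> carrier X" "y \<in> carrier Y" by auto
    have 1: "U x \<oplus>\<^bsub>X\<^esub> B (D' y) \<ominus>\<^bsub>X\<^esub> B (D' (y \<ominus>\<^bsub>Y\<^esub> C x)) = A x"
      using z by (intro X.vec_eqI) (auto simp: X.ev_rules)
    have "G (F z) = (x, (y \<ominus>\<^bsub>Y\<^esub> C x) \<oplus>\<^bsub>Y\<^esub> C x)"
      unfolding F_def G_def z(1) fst_conv snd_conv 1 using z by (simp del: Ueq)
    then show "G (F z) = z" using z by simp
  next
    fix w assume "w \<in> carrier (Y \<oplus>\<^sub>B X)"
    then obtain v u where w: "w = (v, u)" "v \<in> carrier Y" "u \<in> carrier X" by auto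
    define x where "x = A' (u \<ominus>\<^bsub>X\<^esub> B v)"
    have x: "x \<in> carrier X" "A x = u \<ominus>\<^bsub>X\<^esub> B v" using w by (auto simp: x_def)
    have 1: "D v \<oplus>\<^bsub>Y\<^esub> C x \<ominus>\<^bsub>Y\<^esub> C x = D v" using w x by (intro Y.vec_eqI) (auto simp: Y.ev_rules)
    have 2: "U x \<oplus>\<^bsub>X\<^esub> B (D' (D v \<oplus>\<^bsub>Y\<^esub> C x)) = u"
      using w x(1) by (intro X.vec_eqI) (auto simp: X.ev_rules x(2))
    have "G w = (x, D v \<oplus>\<^bsub>Y\<^esub> C x)" by (simp add: G_def w x_def)
    then have "F (G w) = (D' (D v), u)" unfolding F_def fst_conv snd_conv by (simp only: fst_conv snd_conv 1 2)
    then show "F (G w) = w" using w by simp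
  qed
  have EH: "inverse_ops (Y \<oplus>\<^sub>B X) (X \<oplus>\<^sub>B Y) E H"
    unfolding inverse_ops_def
  proof (intro conjI ops ballI)
    fix w assume "w \<in> carrier (Y \<oplus>\<^sub>B X)"
    then obtain v u where w: "w = (v, u)" "v \<in> carrier Y" "u \<in> carrier X" by auto
    define y where "y = v \<oplus>\<^bsub>Y\<^esub> C (A' u)"
    have y: "y \<in> carrier Y" using w by (simp add: y_def)
    have 1: "u \<ominus>\<^bsub>X\<^esub> B (D' y) \<oplus>\<^bsub>X\<^esub> B (D' y) = u" using w y by simp
    have 2: "y \<ominus>\<^bsub>Y\<^esub> C (A' u) = v" unfolding y_def using w by (intro Y.vec_eqI) (auto simp: Y.ev_rules)
    have "E w = (u \<ominus>\<^bsub>X\<^esub> B (D' y), y)" by (simp add: E_def w y_def)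
    then show "H (E w) = w" unfolding H_def by (simp only: fst_conv snd_conv 1 2 w(1))
  next
    fix z assume "z \<in> carrier (X \<oplus>\<^sub>B Y)"
    then obtain x y where z: "z = (x, y)" "x \<in> carrier X" "y \<in> carrier Y" by auto
    define u where "u = x \<oplus>\<^bsub>X\<^esub> B (D' y)"
    have u: "u \<in> carrier X" using z by (simp add: u_def)
    have 1: "y \<ominus>\<^bsub>Y\<^esub> C (A' u) \<oplus>\<^bsub>Y\<^esub> C (A' u) = y" using z u by simp
    have 2: "u \<ominus>\<^bsub>X\<^esub> B (D' y) = x" unfolding u_def using z by (intro X.vec_eqI) (auto simp: X.ev_rules)
    have "H z = (y \<ominus>\<^bsub>Y\<^esub> C (A' u), u)" by (simp add: H_def z u_def)
    then show "E (H z) = z" unfolding E_def by (simp only: fst_conv snd_conv 1 2 z(1))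
  qed
  have "map_prod U id z = E (map_prod V id (F z))" if "z \<in> carrier (X \<oplus>\<^sub>B Y)" for z
  proof -
    obtain x y where z: "z = (x, y)" "x \<in> carrier X" "y \<in> carrier Y" using \<open>z \<in> carrier (X \<oplus>\<^sub>B Y)\<close> by auto
    have 1: "V (D' (y \<ominus>\<^bsub>Y\<^esub> C x)) \<oplus>\<^bsub>Y\<^esub> C (A' (U x \<oplus>\<^bsub>X\<^esub> B (D' y))) = y"
      using z by (intro Y.vec_eqI) (auto simp: Y.ev_rules)
    have 2: "U x \<oplus>\<^bsub>X\<^esub> B (D' y) \<ominus>\<^bsub>X\<^esub> B (D' y) = U x"
      using z by (intro X.vec_eqI) (auto simp: X.ev_rules)
    show ?thesis unfolding E_def F_def z(1) by (simp only: fst_conv snd_conv map_prod_simp id_apply 1 2)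
  qed
  then show ?thesis unfolding EAE_via_def invertible_op_def using X Y EH FG by blast
qed

text \<open>\<open>F\<close> exchanges the summands but matches the kernels of \<open>U\<close> and
  \<open>V\<close> in \<open>Cn n\<close>. In \<open>E\<close>, the term \<open>B j'\<close> matches
  the cokernels in \<open>Cn m\<close>, while on the complements \<open>S'\<close> undoes
  \<open>V\<close> and \<open>U\<close> acts where \<open>V \<oplus> I\<close> was the
  identity.\<close>

lemma fdata_imp_EAE_via:
  assumes X: "banach_space X" and Y: "banach_space Y" and U: "fdata X X U n m" and V: "fdata Y Y V n m"
  shows "EAE_via X Y U V Y X"
proof -
  note Xn = banach_normed[OF X] note Yn = banach_normed[OF Y]
  note XV = banach_vspace[OF X] note YV = banach_vspace[OF Y]
  interpret X: vspace X by (rule XV)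
  interpret Y: vspace Y by (rule YV)
  obtain S i C B j where D: "fdec X X U n m S i C B j" using U by (rule fdataE)
  obtain S' i' C' B' j' where D': "fdec Y Y V n m S' i' C' B' j'" using V by (rule fdataE)
  note d = fdecD[OF D] and e = fdecD[OF D']
  note [simp] = XV YV B_rules[OF XV XV d(1)] B_rules[OF XV XV d(2)] B_rules[OF vspace_Cn XV d(3)]
    B_rules[OF XV vspace_Cn d(4)] B_rules[OF vspace_Cn XV d(5)] B_rules[OF XV vspace_Cn d(6)]
    B_rules[OF YV YV e(1)] B_rules[OF YV YV e(2)] B_rules[OF vspace_Cn YV e(3)]
    B_rules[OF YV vspace_Cn e(4)] B_rules[OF vspace_Cn YV e(5)] B_rules[OF YV vspace_Cn e(6)]
  note [simp] = d(7-14) e(7-14)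
  define F where "F z = ((snd z \<ominus>\<^bsub>Y\<^esub> i' (C' (snd z))) \<oplus>\<^bsub>Y\<^esub> i' (C (fst z)),
    (fst z \<ominus>\<^bsub>X\<^esub> i (C (fst z))) \<oplus>\<^bsub>X\<^esub> i (C' (snd z)))" for z
  define G where "G w = ((snd w \<ominus>\<^bsub>X\<^esub> i (C (snd w))) \<oplus>\<^bsub>X\<^esub> i (C' (fst w)),
    (fst w \<ominus>\<^bsub>Y\<^esub> i' (C' (fst w))) \<oplus>\<^bsub>Y\<^esub> i' (C (snd w)))" for w
  define E where "E w = (U (snd w) \<oplus>\<^bsub>X\<^esub> B (j' (fst w)), S' (fst w) \<oplus>\<^bsub>Y\<^esub> i' (C (snd w)))" for w
  define H where "H z = (V (snd z) \<oplus>\<^bsub>Y\<^esub> B' (j (fst z)), S (fst z) \<oplus>\<^bsub>X\<^esub> i (C' (snd z)))" for z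
  note intros = B_pair B_add B_minus B_comp[OF _ _ d(1)] B_comp[OF _ _ d(2)] B_comp[OF _ _ d(3)]
    B_comp[OF _ _ d(4)] B_comp[OF _ _ d(5)] B_comp[OF _ _ d(6)] B_comp[OF _ _ e(1)] B_comp[OF _ _ e(2)]
    B_comp[OF _ _ e(3)] B_comp[OF _ _ e(4)] B_comp[OF _ _ e(5)] B_comp[OF _ _ e(6)] B_fst B_snd normed_dsum normed_Cn Xn Yn
  have ops: "F \<in> \<B> (X \<oplus>\<^sub>B Y) (Y \<oplus>\<^sub>B X)" "G \<in> \<B> (Y \<oplus>\<^sub>B X) (X \<oplus>\<^sub>B Y)"
    "E \<in> \<B> (Y \<oplus>\<^sub>B X) (X \<oplus>\<^sub>B Y)" "H \<in> \<B> (X \<oplus>\<^sub>B Y) (Y \<oplus>\<^sub>B X)"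
    unfolding F_def G_def E_def H_def by (intro intros)+
  have FG: "inverse_ops (X \<oplus>\<^sub>B Y) (Y \<oplus>\<^sub>B X) F G"
    unfolding inverse_ops_def
  proof (intro conjI ops ballI)
    fix z assume "z \<in> carrier (X \<oplus>\<^sub>B Y)"
    then obtain x y where z: "z = (x, y)" "x \<in> carrier X" "y \<in> carrier Y" by auto
    then show "G (F z) = z" unfolding F_def G_def by (auto intro!: X.vec_eqI Y.vec_eqI simp: X.ev_rules Y.ev_rules)
  next
    fix w assume "w \<in> carrier (Y \<oplus>\<^sub>B X)"
    then obtain v u where w: "w = (v, u)" "v \<in> carrier Y" "u \<in> carrier X" by auto
    then show "F (G w) = w" unfolding F_def G_def by (auto intro!: X.vec_eqI Y.vec_eqI simp: X.ev_rules Y.ev_rules)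
  qed
  have EH: "inverse_ops (Y \<oplus>\<^sub>B X) (X \<oplus>\<^sub>B Y) E H"
    unfolding inverse_ops_def
  proof (intro conjI ops ballI)
    fix w assume "w \<in> carrier (Y \<oplus>\<^sub>B X)"
    then obtain v u where w: "w = (v, u)" "v \<in> carrier Y" "u \<in> carrier X" by auto
    then show "H (E w) = w" unfolding E_def H_def by (auto intro!: X.vec_eqI Y.vec_eqI simp: X.ev_rules Y.ev_rules)
  next
    fix z assume "z \<in> carrier (X \<oplus>\<^sub>B Y)"
    then obtain x y where z: "z = (x, y)" "x \<in> carrier X" "y \<in> carrier Y" by auto
    then show "E (H z) = z" unfolding E_def H_def by (auto intro!: X.vec_eqI Y.vec_eqI simp: X.ev_rules Y.ev_rules)
  qed
  have "map_prod U id z = E (map_prod V id (F z))" if "z \<in> carrier (X \<oplus>\<^sub>B Y)" for z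
  proof -
    obtain x y where z: "z = (x, y)" "x \<in> carrier X" "y \<in> carrier Y" using \<open>z \<in> carrier (X \<oplus>\<^sub>B Y)\<close> by auto
    then show ?thesis unfolding E_def F_def by (auto intro!: X.vec_eqI Y.vec_eqI simp: X.ev_rules Y.ev_rules)
  qed
  then show ?thesis unfolding EAE_via_def invertible_op_def using X Y EH FG by blast
qed

text \<open>With equal defects \<open>U + B C\<close> has the inverse \<open>S + i j\<close>,
  because \<open>B C\<close> maps the kernel of \<open>U\<close> onto a complement of its range. The
  off-diagonal entries \<open>B C'\<close> and \<open>B' C\<close> make the Schur complement
  subtract exactly this correction, as \<open>C' D' B' C = C\<close>; the same happens for
  \<open>V\<close>.\<close>

lemma fdata_imp_SC:
  assumes X: "banach_space X" and Y: "banach_space Y" and U: "fdata X X U n n" and V: "fdata Y Y V n n"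
  shows "SC X Y U V"
proof -
  note Xn = banach_normed[OF X] note Yn = banach_normed[OF Y]
  note XV = banach_vspace[OF X] note YV = banach_vspace[OF Y]
  interpret X: vspace X by (rule XV)
  interpret Y: vspace Y by (rule YV)
  obtain S i C B j where D: "fdec X X U n n S i C B j" using U by (rule fdataE)
  obtain S' i' C' B' j' where D': "fdec Y Y V n n S' i' C' B' j'" using V by (rule fdataE)
  note d = fdecD[OF D] and e = fdecD[OF D']
  note [simp] = XV YV B_rules[OF XV XV d(1)] B_rules[OF XV XV d(2)] B_rules[OF vspace_Cn XV d(3)]
    B_rules[OF XV vspace_Cn d(4)] B_rules[OF vspace_Cn XV d(5)] B_rules[OF XV vspace_Cn d(6)]
    B_rules[OF YV YV e(1)] B_rules[OF YV YV e(2)] B_rules[OF vspace_Cn YV e(3)]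
    B_rules[OF YV vspace_Cn e(4)] B_rules[OF vspace_Cn YV e(5)] B_rules[OF YV vspace_Cn e(6)]
  note [simp] = d(7-14) e(7-14)
  define A where "A x = U x \<oplus>\<^bsub>X\<^esub> B (C x)" for x
  define A' where "A' x = S x \<oplus>\<^bsub>X\<^esub> i (j x)" for x
  define D where "D y = V y \<oplus>\<^bsub>Y\<^esub> B' (C' y)" for y
  define D' where "D' y = S' y \<oplus>\<^bsub>Y\<^esub> i' (j' y)" for y
  note intros = B_pair B_add B_minus B_comp[OF _ _ d(1)] B_comp[OF _ _ d(2)] B_comp[OF _ _ d(3)]
    B_comp[OF _ _ d(4)] B_comp[OF _ _ d(5)] B_comp[OF _ _ d(6)] B_comp[OF _ _ e(1)] B_comp[OF _ _ e(2)]
    B_comp[OF _ _ e(3)] B_comp[OF _ _ e(4)] B_comp[OF _ _ e(5)] B_comp[OF _ _ e(6)] B_fst B_snd normed_dsum normed_Cn Xn Yn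
    d(1,2,4,6) e(1,2,4,6)
  have ops: "A \<in> \<B> X X" "A' \<in> \<B> X X" "D \<in> \<B> Y Y" "D' \<in> \<B> Y Y" "(\<lambda>y. B (C' y)) \<in> \<B> Y X" "(\<lambda>x. B' (C x)) \<in> \<B> X Y"
    unfolding A_def A'_def D_def D'_def by (intro intros)+
  have AA: "inverse_ops X X A A'" unfolding inverse_ops_def
    by (intro conjI ops ballI) (auto intro!: X.vec_eqI simp: A_def A'_def X.ev_rules)
  have DD: "inverse_ops Y Y D D'" unfolding inverse_ops_def
    by (intro conjI ops ballI) (auto intro!: Y.vec_eqI simp: D_def D'_def Y.ev_rules)
  have block: "block_op X Y A (\<lambda>y. B (C' y)) (\<lambda>x. B' (C x)) D \<in> \<B> (X \<oplus>\<^sub>B Y) (X \<oplus>\<^sub>B Y)"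
    unfolding block_op_def case_prod_beta
    by (intro intros B_comp[OF _ _ ops(1)] B_comp[OF _ _ ops(3)])
  have Ueq: "U x = A x \<ominus>\<^bsub>X\<^esub> B (C' (D' (B' (C x))))" if x: "x \<in> carrier X" for x
  proof -
    have "C' (D' (B' (C x))) = C x" using x by (simp add: D'_def)
    then show ?thesis using x by (intro X.vec_eqI) (auto simp: A_def X.ev_rules)
  qed
  have Veq: "V y = D y \<ominus>\<^bsub>Y\<^esub> B' (C (A' (B (C' y))))" if y: "y \<in> carrier Y" for y
  proof -
    have "C (A' (B (C' y))) = C' y" using y by (simp add: A'_def)
    then show ?thesis using y by (intro Y.vec_eqI) (auto simp: D_def Y.ev_rules)
  qed
  show ?thesis unfolding SC_def
    using ops block AA DD Ueq Veq
    by (intro bexI[of _ A] bexI[of _ "\<lambda>y. B (C' y)"] bexI[of _ "\<lambda>x. B' (C x)"] bexI[of _ D] conjI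
      exI[of _ A'] exI[of _ D']) auto
qed

section \<open>Essentially incomparable spaces\<close>

lemma fdata_iff_fredholm:
  assumes "banach_space X" "banach_space Y"
  shows "fdata X Y T n m \<longleftrightarrow> fredholm X Y T \<and> vdim X (Ker X Y T) = n \<and> vdim Y (Coker X Y T) = m"
  using fredholm_imp_fdata[OF assms] fdata_imp_fredholm[OF assms] by blast

lemma SC_imp_fdata:
  assumes X: "banach_space X" and Y: "banach_space Y" and U: "U \<in> \<B> X X" and V: "V \<in> \<B> Y Y"
    and inc: "essentially_incomparable X Y" and SC: "SC X Y U V"
  shows "\<exists>n. fdata X X U n n \<and> fdata Y Y V n n"
proof -
  note Xn = banach_normed[OF X] note Yn = banach_normed[OF Y]
  note XV = banach_vspace[OF X] note YV = banach_vspace[OF Y]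
  obtain A B C D A' D' where B: "B \<in> \<B> Y X" and C: "C \<in> \<B> X Y"
    and AA: "inverse_ops X X A A'" and DD: "inverse_ops Y Y D D'"
    and Ueq: "\<And>x. x \<in> carrier X \<Longrightarrow> U x = A x \<ominus>\<^bsub>X\<^esub> B (D' (C x))"
    using SC unfolding SC_def by blast
  note a = inverse_opsD[OF AA] and dd = inverse_opsD[OF DD]
  note [simp] = XV YV B_rules[OF XV XV a(1)] B_rules[OF YV XV B] B_rules[OF XV YV C]
    B_rules[OF XV XV a(2)] B_rules[OF YV YV dd(2)] a(3,4)
  have "(\<lambda>y. A' (B (D' y))) \<in> \<B> Y X"
    by (rule B_comp[OF Yn Xn a(2) B_comp[OF Yn Yn B dd(2)]])
  from fdata_incomparable[OF X Y inc C this]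
  obtain n where "fdata X X (\<lambda>x. x \<ominus>\<^bsub>X\<^esub> A' (B (D' (C x)))) n n" by blast
  from fdata_invertible_comp[OF X this AA]
  have n: "fdata X X U n n"
    by (rule fdata_cong[OF XV]) (simp add: Ueq)
  obtain E H F G where "eae X Y U V Y X E H F G"
    by (rule EAE_viaE[OF SC_imp_EAE_via[OF X Y U V SC] X Y U V]) (rule that)
  then have "fdata Y Y V n n" using n by (rule eae.fdata_transfer)
  then show ?thesis using n by blast
qed

lemma EAE_via_imp_fdata:
  assumes X: "banach_space X" and Y: "banach_space Y" and U: "U \<in> \<B> X X" and V: "V \<in> \<B> Y Y"
    and inc: "essentially_incomparable X Y" and EAE: "EAE_via X Y U V X\<^sub>0 Y\<^sub>0"
  shows "\<exists>n m. fdata X X U n m \<and> fdata Y Y V n m"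
proof -
  note XV = banach_vspace[OF X]
  obtain E H F G where e: "eae X Y U V X\<^sub>0 Y\<^sub>0 E H F G"
    by (rule EAE_viaE[OF EAE X Y U V]) (rule that)
  obtain W P Q P' Q' where W: "W \<in> \<B> X X" and P: "P \<in> \<B> X Y" "Q \<in> \<B> Y X" and P': "P' \<in> \<B> X Y" "Q' \<in> \<B> Y X"
    and UW: "\<And>x. x \<in> carrier X \<Longrightarrow> U (W x) = x \<ominus>\<^bsub>X\<^esub> Q (P x)"
    and WU: "\<And>x. x \<in> carrier X \<Longrightarrow> W (U x) = x \<ominus>\<^bsub>X\<^esub> Q' (P' x)"
    by (rule eae.parametrix[OF e]) (rule that)
  obtain k where k: "fdata X X (\<lambda>x. x \<ominus>\<^bsub>X\<^esub> Q (P x)) k k" using fdata_incomparable[OF X Y inc P] by blast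
  obtain l where l: "fdata X X (\<lambda>x. x \<ominus>\<^bsub>X\<^esub> Q' (P' x)) l l" using fdata_incomparable[OF X Y inc P'] by blast
  have "\<exists>n m. fdata X X U n m"
    by (rule fdata_of_products[OF X U W fdata_cong[OF XV k UW] fdata_cong[OF XV l WU]])
  then show ?thesis using eae.fdata_transfer[OF e] by blast
qed

text \<open>Let \<open>?S\<close> and \<open>?T\<close> be the upper left entries of
  \<open>F\<close> and of its inverse \<open>G\<close>. A trivial \<open>Y0\<close> gives
  \<open>?T ?S = I\<close>, so the finite-dimensional kernel of \<open>I - ?T ?S\<close> is all of
  \<open>X\<close>. A trivial \<open>X0\<close> gives \<open>?S ?T = I\<close>; then
  \<open>?T\<close> maps \<open>Y\<close> into this kernel and \<open>?S\<close> maps the kernel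
  back onto \<open>Y\<close>, which makes \<open>Y\<close> finite-dimensional.\<close>

lemma incomparable_not_EAOE:
  fixes X Y :: "'u nspace"
  assumes X: "banach_space X" and Y: "banach_space Y" and U: "U \<in> \<B> X X" and V: "V \<in> \<B> Y Y"
    and inc: "essentially_incomparable X Y"
    and fX: "\<not> finite_dim X (carrier X)" and fY: "\<not> finite_dim Y (carrier Y)"
  shows "\<not> EAOE X Y U V"
proof
  note XV = banach_vspace[OF X] note YV = banach_vspace[OF Y]
  assume "EAOE X Y U V"
  then obtain X0 Y0 :: "'u nspace" where EAE: "EAE_via X Y U V X0 Y0"
    and triv: "carrier X0 = {\<zero>\<^bsub>X0\<^esub>} \<or> carrier Y0 = {\<zero>\<^bsub>Y0\<^esub>}" unfolding EAOE_def by blast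
  obtain E H F G where e: "eae X Y U V X0 Y0 E H F G"
    by (rule EAE_viaE[OF EAE X Y U V]) (rule that)
  interpret e: eae X Y U V X0 Y0 E H F G by (rule e)
  let ?S = "\<lambda>x. fst (F (x, \<zero>\<^bsub>X0\<^esub>))" and ?T = "\<lambda>y. fst (G (y, \<zero>\<^bsub>Y0\<^esub>))"
  note SB = e.FB(1) and TB = e.GB(1)
  note [simp] = XV YV B_rules[OF XV YV SB] B_rules[OF YV XV TB]
  let ?K = "{x \<in> carrier X. x \<ominus>\<^bsub>X\<^esub> ?T (?S x) = \<zero>\<^bsub>X\<^esub>}"
  have "fredholm X X (\<lambda>x. x \<ominus>\<^bsub>X\<^esub> ?T (?S x))"
    by (rule incomparable_fredholm[OF inc SB TB])
  then have fK: "finite_dim X ?K" unfolding fredholm_def Ker_eq by blast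
  from triv show False
  proof
    assume Y0: "carrier Y0 = {\<zero>\<^bsub>Y0\<^esub>}"
    have 0: "?T (?S x) = x" if x: "x \<in> carrier X" for x
    proof -
      have xc: "(x, \<zero>\<^bsub>X0\<^esub>) \<in> carrier (X \<oplus>\<^sub>B X0)" using x by simp
      have "snd (F (x, \<zero>\<^bsub>X0\<^esub>)) = \<zero>\<^bsub>Y0\<^esub>" using e.fst_in(2)[OF e.FR(1)[OF xc]] Y0 by simp
      then have "(?S x, \<zero>\<^bsub>Y0\<^esub>) = F (x, \<zero>\<^bsub>X0\<^esub>)" by (simp add: prod_eq_iff)
      then show ?thesis using e.inv(3)[OF xc] by simp
    qed
    have "?K = carrier X" using 0 by auto
    then show False using fK fX by simp
  next
    assume X0: "carrier X0 = {\<zero>\<^bsub>X0\<^esub>}"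
    have 0: "?S (?T y) = y" if y: "y \<in> carrier Y" for y
    proof -
      have yc: "(y, \<zero>\<^bsub>Y0\<^esub>) \<in> carrier (Y \<oplus>\<^sub>B Y0)" using y by simp
      have "snd (G (y, \<zero>\<^bsub>Y0\<^esub>)) = \<zero>\<^bsub>X0\<^esub>" using e.fst_in(2)[OF e.GR(1)[OF yc]] X0 by simp
      then have "(?T y, \<zero>\<^bsub>X0\<^esub>) = G (y, \<zero>\<^bsub>Y0\<^esub>)" by (simp add: prod_eq_iff)
      then show ?thesis using e.inv(4)[OF yc] by simp
    qed
    have KL: "(\<lambda>x. x \<ominus>\<^bsub>X\<^esub> ?T (?S x)) \<in> Lin X X"
      by (rule Lin_minus[OF XV Lin_id Lin_comp[OF B_Lin[OF TB] B_Lin[OF SB]]])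
    have sK: "subsp X ?K" by (rule subsp_kernel[OF XV XV KL])
    obtain n where "dimn X ?K n" using fK finite_dim_iff[OF XV sK] by blast
    then obtain i where i: "i \<in> Lin (Cn n) X" "inj_on i (carrier (Cn n))" "i ` carrier (Cn n) = ?K"
      unfolding dimn_def by blast
    have TS: "?T (?S x) = x" if "x \<in> ?K" for x
      using that vspace.minus_eq_zero_iff[OF XV, of x "?T (?S x)"] by simp
    have "dimn Y (carrier Y) n" unfolding dimn_def
    proof (intro bexI[of _ "\<lambda>c. ?S (i c)"] conjI)
      show "(\<lambda>c. ?S (i c)) \<in> Lin (Cn n) Y" by (rule Lin_comp[OF B_Lin[OF SB] i(1)])
      show "inj_on (\<lambda>c. ?S (i c)) (carrier (Cn n))"
      proof (rule inj_onI)
        fix c d assume c: "c \<in> carrier (Cn n)" "d \<in> carrier (Cn n)" "?S (i c) = ?S (i d)"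
        have K: "i c \<in> ?K" "i d \<in> ?K" using i(3) c by blast+
        have "i c = ?T (?S (i c))" by (rule TS[OF K(1), symmetric])
        also have "\<dots> = ?T (?S (i d))" by (simp only: c(3))
        also have "\<dots> = i d" by (rule TS[OF K(2)])
        finally have "i c = i d" .
        then show "c = d" using i(2) c by (auto dest: inj_onD)
      qed
      show "(\<lambda>c. ?S (i c)) ` carrier (Cn n) = carrier Y"
      proof (intro equalityI subsetI)
        fix y assume y: "y \<in> carrier Y"
        have "?T y \<in> ?K" using y 0[OF y] by simp
        then obtain c where c: "c \<in> carrier (Cn n)" "?T y = i c" using i(3) by blast
        have "y = ?S (i c)" unfolding c(2)[symmetric] by (rule 0[OF y, symmetric])
        then show "y \<in> (\<lambda>c. ?S (i c)) ` carrier (Cn n)" using c(1) by blast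
      next
        fix y assume "y \<in> (\<lambda>c. ?S (i c)) ` carrier (Cn n)"
        then show "y \<in> carrier Y" using Lin_rules(1)[OF vspace_Cn XV i(1)] by auto
      qed
    qed
    then show False using vdim_eq(1)[OF YV] fY by blast
  qed
qed

lemma incomparable_SC_iff:
  assumes X: "banach_space X" and Y: "banach_space Y" and U: "U \<in> \<B> X X" and V: "V \<in> \<B> Y Y"
    and inc: "essentially_incomparable X Y"
  shows "SC X Y U V \<longleftrightarrow> fredholm_index_0 X X U \<and> fredholm_index_0 Y Y V \<and>
    vdim X (Ker X X U) = vdim Y (Ker Y Y V)"
proof -
  have "SC X Y U V \<longleftrightarrow> (\<exists>n. fdata X X U n n \<and> fdata Y Y V n n)"
    using SC_imp_fdata[OF X Y U V inc] fdata_imp_SC[OF X Y] by blast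
  then show ?thesis
    unfolding fdata_iff_fredholm[OF X X] fdata_iff_fredholm[OF Y Y] fredholm_index_0_def by auto
qed

lemma incomparable_EAE_iff:
  fixes X Y :: "'u nspace"
  assumes X: "banach_space X" and Y: "banach_space Y" and U: "U \<in> \<B> X X" and V: "V \<in> \<B> Y Y"
    and inc: "essentially_incomparable X Y"
  shows "EAE X Y U V \<longleftrightarrow> fredholm X X U \<and> fredholm Y Y V \<and>
    vdim X (Ker X X U) = vdim Y (Ker Y Y V) \<and> vdim X (Coker X X U) = vdim Y (Coker Y Y V)"
proof -
  have "EAE X Y U V \<longleftrightarrow> (\<exists>n m. fdata X X U n m \<and> fdata Y Y V n m)"
    unfolding EAE_def using EAE_via_imp_fdata[OF X Y U V inc] fdata_imp_EAE_via[OF X Y] by blast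
  then show ?thesis
    unfolding fdata_iff_fredholm[OF X X] fdata_iff_fredholm[OF Y Y] by auto
qed

section \<open>The right shifts on \<open>c\<^sub>0\<close> and \<open>\<ell>\<^sup>2\<close>\<close>

definition c0 :: "(nat \<Rightarrow> complex) nspace"
  where "c0 = seqsp {f. f \<longlonglongrightarrow> 0} supn"

definition l2n :: "(nat \<Rightarrow> complex) \<Rightarrow> real"
  where "l2n f = sqrt (\<Sum>i. (cmod (f i))\<^sup>2)"

definition l2 :: "(nat \<Rightarrow> complex) nspace"
  where "l2 = seqsp {f. summable (\<lambda>i. (cmod (f i))\<^sup>2)} l2n"

lemma c0_simps [simp]:
  "f \<in> carrier c0 \<longleftrightarrow> f \<longlonglongrightarrow> 0" "\<zero>\<^bsub>c0\<^esub> = (\<lambda>_. 0)" "f \<oplus>\<^bsub>c0\<^esub> g = (\<lambda>i. f i + g i)"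
  "c \<odot>\<^bsub>c0\<^esub> f = (\<lambda>i. c * f i)" "vnorm c0 = supn"
  by (simp_all add: c0_def)

lemma l2_simps [simp]:
  "f \<in> carrier l2 \<longleftrightarrow> summable (\<lambda>i. (cmod (f i))\<^sup>2)" "\<zero>\<^bsub>l2\<^esub> = (\<lambda>_. 0)" "f \<oplus>\<^bsub>l2\<^esub> g = (\<lambda>i. f i + g i)"
  "c \<odot>\<^bsub>l2\<^esub> f = (\<lambda>i. c * f i)" "vnorm l2 = l2n"
  by (simp_all add: l2_def)

lemma c0_bdd:
  assumes "f \<longlonglongrightarrow> (0::complex)" shows "bdd_above (range (\<lambda>i. cmod (f i)))"
proof -
  have "Bseq f" using assms by (intro convergent_imp_Bseq) (auto simp: convergent_def)
  then obtain K where "\<And>i. cmod (f i) \<le> K" unfolding Bseq_def by blast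
  then show ?thesis by (intro bdd_aboveI2)
qed

lemma vspace_c0 [simp]: "vspace c0"
  unfolding c0_def by (rule vspace_seqsp) (auto intro: tendsto_add_zero tendsto_mult_right_zero)

lemma c0_minus: "g \<longlonglongrightarrow> 0 \<Longrightarrow> f \<ominus>\<^bsub>c0\<^esub> g = (\<lambda>i. f i - g i)"
  using vspace_c0 seqsp_minus[of "{f. f \<longlonglongrightarrow> 0}" supn g f] unfolding c0_def by simp

lemma c0_upper: "f \<longlonglongrightarrow> 0 \<Longrightarrow> cmod (f i) \<le> supn f"
  by (rule supn_upper[OF c0_bdd])

lemma banach_c0 [simp]: "banach_space c0"
  unfolding c0_def
proof (rule banach_supn)
  show "vspace (seqsp {f. f \<longlonglongrightarrow> 0} supn)" using vspace_c0 by (simp add: c0_def)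
  show "bdd_above (range (\<lambda>i. cmod (f i)))" if "f \<in> {f. f \<longlonglongrightarrow> 0}" for f using c0_bdd that by simp
  fix s f assume "\<And>n. s n \<in> {f. f \<longlonglongrightarrow> (0::complex)}"
    and C: "\<And>e. e > 0 \<Longrightarrow> \<exists>M. \<forall>m\<ge>M. \<forall>n\<ge>M. supn (\<lambda>i. s m i - s n i) < e"
    and l: "\<And>i. (\<lambda>n. s n i) \<longlonglongrightarrow> f i"
  then have s: "s n \<longlonglongrightarrow> 0" for n by simp
  have "f \<longlonglongrightarrow> 0"
  proof (rule LIMSEQ_I)
    fix e :: real assume e: "e > 0"
    obtain M where M: "\<And>m. m \<ge> M \<Longrightarrow> supn (\<lambda>i. s m i - s M i) < e / 2"
      using C[of "e / 2"] e by auto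
    \<comment> \<open>Letting \<open>m\<close> tend to infinity keeps the estimate, uniformly in
      \<open>i\<close>; the decay of the single sequence \<open>s M\<close> then forces that of
      \<open>f\<close>.\<close>
    have close: "cmod (f i - s M i) \<le> e / 2" for i
    proof (rule LIMSEQ_le_const2)
      show "(\<lambda>m. cmod (s m i - s M i)) \<longlonglongrightarrow> cmod (f i - s M i)"
        by (intro tendsto_norm tendsto_diff tendsto_const l)
      have "cmod (s m i - s M i) \<le> e / 2" if "m \<ge> M" for m
        using c0_upper[OF tendsto_diff[OF s[of m] s[of M], simplified], of i] M[OF that] by simp
      then show "\<exists>N. \<forall>m\<ge>N. cmod (s m i - s M i) \<le> e / 2" by blast
    qed
    obtain N where N: "\<And>i. i \<ge> N \<Longrightarrow> cmod (s M i) < e / 2"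
      using LIMSEQ_D[OF s[of M], of "e / 2"] e by auto
    have "cmod (f i - 0) < e" if "i \<ge> N" for i
      using norm_triangle_ineq[of "f i - s M i" "s M i"] close[of i] N[OF that] by simp
    then show "\<exists>no. \<forall>i\<ge>no. cmod (f i - 0) < e" by blast
  qed
  then show "f \<in> {f. f \<longlonglongrightarrow> 0}" by simp
qed

section \<open>The space of square-summable sequences\<close>

lemma l2_partial: "summable (\<lambda>i. (cmod (f i))\<^sup>2) \<Longrightarrow> (\<Sum>i<k. (cmod (f i))\<^sup>2) \<le> (l2n f)\<^sup>2"
  unfolding l2n_def by (simp add: suminf_nonneg sum_le_suminf)

text \<open>Gives membership and norm estimate at once from finite partial sums; sums, limits and
  shifts in \<open>l2\<close> are all handled through it.\<close>

lemma l2_bound: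
  assumes "\<And>k. (\<Sum>i<k. (cmod (f i))\<^sup>2) \<le> e\<^sup>2" "0 \<le> e"
  shows "summable (\<lambda>i. (cmod (f i))\<^sup>2)" "l2n f \<le> e"
proof -
  show s: "summable (\<lambda>i. (cmod (f i))\<^sup>2)"
    by (rule summableI_nonneg_bounded[of _ "e\<^sup>2"]) (use assms in auto)
  have "(\<Sum>i. (cmod (f i))\<^sup>2) \<le> e\<^sup>2"
    by (rule suminf_le_const[OF s]) (rule assms)
  then show "l2n f \<le> e" unfolding l2n_def using assms(2) by (intro real_le_lsqrt) (auto simp: suminf_nonneg s)
qed

lemma l2n_nonneg: "summable (\<lambda>i. (cmod (f i))\<^sup>2) \<Longrightarrow> 0 \<le> l2n f"
  by (simp add: l2n_def suminf_nonneg)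

lemma l2_add:
  assumes f: "summable (\<lambda>i. (cmod (f i))\<^sup>2)" and g: "summable (\<lambda>i. (cmod (g i))\<^sup>2)"
  shows "summable (\<lambda>i. (cmod (f i + g i))\<^sup>2)" "l2n (\<lambda>i. f i + g i) \<le> l2n f + l2n g"
proof -
  have "(\<Sum>i<k. (cmod (f i + g i))\<^sup>2) \<le> (l2n f + l2n g)\<^sup>2" for k
  proof -
    have nf: "L2_set (\<lambda>i. cmod (f i)) {..<k} \<le> l2n f"
      unfolding L2_set_def using l2_partial[OF f] l2n_nonneg[OF f] by (intro real_le_lsqrt) (auto simp: sum_nonneg)
    have ng: "L2_set (\<lambda>i. cmod (g i)) {..<k} \<le> l2n g"
      unfolding L2_set_def using l2_partial[OF g] l2n_nonneg[OF g] by (intro real_le_lsqrt) (auto simp: sum_nonneg)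
    have "(\<Sum>i<k. (cmod (f i + g i))\<^sup>2) \<le> (\<Sum>i<k. (cmod (f i) + cmod (g i))\<^sup>2)"
      by (intro sum_mono power_mono norm_triangle_ineq) auto
    also have "\<dots> = (L2_set (\<lambda>i. cmod (f i) + cmod (g i)) {..<k})\<^sup>2"
      unfolding L2_set_def by (simp add: sum_nonneg)
    also have "\<dots> \<le> (l2n f + l2n g)\<^sup>2"
      using L2_set_triangle_ineq[of "\<lambda>i. cmod (f i)" "\<lambda>i. cmod (g i)" "{..<k}"] nf ng
      by (intro power_mono) auto
    finally show ?thesis .
  qed
  from l2_bound[OF this] show "summable (\<lambda>i. (cmod (f i + g i))\<^sup>2)" "l2n (\<lambda>i. f i + g i) \<le> l2n f + l2n g"
    using l2n_nonneg[OF f] l2n_nonneg[OF g] by auto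
qed

lemma l2_smult:
  assumes f: "summable (\<lambda>i. (cmod (f i))\<^sup>2)"
  shows "summable (\<lambda>i. (cmod (c * f i))\<^sup>2)" "l2n (\<lambda>i. c * f i) = cmod c * l2n f"
  using summable_mult[OF f, of "(cmod c)\<^sup>2"] suminf_mult[OF f, of "(cmod c)\<^sup>2"]
  by (simp_all add: l2n_def norm_mult power_mult_distrib real_sqrt_mult)

lemma vspace_l2 [simp]: "vspace l2"
  unfolding l2_def by (rule vspace_seqsp) (simp_all add: l2_add l2_smult)

lemma l2_minus: "summable (\<lambda>i. (cmod (g i))\<^sup>2) \<Longrightarrow> f \<ominus>\<^bsub>l2\<^esub> g = (\<lambda>i. f i - g i)"
  using vspace_l2 seqsp_minus[of "{f. summable (\<lambda>i. (cmod (f i))\<^sup>2)}" l2n g f] unfolding l2_def by simp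

lemma l2_coord:
  assumes f: "summable (\<lambda>i. (cmod (f i))\<^sup>2)" shows "cmod (f i) \<le> l2n f"
proof -
  have "(cmod (f i))\<^sup>2 \<le> (\<Sum>k<Suc i. (cmod (f k))\<^sup>2)"
    by (rule member_le_sum) auto
  also have "\<dots> \<le> (l2n f)\<^sup>2" by (rule l2_partial[OF f])
  finally show ?thesis by (rule power2_le_imp_le[OF _ l2n_nonneg[OF f]])
qed

lemma normed_l2: "normed l2"
  unfolding normed_def normed_axioms_def
proof (intro conjI allI impI)
  fix f assume f: "f \<in> carrier l2"
  show "0 \<le> vnorm l2 f" using f l2n_nonneg by simp
  show "(vnorm l2 f = 0) = (f = \<zero>\<^bsub>l2\<^esub>)"
  proof
    assume "vnorm l2 f = 0"
    then have "cmod (f i) \<le> 0" for i using l2_coord[of f i] f by simp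
    then show "f = \<zero>\<^bsub>l2\<^esub>" by (simp add: fun_eq_iff)
  qed (simp add: l2n_def)
qed (simp_all add: l2_add l2_smult)

lemma l2_fatou:
  assumes s: "\<And>n. summable (\<lambda>i. (cmod (s n i))\<^sup>2)" and l: "\<And>i. (\<lambda>n. s n i) \<longlonglongrightarrow> f i"
    and b: "\<And>n. l2n (s n) \<le> e"
  shows "summable (\<lambda>i. (cmod (f i))\<^sup>2)" "l2n f \<le> e"
proof -
  have e: "0 \<le> e" using l2n_nonneg[OF s, of 0] b[of 0] by simp
  have "(\<Sum>i<k. (cmod (f i))\<^sup>2) \<le> e\<^sup>2" for k
  proof (rule LIMSEQ_le_const2)
    show "(\<lambda>n. \<Sum>i<k. (cmod (s n i))\<^sup>2) \<longlonglongrightarrow> (\<Sum>i<k. (cmod (f i))\<^sup>2)"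
      by (intro tendsto_sum tendsto_power tendsto_norm l)
    have "(\<Sum>i<k. (cmod (s n i))\<^sup>2) \<le> e\<^sup>2" for n
      using l2_partial[OF s, of n k] power_mono[OF b[of n] l2n_nonneg[OF s], of 2] by simp
    then show "\<exists>N. \<forall>n\<ge>N. (\<Sum>i<k. (cmod (s n i))\<^sup>2) \<le> e\<^sup>2" by blast
  qed
  from l2_bound[OF this e] show "summable (\<lambda>i. (cmod (f i))\<^sup>2)" "l2n f \<le> e" by auto
qed

lemma banach_l2 [simp]: "banach_space l2"
  unfolding l2_def
proof (rule banach_seqsp)
  show "normed (seqsp {f. summable (\<lambda>i. (cmod (f i))\<^sup>2)} l2n)" using normed_l2 by (simp add: l2_def)
  show "cmod (f i) \<le> l2n f" if "f \<in> {f. summable (\<lambda>i. (cmod (f i))\<^sup>2)}" for f i using that l2_coord by simp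
  show "l2n f \<le> e" if "\<And>n. s n \<in> {f. summable (\<lambda>i. (cmod (f i))\<^sup>2)}" "\<And>i. (\<lambda>n. s n i) \<longlonglongrightarrow> f i"
    "\<And>n. l2n (s n) \<le> e" for s f e using l2_fatou(2)[of s f e] that by simp
  fix s f assume "\<And>n. s n \<in> {f. summable (\<lambda>i. (cmod (f i))\<^sup>2)}"
    and C: "\<And>e. e > 0 \<Longrightarrow> \<exists>M. \<forall>m\<ge>M. \<forall>n\<ge>M. l2n (\<lambda>i. s m i - s n i) < e"
    and l: "\<And>i. (\<lambda>n. s n i) \<longlonglongrightarrow> f i"
  then have s: "summable (\<lambda>i. (cmod (s n i))\<^sup>2)" for n by simp
  obtain M where M: "\<And>m. m \<ge> M \<Longrightarrow> l2n (\<lambda>i. s m i - s M i) < 1"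
    using C[of 1] by auto
  \<comment> \<open>From \<open>M\<close> on the sequence stays within distance 1 of
    \<open>s M\<close>; the resulting norm bound is what \<open>l2_fatou\<close> needs to place the
    limit in the space.\<close>
  have "l2n (s (n + M)) \<le> 1 + l2n (s M)" for n
  proof -
    have "summable (\<lambda>i. (cmod (s (n + M) i + (-1) * s M i))\<^sup>2)"
      by (rule l2_add(1)[OF s l2_smult(1)[OF s]])
    then have d: "summable (\<lambda>i. (cmod (s (n + M) i - s M i))\<^sup>2)" by simp
    show ?thesis using l2_add(2)[OF d s[of M]] M[of "n + M"] by simp
  qed
  then have "summable (\<lambda>i. (cmod (f i))\<^sup>2)"
    by (rule l2_fatou(1)[OF s LIMSEQ_ignore_initial_segment[OF l]])
  then show "f \<in> {f. summable (\<lambda>i. (cmod (f i))\<^sup>2)}" by simp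
qed

lemma normed_c0 [simp]: "normed c0"
  by (rule banach_normed) simp

text \<open>By the parallelogram identity the two squares on the right average to the sum on the
  left, so one of them is at least that large. This is where the Hilbert space structure
  enters.\<close>

lemma l2_parallelogram:
  assumes f: "summable (\<lambda>i. (cmod (f i))\<^sup>2)" and g: "summable (\<lambda>i. (cmod (g i))\<^sup>2)"
  shows "(l2n f)\<^sup>2 + (l2n g)\<^sup>2 \<le> (l2n (\<lambda>i. f i + g i))\<^sup>2 \<or> (l2n f)\<^sup>2 + (l2n g)\<^sup>2 \<le> (l2n (\<lambda>i. f i - g i))\<^sup>2"
proof -
  have sq: "(l2n h)\<^sup>2 = (\<Sum>i. (cmod (h i))\<^sup>2)" if "summable (\<lambda>i. (cmod (h i))\<^sup>2)" for h
    using that by (simp add: l2n_def suminf_nonneg)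
  have p: "summable (\<lambda>i. (cmod (f i + g i))\<^sup>2)" by (rule l2_add(1)[OF f g])
  have "summable (\<lambda>i. (cmod (f i + (-1) * g i))\<^sup>2)" by (rule l2_add(1)[OF f l2_smult(1)[OF g]])
  then have m: "summable (\<lambda>i. (cmod (f i - g i))\<^sup>2)" by simp
  have pt: "(cmod (a + b))\<^sup>2 + (cmod (a - b))\<^sup>2 = 2 * (cmod a)\<^sup>2 + 2 * (cmod b)\<^sup>2" for a b :: complex
    unfolding cmod_power2 by (simp add: power2_eq_square algebra_simps)
  have "(\<Sum>i. (cmod (f i + g i))\<^sup>2) + (\<Sum>i. (cmod (f i - g i))\<^sup>2) =
      (\<Sum>i. 2 * (cmod (f i))\<^sup>2 + 2 * (cmod (g i))\<^sup>2)"
    unfolding suminf_add[OF p m] pt ..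
  also have "\<dots> = 2 * (\<Sum>i. (cmod (f i))\<^sup>2) + 2 * (\<Sum>i. (cmod (g i))\<^sup>2)"
    using suminf_add[OF summable_mult[OF f, of 2] summable_mult[OF g, of 2]]
    by (simp add: suminf_mult[OF f] suminf_mult[OF g])
  finally show ?thesis unfolding sq[OF f] sq[OF g] sq[OF p] sq[OF m] by linarith
qed

lemma c0_truncation:
  assumes f: "f \<longlonglongrightarrow> 0"
  shows "tr k f \<longlonglongrightarrow> 0" "(\<lambda>i. f i - tr k f i) \<longlonglongrightarrow> 0" "supn (\<lambda>i. f i - tr k f i) \<le> supn f"
proof -
  have "\<forall>\<^sub>F i in sequentially. tr k f i = 0"
    unfolding eventually_sequentially by (rule exI[of _ k]) (simp add: tr_def)
  then show t: "tr k f \<longlonglongrightarrow> 0" by (rule tendsto_eventually)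
  show "(\<lambda>i. f i - tr k f i) \<longlonglongrightarrow> 0" using tendsto_diff[OF f t] by simp
  have "cmod (f i - tr k f i) \<le> supn f" for i
    using c0_upper[OF f, of i] order_trans[OF norm_ge_zero c0_upper[OF f, of i]] by (auto simp: tr_def)
  then show "supn (\<lambda>i. f i - tr k f i) \<le> supn f" by (rule supn_least)
qed

text \<open>Otherwise there are infinitely many disjointly supported unit vectors of \<open>c\<^sub>0\<close> with images of
  length more than \<open>\<epsilon>\<close>. For suitable signs, partial sums have unbounded images by the
  parallelogram law, although their norms stay at most 1.\<close>

lemma c0_l2_small_on_tails:
  assumes T: "T \<in> \<B> c0 l2" and e: "\<epsilon> > 0"
  shows "\<exists>k. \<forall>x\<in>carrier c0. (\<forall>i<k. x i = 0) \<longrightarrow> l2n (T x) \<le> \<epsilon> * supn x"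
proof (rule ccontr)
  assume neg: "\<not> ?thesis"
  note TR = B_rules[OF vspace_c0 vspace_l2 T]
  obtain K where K: "K > 0" "\<And>x. x \<in> carrier c0 \<Longrightarrow> vnorm l2 (T x) \<le> K * vnorm c0 x"
    by (rule B_bound[OF normed_c0 T]) (rule that)
  have T2: "summable (\<lambda>i. (cmod (T x i))\<^sup>2)" if "x \<longlonglongrightarrow> 0" for x using TR(1)[of x] that by simp
  have bump: "\<exists>x l. x \<longlonglongrightarrow> 0 \<and> (\<forall>i<k. x i = 0) \<and> (\<forall>i\<ge>l. x i = 0) \<and> (\<forall>i. cmod (x i) \<le> 1) \<and> \<epsilon> \<le> l2n (T x)" for k
  proof -
    obtain x where x: "x \<longlonglongrightarrow> 0" "\<forall>i<k. x i = 0" "l2n (T x) > \<epsilon> * supn x"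
      using neg unfolding not_ex not_all not_imp not_le bex_simps Bex_def Ball_def c0_simps by blast
    have s0: "supn x \<ge> 0" using order_trans[OF norm_ge_zero c0_upper[OF x(1), of 0]] .
    have "supn x \<noteq> 0"
    proof
      assume "supn x = 0"
      then have "l2n (T x) \<le> 0" using K(2)[of x] x(1) by simp
      then show False using x(3) \<open>supn x = 0\<close> by simp
    qed
    then have s: "supn x > 0" using s0 by simp
    define y where "y = (\<lambda>i. complex_of_real (1 / supn x) * x i)"
    have y: "y \<longlonglongrightarrow> 0" unfolding y_def by (rule tendsto_mult_right_zero[OF x(1)])
    have y1: "cmod (y i) \<le> 1" for i
      using c0_upper[OF x(1), of i] s by (simp add: y_def norm_mult norm_divide)
    have "T y = (\<lambda>i. complex_of_real (1 / supn x) * T x i)"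
      using TR(3)[of x "complex_of_real (1 / supn x)"] x(1) by (simp add: y_def)
    then have "l2n (T y) = l2n (T x) / supn x"
      using l2_smult(2)[OF T2[OF x(1)], of "complex_of_real (1 / supn x)"] s by (simp add: norm_divide)
    then have yT: "l2n (T y) > \<epsilon>" using x(3) s by (simp add: pos_less_divide_eq)
    \<comment> \<open>The slack above \<open>\<epsilon>\<close>, divided by the bound
      \<open>K\<close>: cutting off a tail with entries smaller than this changes the image by at
      most the slack, so the truncated vector still has an image of length at least
      \<open>\<epsilon>\<close>.\<close>
    define \<delta> where "\<delta> = (l2n (T y) - \<epsilon>) / K"
    have \<delta>: "\<delta> > 0" using yT K(1) by (simp add: \<delta>_def)
    obtain l where l: "\<And>i. i \<ge> l \<Longrightarrow> cmod (y i) < \<delta>" using LIMSEQ_D[OF y \<delta>] by auto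
    note tt = c0_truncation[OF y, of l]
    have "supn (\<lambda>i. y i - tr l y i) \<le> \<delta>"
      by (rule supn_least) (use l \<delta> in \<open>auto simp: tr_def less_imp_le\<close>)
    then have "K * supn (\<lambda>i. y i - tr l y i) \<le> K * \<delta>" using K(1) by simp
    then have "l2n (T (\<lambda>i. y i - tr l y i)) \<le> K * \<delta>"
      using K(2)[of "\<lambda>i. y i - tr l y i"] tt(2) by simp
    also have "\<dots> = l2n (T y) - \<epsilon>" using K(1) by (simp add: \<delta>_def)
    finally have d: "l2n (T (\<lambda>i. y i - tr l y i)) \<le> l2n (T y) - \<epsilon>" .
    have "T y = (\<lambda>i. T (tr l y) i + T (\<lambda>i. y i - tr l y i) i)"
      using TR(2)[of "tr l y" "\<lambda>i. y i - tr l y i"] tt by simp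
    then have "l2n (T y) \<le> l2n (T (tr l y)) + l2n (T (\<lambda>i. y i - tr l y i))"
      using l2_add(2)[OF T2[OF tt(1)] T2[OF tt(2)]] by simp
    then have "\<epsilon> \<le> l2n (T (tr l y))" using d by simp
    moreover have "\<forall>i<k. tr l y i = 0" using x(2) by (simp add: tr_def y_def)
    moreover have "\<forall>i\<ge>l. tr l y i = 0" by (simp add: tr_def)
    moreover have "\<forall>i. cmod (tr l y i) \<le> 1" using y1 by (simp add: tr_def)
    ultimately show ?thesis using tt(1) by blast
  qed
  \<comment> \<open>The next bump starts where \<open>a\<close> ends, so adding it with either sign
    keeps all entries at most 1 in modulus, and one of the signs raises the squared length of the
    image by at least the square of \<open>\<epsilon>\<close>. For large \<open>n\<close> this
    exceeds the square of \<open>K\<close>, the bound on the image of any such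
    \<open>a\<close>.\<close>
  have "\<exists>a k. a \<longlonglongrightarrow> 0 \<and> (\<forall>i\<ge>k. a i = 0) \<and> (\<forall>i. cmod (a i) \<le> 1) \<and> real n * \<epsilon>\<^sup>2 \<le> (l2n (T a))\<^sup>2" for n
  proof (induction n)
    case 0
    show ?case by (rule exI[of _ "\<lambda>_. 0"]) auto
  next
    case (Suc n)
    then obtain a k where a: "a \<longlonglongrightarrow> 0" "\<forall>i\<ge>k. a i = 0" "\<forall>i. cmod (a i) \<le> 1" "real n * \<epsilon>\<^sup>2 \<le> (l2n (T a))\<^sup>2"
      by blast
    obtain x l where x: "x \<longlonglongrightarrow> 0" "\<forall>i<k. x i = 0" "\<forall>i\<ge>l. x i = 0" "\<forall>i. cmod (x i) \<le> 1" "\<epsilon> \<le> l2n (T x)"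
      using bump[of k] by blast
    have p: "(\<lambda>i. a i + x i) \<longlonglongrightarrow> 0" and m: "(\<lambda>i. a i - x i) \<longlonglongrightarrow> 0"
      using tendsto_add[OF a(1) x(1)] tendsto_diff[OF a(1) x(1)] by simp_all
    have Tp: "T (\<lambda>i. a i + x i) = (\<lambda>i. T a i + T x i)" using TR(2)[of a x] a(1) x(1) by simp
    have Tm: "T (\<lambda>i. a i - x i) = (\<lambda>i. T a i - T x i)"
      using TR(6)[of a x] a(1) x(1) by (simp add: c0_minus l2_minus T2)
    have "\<epsilon>\<^sup>2 \<le> (l2n (T x))\<^sup>2" using x(5) e by (intro power_mono) auto
    then have "real (Suc n) * \<epsilon>\<^sup>2 \<le> (l2n (T a))\<^sup>2 + (l2n (T x))\<^sup>2" using a(4) by (simp add: algebra_simps)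
    then have "real (Suc n) * \<epsilon>\<^sup>2 \<le> (l2n (T (\<lambda>i. a i + x i)))\<^sup>2 \<or> real (Suc n) * \<epsilon>\<^sup>2 \<le> (l2n (T (\<lambda>i. a i - x i)))\<^sup>2"
      unfolding Tp Tm using l2_parallelogram[OF T2[OF a(1)] T2[OF x(1)]] by linarith
    moreover have "cmod (a i + x i) \<le> 1 \<and> cmod (a i - x i) \<le> 1" for i
      using a(2,3) x(2,4) by (cases "i < k") auto
    moreover have "\<forall>i\<ge>max k l. a i + x i = 0 \<and> a i - x i = 0" using a(2) x(3) by simp
    ultimately show ?case using p m by blast
  qed
  note big = this
  obtain n :: nat where n: "K\<^sup>2 < real n * \<epsilon>\<^sup>2"
    using reals_Archimedean3[of "\<epsilon>\<^sup>2"] e by (auto simp: zero_less_power)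
  obtain a where a: "a \<longlonglongrightarrow> 0" "\<forall>i. cmod (a i) \<le> 1" "real n * \<epsilon>\<^sup>2 \<le> (l2n (T a))\<^sup>2"
    using big[of n] by blast
  have "supn a \<le> 1" by (rule supn_least) (use a(2) in simp)
  then have "K * supn a \<le> K" using K(1) by simp
  then have "l2n (T a) \<le> K" using K(2)[of a] a(1) by simp
  then have "(l2n (T a))\<^sup>2 \<le> K\<^sup>2" using l2n_nonneg[OF T2[OF a(1)]] by (intro power_mono) auto
  then show False using n a(3) by simp
qed

section \<open>Shift operators and their coupling\<close>

definition rshift :: "(nat \<Rightarrow> complex) \<Rightarrow> nat \<Rightarrow> complex"
  where "rshift f = (\<lambda>i. case i of 0 \<Rightarrow> 0 | Suc k \<Rightarrow> f k)"

definition lshift :: "(nat \<Rightarrow> complex) \<Rightarrow> nat \<Rightarrow> complex"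
  where "lshift f = (\<lambda>i. f (Suc i))"

lemma rshift_simps [simp]: "rshift f 0 = 0" "rshift f (Suc i) = f i"
  by (simp_all add: rshift_def)

lemma lshift_simps [simp]: "lshift f i = f (Suc i)"
  by (simp add: lshift_def)

lemma rshift_linear: "rshift (\<lambda>i. f i + g i) = (\<lambda>i. rshift f i + rshift g i)"
  "rshift (\<lambda>i. c * f i) = (\<lambda>i. c * rshift f i)"
  by (auto simp: fun_eq_iff rshift_def split: nat.split)

lemma rshift_c0: "rshift \<in> \<B> c0 c0"
proof (rule B_I[where K = 1])
  have c: "rshift f \<longlonglongrightarrow> 0" if "f \<longlonglongrightarrow> 0" for f
    by (rule LIMSEQ_imp_Suc) (use that in simp)
  show "rshift \<in> Lin c0 c0"
    by (rule Lin_I) (simp_all add: c rshift_linear)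
  fix f assume "f \<in> carrier c0"
  then have f: "f \<longlonglongrightarrow> 0" by simp
  have "cmod (rshift f i) \<le> supn f" for i
    using c0_upper[OF f] order_trans[OF norm_ge_zero c0_upper[OF f, of 0]] by (cases i) auto
  then show "vnorm c0 (rshift f) \<le> 1 * vnorm c0 f" by (simp add: supn_least)
qed

lemma lshift_c0: "lshift \<in> \<B> c0 c0"
proof (rule B_I[where K = 1])
  have c: "lshift f \<longlonglongrightarrow> 0" if "f \<longlonglongrightarrow> 0" for f
    unfolding lshift_def by (rule LIMSEQ_Suc[OF that])
  show "lshift \<in> Lin c0 c0"
    by (rule Lin_I) (auto simp: c fun_eq_iff)
  fix f assume "f \<in> carrier c0"
  then have f: "f \<longlonglongrightarrow> 0" by simp
  then show "vnorm c0 (lshift f) \<le> 1 * vnorm c0 f" using c0_upper[OF f] by (simp add: supn_least)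
qed

lemma rshift_l2: "rshift \<in> \<B> l2 l2"
proof (rule B_I[where K = 1])
  have b: "(\<Sum>i<k. (cmod (rshift f i))\<^sup>2) \<le> (l2n f)\<^sup>2" if f: "summable (\<lambda>i. (cmod (f i))\<^sup>2)" for f k
  proof (cases k)
    case (Suc k')
    then show ?thesis using l2_partial[OF f, of k'] by (simp add: sum.lessThan_Suc_shift del: sum.lessThan_Suc)
  qed simp
  have c: "summable (\<lambda>i. (cmod (rshift f i))\<^sup>2)" "l2n (rshift f) \<le> l2n f" if "summable (\<lambda>i. (cmod (f i))\<^sup>2)" for f
    using l2_bound[OF b[OF that]] l2n_nonneg[OF that] by auto
  show "rshift \<in> Lin l2 l2"
    by (rule Lin_I) (simp_all add: c rshift_linear)
  show "vnorm l2 (rshift f) \<le> 1 * vnorm l2 f" if "f \<in> carrier l2" for f using that c by simp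
qed

lemma lshift_l2: "lshift \<in> \<B> l2 l2"
proof (rule B_I[where K = 1])
  have b: "(\<Sum>i<k. (cmod (lshift f i))\<^sup>2) \<le> (l2n f)\<^sup>2" if f: "summable (\<lambda>i. (cmod (f i))\<^sup>2)" for f k
    using l2_partial[OF f, of "Suc k"] unfolding sum.lessThan_Suc_shift
    by simp (smt (verit) zero_le_power2)
  have c: "summable (\<lambda>i. (cmod (f (Suc i)))\<^sup>2)" "l2n (lshift f) \<le> l2n f" if f: "summable (\<lambda>i. (cmod (f i))\<^sup>2)" for f
    using l2_bound(1)[OF b[OF f] l2n_nonneg[OF f]] l2_bound(2)[OF b[OF f] l2n_nonneg[OF f]]
    unfolding lshift_simps by blast+
  show "lshift \<in> Lin l2 l2"
    by (rule Lin_I) (auto simp: c fun_eq_iff)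
  show "vnorm l2 (lshift f) \<le> 1 * vnorm l2 f" if "f \<in> carrier l2" for f using that c by simp
qed

text \<open>A rank one map reading entry 0: it transports the direction missing from the range of
  the shift from one space to the other.\<close>

lemma tr1_c0_l2: "tr 1 \<in> \<B> c0 l2"
proof (rule B_I[where K = 1])
  have s: "(\<Sum>i<k. (cmod (tr 1 f i))\<^sup>2) \<le> (cmod (f 0))\<^sup>2" for f k
    by (cases k) (simp_all add: sum.lessThan_Suc_shift tr_def del: sum.lessThan_Suc)
  note b = l2_bound[OF s]
  show "tr 1 \<in> Lin c0 l2"
    by (rule Lin_I) (use b(1) in \<open>auto simp: tr_def fun_eq_iff\<close>)
  show "vnorm l2 (tr 1 f) \<le> 1 * vnorm c0 f" if "f \<in> carrier c0" for f
    using b(2)[of f] c0_upper[of f 0] that by simp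
qed

lemma tr1_l2_c0: "tr 1 \<in> \<B> l2 c0"
proof (rule B_I[where K = 1])
  have b: "tr 1 f \<longlonglongrightarrow> 0" for f
    by (rule tendsto_eventually) (auto simp: eventually_sequentially tr_def intro!: exI[of _ 1])
  show "tr 1 \<in> Lin l2 c0"
    by (rule Lin_I) (use b in \<open>auto simp: tr_def fun_eq_iff\<close>)
  fix f assume f: "f \<in> carrier l2"
  have "supn (tr 1 f) \<le> l2n f"
    by (rule supn_least) (use f l2_coord[of f 0] l2n_nonneg[of f] in \<open>auto simp: tr_def\<close>)
  then show "vnorm c0 (tr 1 f) \<le> 1 * vnorm l2 f" by simp
qed

text \<open>Both shifts are injective with range of codimension 1. The operator playing
  \<open>F\<close> merely swaps the summands. \<open>E\<close> keeps \<open>lshift f\<close> in the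
  space of \<open>f\<close> and hands entry 0 to the other space, where the right shift has made
  room; it is undone by \<open>f = tr 1 f + rshift (lshift f)\<close>. On shifted sequences entry 0
  is zero and nothing is handed over.\<close>

lemma rshift_EAE: "EAE c0 l2 rshift rshift"
proof -
  note l2n = normed_l2
  define E where "E w = (tr 1 (fst w) \<oplus>\<^bsub>c0\<^esub> rshift (snd w), lshift (fst w))" for w
  define H where "H z = (tr 1 (fst z) \<oplus>\<^bsub>l2\<^esub> rshift (snd z), lshift (fst z))" for z
  have E: "E \<in> \<B> (l2 \<oplus>\<^sub>B c0) (c0 \<oplus>\<^sub>B l2)" unfolding E_def
    by (intro B_pair B_add B_comp[OF _ _ tr1_l2_c0] B_comp[OF _ _ rshift_c0] B_comp[OF _ _ lshift_l2]
      B_fst B_snd normed_dsum normed_c0 l2n)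
  have H: "H \<in> \<B> (c0 \<oplus>\<^sub>B l2) (l2 \<oplus>\<^sub>B c0)" unfolding H_def
    by (intro B_pair B_add B_comp[OF _ _ tr1_c0_l2] B_comp[OF _ _ rshift_l2] B_comp[OF _ _ lshift_c0]
      B_fst B_snd normed_dsum normed_c0 l2n)
  have tl: "(\<lambda>i. tr 1 f i + rshift (lshift f) i) = f" for f
    by (auto simp: tr_def rshift_def fun_eq_iff split: nat.split)
  have ltr: "lshift (\<lambda>i. tr 1 f i + rshift g i) = g" for f g
    by (auto simp: tr_def fun_eq_iff)
  have trt: "tr 1 (\<lambda>i. tr 1 f i + rshift g i) = tr 1 f" for f g
    by (auto simp: tr_def fun_eq_iff)
  have tr_r: "(\<lambda>i. tr 1 (rshift f) i + g i) = g" for f g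
    by (auto simp: tr_def fun_eq_iff)
  have lr: "lshift (rshift f) = f" for f by (auto simp: fun_eq_iff)
  have tl': "(\<lambda>i. tr 1 (\<lambda>i. tr 1 f i + rshift g i) i + rshift (lshift f) i) = f" for f g
    unfolding trt by (rule tl)
  have EH: "inverse_ops (l2 \<oplus>\<^sub>B c0) (c0 \<oplus>\<^sub>B l2) E H" unfolding inverse_ops_def
    by (intro conjI E H ballI) (simp_all only: E_def H_def c0_simps l2_simps fst_conv snd_conv tl' ltr prod.collapse)
  let ?F = "\<lambda>z. (snd z, fst z)"
  have FF: "inverse_ops (c0 \<oplus>\<^sub>B l2) (l2 \<oplus>\<^sub>B c0) ?F ?F" unfolding inverse_ops_def
    by (intro conjI ballI B_pair B_fst B_snd normed_dsum normed_c0 l2n) simp_all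
  have "map_prod rshift id z = E (map_prod rshift id (?F z))" for z
    by (cases z) (simp only: E_def map_prod_simp fst_conv snd_conv id_apply c0_simps tr_r lr)
  then have "EAE_via c0 l2 rshift rshift l2 c0"
    unfolding EAE_via_def invertible_op_def using EH FF banach_c0 banach_l2 by blast
  then show ?thesis unfolding EAE_def by blast
qed

text \<open>Schur coupling makes the shift on \<open>c\<^sub>0\<close> a finite-rank perturbation of an isomorphism, but it is
  injective and not surjective.\<close>

lemma rshift_not_SC: "\<not> SC c0 l2 rshift rshift"
proof
  note l2n = normed_l2
  note XV = vspace_c0 note YV = vspace_l2
  assume "SC c0 l2 rshift rshift"
  then obtain A B C D A' D' where B: "B \<in> \<B> l2 c0" and C: "C \<in> \<B> c0 l2"
    and AA: "inverse_ops c0 c0 A A'" and DD: "inverse_ops l2 l2 D D'"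
    and Ueq: "\<And>x. x \<in> carrier c0 \<Longrightarrow> rshift x = A x \<ominus>\<^bsub>c0\<^esub> B (D' (C x))"
    unfolding SC_def by blast
  note a = inverse_opsD[OF AA] and dd = inverse_opsD[OF DD]
  define R where "R y = A' (B (D' y))" for y
  have R: "R \<in> \<B> l2 c0" unfolding R_def
    by (rule B_comp[OF l2n normed_c0 a(2) B_comp[OF l2n l2n B dd(2)]])
  obtain r where r: "r > 0" "\<And>y. y \<in> carrier l2 \<Longrightarrow> vnorm c0 (R y) \<le> r * vnorm l2 y"
    by (rule B_bound[OF l2n R]) (rule that)
  \<comment> \<open>\<open>R\<close> has bound \<open>r\<close>, so with this tolerance
    \<open>R C\<close> has norm at most 1/2 on sequences vanishing below \<open>k\<close>, as the
    contraction argument requires.\<close>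
  have "1 / (2 * r) > 0" using r(1) by simp
  from c0_l2_small_on_tails[OF C this] obtain k
    where k: "\<forall>x\<in>carrier c0. (\<forall>i<k. x i = 0) \<longrightarrow> l2n (C x) \<le> 1 / (2 * r) * supn x" by (rule exE)
  have trL: "tr k \<in> Lin c0 (Cn k)" by (rule Lin_I) (auto simp: tr_def fun_eq_iff Cn_simps)
  have incl: "(\<lambda>c. c) \<in> Lin (Cn k) c0"
  proof (rule Lin_I)
    fix c assume "c \<in> carrier (Cn k)"
    then have "\<forall>\<^sub>F i in sequentially. c i = 0" by (auto simp: Cn_simps eventually_sequentially)
    then show "c \<in> carrier c0" by (simp add: tendsto_eventually)
  qed (auto simp: Cn_simps)
  note RC = Lin_comp[OF B_Lin[OF R] B_Lin[OF C]]
  note RCR = Lin_rules[OF XV XV RC]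
  have trL': "tr k \<in> Lin c0 c0" using Lin_comp[OF incl trL] by simp
  \<comment> \<open>\<open>I + K\<close> is \<open>I - R C\<close> with \<open>R C\<close> applied
    to tails only, and \<open>K\<close> is a contraction by the choice of \<open>k\<close>. The
    operator \<open>I - R C\<close> itself differs from \<open>I + K\<close> by \<open>- R C\<close>
    on the first \<open>k\<close> coordinates, hence by finite rank.\<close>
  define K where "K x = \<ominus>\<^bsub>c0\<^esub> R (C (x \<ominus>\<^bsub>c0\<^esub> tr k x))" for x
  have KL: "K \<in> Lin c0 c0"
  proof -
    have "(\<lambda>x. (-1) \<odot>\<^bsub>c0\<^esub> R (C (x \<ominus>\<^bsub>c0\<^esub> tr k x))) \<in> Lin c0 c0"
      by (rule Lin_smult[OF XV Lin_comp[OF RC Lin_minus[OF XV Lin_id trL']]])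
    moreover have "K x = (-1) \<odot>\<^bsub>c0\<^esub> R (C (x \<ominus>\<^bsub>c0\<^esub> tr k x))" if "x \<in> carrier c0" for x
      unfolding K_def by (rule vspace.neg_smult[OF XV RCR(1)[OF vspace.minus_in[OF XV that Lin_rules(1)[OF XV XV trL' that]]]])
    ultimately show ?thesis unfolding Lin_def by (simp add: Pi_iff vspace.smult_in[OF XV] vspace.add_in[OF XV] del: c0_simps)
  qed
  have Kn: "vnorm c0 (K x) \<le> 1/2 * vnorm c0 x" if x: "x \<in> carrier c0" for x
  proof -
    have x0: "x \<longlonglongrightarrow> 0" using x by simp
    note tt = c0_truncation[OF x0, of k]
    have d: "x \<ominus>\<^bsub>c0\<^esub> tr k x = (\<lambda>i. x i - tr k x i)" by (rule c0_minus[OF tt(1)])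
    have dc: "(\<lambda>i. x i - tr k x i) \<in> carrier c0" using tt(2) by simp
    have Cc: "C (\<lambda>i. x i - tr k x i) \<in> carrier l2" by (rule B_rules(1)[OF XV YV C dc])
    have "vnorm c0 (K x) = vnorm c0 (R (C (\<lambda>i. x i - tr k x i)))"
      unfolding K_def d by (rule normed.nm_neg[OF normed_c0 RCR(1)[OF dc]])
    also have "\<dots> \<le> r * l2n (C (\<lambda>i. x i - tr k x i))" using r(2)[OF Cc] by simp
    also have "\<dots> \<le> r * (1 / (2 * r) * supn (\<lambda>i. x i - tr k x i))"
      using r(1) bspec[OF k dc] by (intro mult_left_mono) (auto simp: tr_def)
    also have "\<dots> = 1/2 * supn (\<lambda>i. x i - tr k x i)" using r(1) by simp
    also have "\<dots> \<le> 1/2 * supn x" using tt(3) by simp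
    finally show ?thesis by simp
  qed
  note N = neumann[OF banach_c0 KL _ Kn]
  define J where "J = (\<lambda>x. x \<oplus>\<^bsub>c0\<^esub> K x)"
  have JL: "J \<in> Lin c0 c0" unfolding J_def by (rule Lin_add[OF XV Lin_id KL])
  have J: "bijL c0 c0 J" unfolding bijL_def using N JL unfolding J_def by simp
  define T where "T x = x \<ominus>\<^bsub>c0\<^esub> R (C x)" for x
  have TL: "T \<in> Lin c0 c0" unfolding T_def by (rule Lin_minus[OF XV Lin_id RC])
  have "finrk c0 c0 (\<lambda>x. T x \<ominus>\<^bsub>c0\<^esub> J x)"
  proof (rule finrkI[OF Lin_smult[OF XV Lin_comp[OF RC incl], of "-1"] trL])
    fix x assume x: "x \<in> carrier c0"
    have tx: "tr k x \<in> carrier c0" by (rule Lin_rules(1)[OF XV XV trL' x])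
    have K: "K x = \<ominus>\<^bsub>c0\<^esub> (R (C x) \<ominus>\<^bsub>c0\<^esub> R (C (tr k x)))"
      unfolding K_def by (subst RCR(6)[OF x tx]) (rule refl)
    show "T x \<ominus>\<^bsub>c0\<^esub> J x = (-1) \<odot>\<^bsub>c0\<^esub> R (C (tr k x))"
      unfolding T_def J_def K
      by (rule vspace.vec_eqI[OF XV])
        (use x RCR(1)[OF x] RCR(1)[OF tx] in \<open>simp_all add: vec_ev[OF XV] vspace.add_in[OF XV]
          vspace.smult_in[OF XV] vspace.minus_in[OF XV] vspace.neg_in[OF XV] del: c0_simps\<close>)
  qed
  then have TIS: "inj_on T (carrier c0) \<longleftrightarrow> T ` carrier c0 = carrier c0"
    by (rule finrk_perturbation[OF XV XV J TL])
  have AT: "A (T x) = rshift x" if x: "x \<in> carrier c0" for x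
  proof -
    have BDC: "B (D' (C x)) \<in> carrier c0"
      by (rule B_rules(1)[OF YV XV B B_rules(1)[OF YV YV dd(2) B_rules(1)[OF XV YV C x]]])
    have "A (T x) = A x \<ominus>\<^bsub>c0\<^esub> A (R (C x))" unfolding T_def
      by (rule B_rules(6)[OF XV XV a(1) x RCR(1)[OF x]])
    also have "A (R (C x)) = B (D' (C x))" unfolding R_def by (rule a(4)[OF BDC])
    finally show ?thesis using Ueq[OF x] by simp
  qed
  have "inj_on T (carrier c0)"
  proof (rule inj_onI)
    fix x y assume xy: "x \<in> carrier c0" "y \<in> carrier c0" "T x = T y"
    have "rshift x = rshift y" using AT[OF xy(1)] AT[OF xy(2)] xy(3) by simp
    then have "rshift x (Suc i) = rshift y (Suc i)" for i by simp
    then show "x = y" by (simp add: fun_eq_iff)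
  qed
  then have surj: "T ` carrier c0 = carrier c0" using TIS by blast
  have u: "un 0 \<in> carrier c0"
    unfolding c0_simps by (rule tendsto_eventually) (auto simp: eventually_sequentially un_def intro!: exI[of _ 1])
  have "A' (un 0) \<in> carrier c0" by (rule B_rules(1)[OF XV XV a(2) u])
  then obtain x where x: "x \<in> carrier c0" "A' (un 0) = T x" using surj by blast
  have "un 0 = rshift x" using AT[OF x(1)] a(4)[OF u] unfolding x(2) by simp
  then have "un 0 0 = rshift x 0" by simp
  then show False by (simp add: un_def)
qed

text \<open>Infinite dimension in the first claim excludes degenerate pairs. If one of the two
  spaces is zero, the pair is essentially incomparable, yet the identity operators on both spaces
  are equivalent after one-sided extension of the zero space by the other one.\<close>

theorem theorem2p1:
  shows "(\<forall>(X :: 'u nspace) (Y :: 'u nspace) U V.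
      banach_space X \<longrightarrow> banach_space Y \<longrightarrow> U \<in> \<B> X X \<longrightarrow> V \<in> \<B> Y Y \<longrightarrow>
      essentially_incomparable X Y \<longrightarrow>
        (\<not> finite_dim X (carrier X) \<longrightarrow> \<not> finite_dim Y (carrier Y) \<longrightarrow> \<not> EAOE X Y U V) \<and>
        (SC X Y U V \<longleftrightarrow>
          fredholm_index_0 X X U \<and> fredholm_index_0 Y Y V \<and>
          vdim X (Ker X X U) = vdim Y (Ker Y Y V)) \<and>
        (fredholm_index_0 X X U \<and> fredholm_index_0 Y Y V \<and>
          vdim X (Ker X X U) = vdim Y (Ker Y Y V) \<longrightarrow>
          vdim X (Coker X X U) = vdim Y (Coker Y Y V)) \<and>
        (EAE X Y U V \<longleftrightarrow>
          fredholm X X U \<and> fredholm Y Y V \<and>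
          vdim X (Ker X X U) = vdim Y (Ker Y Y V) \<and>
          vdim X (Coker X X U) = vdim Y (Coker Y Y V))) \<and>
    (\<exists>(X :: (nat \<Rightarrow> complex) nspace) (Y :: (nat \<Rightarrow> complex) nspace) U V.
      banach_space X \<and> banach_space Y \<and> U \<in> \<B> X X \<and> V \<in> \<B> Y Y \<and>
      EAE X Y U V \<and> \<not> SC X Y U V)"
proof (intro conjI)
  show "\<exists>(X :: (nat \<Rightarrow> complex) nspace) (Y :: (nat \<Rightarrow> complex) nspace) U V.
      banach_space X \<and> banach_space Y \<and> U \<in> \<B> X X \<and> V \<in> \<B> Y Y \<and>
      EAE X Y U V \<and> \<not> SC X Y U V"
    using banach_c0 banach_l2 rshift_c0 rshift_l2 rshift_EAE rshift_not_SC by blast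
\<comment> \<open>For the clause on cokernels: index 0 makes both cokernel dimensions equal to the
  common kernel dimension.\<close>
qed (intro allI impI conjI incomparable_not_EAOE incomparable_SC_iff incomparable_EAE_iff;
  auto simp: fredholm_index_0_def)

end
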